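(* Let $\omega\subset\mathbb R^2$ be a bounded domain, let $\mu\in(0,2)$ and let $\lambda=\frac{4-\mu}4$. Suppose $0<a\le b<\infty$ and $\Lambda\subset\Lambda_{a,b}(\omega)$ is a subset that is equicontinuous at each point of $\omega$. For each compact subset $K\subset\omega$, each $c_0>0$, and each $C_1>1$ there is a constant $C_2=C_2(\Lambda,K,\omega,c_0,C_1)>0$ such that if $V\in\Lambda$, if $\Omega\subset\mathbb R^2$ is a bounded domain for which $\omega\subset\Omega$, and if $u$ is a distributional solution to $$\begin{cases}-\Delta u=V\,I_\mu[e^{\lambda u}\chi_\Omega]\,e^{\lambda u}&\text{in }\omega,\\ \|e^u\|_{L^1(\Omega)}\le c_0,\end{cases}$$ then $$\max_Ku+C_1\inf_\omega u\le C_2.$$ In particular $C_2$ is independent of $\Omega$.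
   Context: For $\mu\in(0,2)$, $I_\mu f(x)=\int_{\mathbb R^2}\frac{f(y)}{|x-y|^\mu}\,dy$. $\chi_A$ is the characteristic function of $A$ (a product $g\chi_A$ is extended by zero outside $A$). For $S\subset\mathbb R^2$ and $a\le b$, $\Lambda_{a,b}(S)=\{V\in C^0(S):a\le V\le b\text{ in }S\}$. Here $u:\Omega\to\mathbb R$ is a function with $u\in L^1_{\mathrm{loc}}(\omega)$; a distributional solution of $-\Delta u=f$ in $\omega$ (with $f\in L^1(\omega)$) satisfies $-\int_\omega u\,\Delta\varphi=\int_\omega f\varphi$ for all $\varphi\in C_c^\infty(\omega)$. Under the stated hypotheses the right-hand side lies in $L^1(\omega)$, and solutions are identified on $\omega$ with their continuous representatives. *)

theory Defs
  imports "HOL-Analysis.Analysis"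
begin

text \<open>Functions on a subset of the plane are represented by total functions on
  \<^typ>\<open>real^2\<close>; only their values on that subset are ever used.\<close>

definition bounded_domain :: "(real^2) set \<Rightarrow> bool" where
  "bounded_domain S \<longleftrightarrow> open S \<and> connected S \<and> S \<noteq> {} \<and> bounded S"

text \<open>The convention \<open>x / 0 = 0\<close> affects the kernel only at the single point \<open>y = x\<close>.\<close>

definition riesz_potential :: "real \<Rightarrow> (real^2 \<Rightarrow> real) \<Rightarrow> real^2 \<Rightarrow> real" where
  "riesz_potential \<mu> f x = (LINT y|lebesgue. f y / norm (x - y) powr \<mu>)"

definition Lambda_class :: "real \<Rightarrow> real \<Rightarrow> (real^2) set \<Rightarrow> (real^2 \<Rightarrow> real) set" where
  "Lambda_class a b S = {V. continuous_on S V \<and> (\<forall>x\<in>S. a \<le> V x \<and> V x \<le> b)}"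

definition equicontinuous_at_points :: "(real^2) set \<Rightarrow> (real^2 \<Rightarrow> real) set \<Rightarrow> bool" where
  "equicontinuous_at_points S F \<longleftrightarrow>
     (\<forall>x\<in>S. \<forall>\<epsilon>>0. \<exists>\<delta>>0. \<forall>V\<in>F. \<forall>y\<in>S. dist y x < \<delta> \<longrightarrow> dist (V y) (V x) < \<epsilon>)"

definition partial_deriv :: "real^2 \<Rightarrow> (real^2 \<Rightarrow> real) \<Rightarrow> real^2 \<Rightarrow> real" where
  "partial_deriv i f x = frechet_derivative f (at x) i"

definition laplacian :: "(real^2 \<Rightarrow> real) \<Rightarrow> real^2 \<Rightarrow> real" where
  "laplacian f x = (\<Sum>i\<in>Basis. partial_deriv i (partial_deriv i f) x)"

fun C_k :: "nat \<Rightarrow> (real^2 \<Rightarrow> real) \<Rightarrow> bool" where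
  "C_k 0 f \<longleftrightarrow> continuous_on UNIV f"
| "C_k (Suc k) f \<longleftrightarrow> f differentiable_on UNIV \<and> (\<forall>i\<in>Basis. C_k k (partial_deriv i f))"

text \<open>\<open>C\<^sub>c\<^sup>\<infinity>(S)\<close> for open \<open>S\<close>, each function being extended by zero to the whole plane.\<close>

definition test_functions :: "(real^2) set \<Rightarrow> (real^2 \<Rightarrow> real) set" where
  "test_functions S =
     {\<phi>. (\<forall>k. C_k k \<phi>) \<and> compact (closure {x. \<phi> x \<noteq> 0}) \<and> closure {x. \<phi> x \<noteq> 0} \<subseteq> S}"

definition locally_L1 :: "(real^2) set \<Rightarrow> (real^2 \<Rightarrow> real) \<Rightarrow> bool" where
  "locally_L1 S u \<longleftrightarrow> (\<forall>K. compact K \<and> K \<subseteq> S \<longrightarrow> set_integrable lebesgue K u)"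

text \<open>\<open>u \<in> L\<^sup>1\<^sub>l\<^sub>o\<^sub>c(S)\<close> solves \<open>-\<Delta>u = f\<close> in \<open>S\<close>, with \<open>f \<in> L\<^sup>1(S)\<close>, in the sense of distributions.\<close>

definition distributional_solution ::
    "(real^2) set \<Rightarrow> (real^2 \<Rightarrow> real) \<Rightarrow> (real^2 \<Rightarrow> real) \<Rightarrow> bool" where
  "distributional_solution S u f \<longleftrightarrow>
     locally_L1 S u \<and> set_integrable lebesgue S f \<and>
     (\<forall>\<phi>\<in>test_functions S.
        - (LINT x:S|lebesgue. u x * laplacian \<phi> x) = (LINT x:S|lebesgue. f x * \<phi> x))"

end

theory Submission
  imports Defs "HOL-Complex_Analysis.Great_Picard" "HOL-Real_Asymp.Real_Asymp"
begin

text \<open>Suppose the bound fails along a sequence. Then \<open>max\<^sub>K u \<rightarrow> \<infinity>\<close>, and rescaling around suitable points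
  \<open>x\<^sub>n\<close> with \<open>u (x\<^sub>n) \<ge> max\<^sub>K u\<close> produces, by compactness, a limit solution \<open>-\<Delta>v = W I\<^sub>\<mu>[e\<^bsup>\<lambda>v\<^esup>] e\<^bsup>\<lambda>v\<^esup>\<close> on the
  whole plane; equicontinuity of the coefficients makes \<open>W\<close> constant, and the mass of \<open>e\<^sup>u\<close> far away
  contributes nothing to the potential in the limit. A Pohozaev argument shows that such a solution has
  mass at least \<open>8\<pi>\<close>. Hence for every \<open>\<epsilon> > 0\<close> mass \<open>8\<pi> - \<epsilon>\<close> concentrates at scale \<open>e\<^bsup>-u(x\<^sub>n)/2\<^esup>\<close> around \<open>x\<^sub>n\<close>, and
  the mean value formula on a disc of fixed radius yields \<open>inf u \<le> u (x\<^sub>n) - (4 - \<epsilon>') u (x\<^sub>n) / 2 + C\<close>, which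
  contradicts the failure because \<open>C\<^sub>1 > 1\<close>.

  All equations are used through one integral representation, obtained by testing with explicit
  radial functions, so that no regularity theory is needed.\<close>

section \<open>Smooth functions of one variable\<close>

text \<open>Outside \<open>\<omega>\<close> nothing is known about \<open>u\<close> beyond the
  integral of \<open>exp u\<close>, while the potential integrates over all of
  \<open>\<Omega>\<close>. The exponents resolve this: \<open>exp (lam * u)\<close> lies in L^p with
  p = 1 / lam = 4 / (4 - \<mu>), and the dual exponent 4 / \<mu> turns the kernel |x|^(-\<mu>) into
  |x|^(-4), which is integrable at infinity in the plane. The integral of \<open>exp u\<close> is
  invariant under the rescaling, so this control is uniform in \<open>\<Omega>\<close> and survives
  the blow-up. The mass bound comes from finite deformations instead of derivatives: the energy, the
  double integral of exp(lam v(x)) exp(lam v(y)) / |x - y|^\<mu>, does not increase when pulled back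
  by an injective map near the identity. To first order in the size of the deformation this says 4 m
  \<le> \<mu> m + lam kappa m^2 for the mass m, that is 4 \<le> kappa m, since 4 - \<mu> = 4 lam.
  The value 1 of \<open>C\<^sub>1\<close> is the borderline because mass 4 / kappa at a point of
  height M pushes the infimum down to about -M.\<close>

fun C_k_real :: "nat \<Rightarrow> (real \<Rightarrow> real) \<Rightarrow> bool" where
  "C_k_real 0 f \<longleftrightarrow> continuous_on UNIV f"
| "C_k_real (Suc k) f \<longleftrightarrow> (\<exists>f'. (\<forall>x. (f has_real_derivative f' x) (at x)) \<and> C_k_real k f')"

lemma C_k_real_SucI: "(\<And>x. (f has_real_derivative f' x) (at x)) \<Longrightarrow> C_k_real k f' \<Longrightarrow> C_k_real (Suc k) f"
  by auto

lemma has_derivative_affine: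
  assumes "\<And>x. (f has_real_derivative f' x) (at x)"
  shows "((\<lambda>t. f (t * a + b)) has_real_derivative a * f' (t * a + b)) (at t)"
proof -
  have "((\<lambda>t. t * a + b) has_real_derivative a) (at t)"
    by (auto intro!: derivative_eq_intros)
  from DERIV_chain2[OF assms this] show ?thesis by (simp add: mult.commute)
qed

lemma C_k_real_imp_continuous: "C_k_real k f \<Longrightarrow> continuous_on A f"
proof (cases k)
  case 0
  then show "C_k_real k f \<Longrightarrow> continuous_on A f"
    using continuous_on_subset by auto
next
  case (Suc m)
  assume "C_k_real k f"
  with Suc obtain f' where "\<And>x. (f has_real_derivative f' x) (at x)" by auto
  then show ?thesis
    by (meson DERIV_isCont continuous_at_imp_continuous_on)
qed

lemma C_k_real_add: "C_k_real k f \<Longrightarrow> C_k_real k g \<Longrightarrow> C_k_real k (\<lambda>x. f x + g x)"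
proof (induction k arbitrary: f g)
  case 0
  then show ?case by (auto intro: continuous_intros)
next
  case (Suc k)
  then obtain f' g' where *: "\<And>x. (f has_real_derivative f' x) (at x)" "C_k_real k f'"
     "\<And>x. (g has_real_derivative g' x) (at x)" "C_k_real k g'" by auto
  then show ?case
    by (auto intro!: exI[of _ "\<lambda>x. f' x + g' x"] Suc.IH derivative_intros)
qed

lemma C_k_real_scale: "C_k_real k f \<Longrightarrow> C_k_real k (\<lambda>x. c * f (x * a + b))"
proof (induction k arbitrary: f c)
  case 0
  then show ?case
    by (auto intro!: continuous_intros continuous_on_compose2[of UNIV f])
next
  case (Suc k)
  then obtain f' where *: "\<And>x. (f has_real_derivative f' x) (at x)" "C_k_real k f'" by auto
  have "((\<lambda>x. c * f (x * a + b)) has_real_derivative (c * a) * f' (x * a + b)) (at x)" for x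
    using DERIV_cmult[OF has_derivative_affine[OF *(1)]] by (simp add: mult.assoc)
  then show ?case
    using Suc.IH[OF *(2), of "c * a"] by (intro C_k_real_SucI) auto
qed

text \<open>Needed for \<open>ell\<close>. Each differentiation under the integral sign brings out a
  factor \<tau>, so the induction has to carry the weight \<open>\<tau> ^ n\<close>.\<close>

lemma C_k_real_moment:
  assumes "C_k_real k f"
  shows "C_k_real k (\<lambda>t. integral {0..1} (\<lambda>\<tau>. \<tau> ^ n * f (t * \<tau>)))"
  using assms
proof (induction k arbitrary: f n)
  case 0
  have "continuous_on UNIV (\<lambda>t. integral (cbox 0 1) (\<lambda>\<tau>. \<tau> ^ n * f (t * \<tau>)))"
    by (rule integral_continuous_on_param)
       (use 0 in \<open>auto intro!: continuous_intros continuous_on_compose2[of UNIV f] simp: case_prod_beta\<close>)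
  then show ?case by simp
next
  case (Suc k)
  then obtain f' where *: "\<And>x. (f has_real_derivative f' x) (at x)" "C_k_real k f'" by auto
  have cf: "continuous_on A f" "continuous_on A f'" for A
    using C_k_real_imp_continuous Suc.prems *(2) by blast+
  have "((\<lambda>t. integral (cbox 0 1) (\<lambda>\<tau>. \<tau> ^ n * f (t * \<tau>))) has_real_derivative
      integral (cbox 0 1) (\<lambda>\<tau>. \<tau> ^ Suc n * f' (t * \<tau>))) (at t within UNIV)" for t
  proof (rule leibniz_rule_field_derivative)
    show "((\<lambda>t. \<tau> ^ n * f (t * \<tau>)) has_real_derivative \<tau> ^ Suc n * f' (t * \<tau>)) (at t within UNIV)" for t \<tau>
      using DERIV_cmult[OF has_derivative_affine[OF *(1)], of "\<tau> ^ n" \<tau> 0 t] by (simp add: ac_simps)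
    show "(\<lambda>\<tau>. \<tau> ^ n * f (t * \<tau>)) integrable_on cbox 0 1" for t
      by (intro integrable_continuous)
         (auto intro!: continuous_intros continuous_on_compose2[of UNIV f] cf)
    show "continuous_on (UNIV \<times> cbox 0 1) (\<lambda>(t, \<tau>). \<tau> ^ Suc n * f' (t * \<tau>))"
      unfolding case_prod_beta
      by (auto intro!: continuous_intros continuous_on_compose2[of UNIV f'] cf)
  qed auto
  then show ?case
    using Suc.IH[OF *(2), of "Suc n"] by (intro C_k_real_SucI) auto
qed

text \<open>The derivatives of \<open>exp (-1/x)\<close> are combinations of these functions.\<close>

definition flat :: "nat \<Rightarrow> real \<Rightarrow> real" where
  "flat n x = (if x > 0 then exp (- 1 / x) / x ^ n else 0)"

lemma flat_tendsto_0: "((\<lambda>x. exp (- 1 / x) / x ^ n) \<longlongrightarrow> 0) (at_right (0::real))"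
proof -
  have "((\<lambda>y::real. y ^ n / exp y) \<longlongrightarrow> 0) at_top"
    by (rule tendsto_power_div_exp_0)
  then have "((\<lambda>x::real. inverse x ^ n / exp (inverse x)) \<longlongrightarrow> 0) (at_right 0)"
    by (rule filterlim_compose[OF _ filterlim_inverse_at_top_right])
  moreover have "inverse x ^ n / exp (inverse x) = exp (- 1 / x) / x ^ n" for x :: real
    by (simp add: exp_minus field_simps)
  ultimately show ?thesis by simp
qed

lemma flat_has_derivative:
  "(flat n has_real_derivative flat (n + 2) x - real n * flat (n + 1) x) (at x)"
proof (cases x "0::real" rule: linorder_cases)
  case less
  have "((\<lambda>_. 0) has_real_derivative 0) (at x)" by simp
  then have "(flat n has_real_derivative 0) (at x)"
    by (rule has_field_derivative_transform_within_open[where S="{..<0}"])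
       (use less in \<open>auto simp: flat_def\<close>)
  then show ?thesis using less by (simp add: flat_def)
next
  case greater
  have p: "((\<lambda>x. x ^ n) has_real_derivative real n * x ^ n / x) (at x)"
    using DERIV_pow[of n x] greater by (cases n) auto
  have e: "((\<lambda>x. exp (- 1 / x)) has_real_derivative exp (- 1 / x) / x\<^sup>2) (at x)"
    using greater by (auto intro!: derivative_eq_intros simp: power2_eq_square)
  have "((\<lambda>x. exp (- 1 / x) / x ^ n) has_real_derivative
      exp (- 1 / x) / x ^ (n + 2) - real n * (exp (- 1 / x) / x ^ (n + 1))) (at x)"
    by (rule DERIV_cong[OF DERIV_divide[OF e p]])
       (use greater in \<open>simp_all add: field_simps power2_eq_square\<close>)
  then have "(flat n has_real_derivative
      exp (- 1 / x) / x ^ (n + 2) - real n * (exp (- 1 / x) / x ^ (n + 1))) (at x)"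
    by (rule has_field_derivative_transform_within_open[where S="{0<..}"])
       (use greater in \<open>auto simp: flat_def\<close>)
  then show ?thesis using greater by (simp add: flat_def)
next
  case equal
  \<comment> \<open>From the right the difference quotient at 0 is exp(-1/y) / y^(n+1), so its limit
    is \<open>flat_tendsto_0\<close> with n + 1; from the left it vanishes.\<close>
  have "((\<lambda>y. (flat n y - flat n 0) / (y - 0)) \<longlongrightarrow> 0) (at_right 0)"
    by (rule Lim_transform_eventually[OF flat_tendsto_0[of "Suc n"]])
       (auto simp: flat_def eventually_at_right_less intro!: eventually_mono[OF eventually_at_right_less[of 0]])
  moreover have "((\<lambda>y. (flat n y - flat n 0) / (y - 0)) \<longlongrightarrow> 0) (at_left 0)"
    by (rule Lim_transform_eventually[OF tendsto_const[of 0]])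
       (auto simp: flat_def eventually_at_filter)
  ultimately have "((\<lambda>y. (flat n y - flat n 0) / (y - 0)) \<longlongrightarrow> 0) (at 0)"
    using filterlim_split_at by blast
  then show ?thesis
    using equal by (simp add: flat_def has_field_derivative_iff)
qed

lemma C_k_real_flat: "C_k_real k (flat n)"
proof (induction k arbitrary: n)
  case 0
  then show ?case
    by (auto intro!: continuous_at_imp_continuous_on DERIV_isCont flat_has_derivative)
next
  case (Suc k)
  have "C_k_real k (\<lambda>x. flat (n + 2) x + (- real n) * flat (n + 1) (x * 1 + 0))"
    by (rule C_k_real_add[OF Suc C_k_real_scale[OF Suc]])
  then show ?case
    using flat_has_derivative by (auto intro!: exI[of _ "\<lambda>x. flat (n + 2) x - real n * flat (n + 1) x"])
qed

text \<open>Composed with the squared distance this is a smooth radial bump on the unit disc; using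
  the square keeps it smooth at the centre.\<close>

definition eta :: "real \<Rightarrow> real" where "eta t = flat 0 (1 - t)"

text \<open>The Laplacian of \<open>h (|x|\<^sup>2)\<close> in the plane is \<open>4 (t h')'\<close> at \<open>t = |x|\<^sup>2\<close>. As \<open>(t ell t)' = eta t\<close>, an
  antiderivative \<open>Lg\<close> of \<open>ell\<close> gives a smooth function with Laplacian \<open>4 eta (|x|\<^sup>2)\<close> that is a
  multiple of the logarithm outside the unit disc.\<close>

definition ell :: "real \<Rightarrow> real" where
  "ell t = integral {0..1} (\<lambda>\<tau>. eta (t * \<tau>))"

text \<open>The integral of \<open>eta\<close> over [0, 1], hence over the half line, because
  \<open>eta\<close> vanishes from 1 on. It becomes the coefficient of the logarithm in
  \<open>Lg\<close>.\<close>

definition theta :: real where "theta = ell 1"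

lemma C_k_real_eta: "C_k_real k eta"
  using C_k_real_scale[OF C_k_real_flat, of k 1 0 "-1" 1] by (simp add: eta_def[abs_def])

lemma C_k_real_ell: "C_k_real k ell"
  using C_k_real_moment[OF C_k_real_eta, of k 0] by (simp add: ell_def[abs_def])

lemmas continuous_eta = C_k_real_imp_continuous[OF C_k_real_eta]
lemmas continuous_ell = C_k_real_imp_continuous[OF C_k_real_ell]

lemma eta_nonneg: "eta t \<ge> 0"
  and eta_pos: "t < 1 \<Longrightarrow> eta t > 0" and eta_eq_0: "t \<ge> 1 \<Longrightarrow> eta t = 0"
  by (auto simp: eta_def flat_def)

lemma eta_antimono: "s \<le> t \<Longrightarrow> eta t \<le> eta s"
  by (auto simp: eta_def flat_def frac_le)

text \<open>The substitution r = t \<tau> shows t ell(t) to be the integral of \<open>eta\<close>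
  from 0 to t. The proof stays on [0, 1], which covers every sign of t: eta(t \<tau>) + t \<tau>
  eta'(t \<tau>) is the derivative of \<tau> eta(t \<tau>) in \<tau>, and integrating it gives
  ell(t) + t ell'(t) = eta(t).\<close>

lemma moment_has_derivative: "((\<lambda>t. t * ell t) has_real_derivative eta t) (at t)"
proof -
  obtain eta' where e': "\<And>x. (eta has_real_derivative eta' x) (at x)" "C_k_real 0 eta'"
    using C_k_real_eta[of "Suc 0"] by auto
  have ce': "continuous_on A eta'" for A
    using C_k_real_imp_continuous e'(2) by blast
  have 1: "(ell has_real_derivative integral (cbox 0 1) (\<lambda>\<tau>. \<tau> * eta' (t * \<tau>))) (at t within UNIV)"
    unfolding ell_def[abs_def] cbox_interval[symmetric]
  proof (rule leibniz_rule_field_derivative)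
    show "((\<lambda>t. eta (t * \<tau>)) has_real_derivative \<tau> * eta' (t * \<tau>)) (at t within UNIV)" for t \<tau>
      using has_derivative_affine[OF e'(1), of \<tau> 0 t] by simp
    show "(\<lambda>\<tau>. eta (t * \<tau>)) integrable_on cbox 0 1" for t
      by (intro integrable_continuous)
         (auto intro!: continuous_intros continuous_on_compose2[OF continuous_eta[of UNIV]])
    show "continuous_on (UNIV \<times> cbox 0 1) (\<lambda>(t, \<tau>). \<tau> * eta' (t * \<tau>))"
      unfolding case_prod_beta
      by (auto intro!: continuous_intros continuous_on_compose2[of UNIV eta'] ce')
  qed auto
  have fa: "((\<lambda>\<tau>. eta (t * \<tau>) + t * (\<tau> * eta' (t * \<tau>))) has_integral 1 * eta (t * 1) - 0 * eta (t * 0)) {0..1}"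
  proof (rule fundamental_theorem_of_calculus)
    show "((\<lambda>\<tau>. \<tau> * eta (t * \<tau>)) has_vector_derivative
        eta (t * \<tau>) + t * (\<tau> * eta' (t * \<tau>))) (at \<tau> within {0..1})" for \<tau>
      using DERIV_mult[OF DERIV_ident has_derivative_affine[OF e'(1), of t 0 \<tau>]]
      by (auto simp: has_real_derivative_iff_has_vector_derivative[symmetric] ac_simps
          intro: has_field_derivative_at_within)
  qed simp
  have i1: "(\<lambda>\<tau>. eta (t * \<tau>)) integrable_on {0..1}"
    by (rule integrable_continuous_real, rule continuous_on_compose2[OF continuous_eta[of UNIV]])
       (auto intro!: continuous_intros)
  have "continuous_on {0..1} (\<lambda>\<tau>. eta' (t * \<tau>))"
    by (rule continuous_on_compose2[OF ce'[of UNIV]]) (auto intro!: continuous_intros)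
  then have i2: "(\<lambda>\<tau>. \<tau> * eta' (t * \<tau>)) integrable_on {0..1}"
    by (intro integrable_continuous_real continuous_intros)
  note fb = has_integral_add[OF integrable_integral[OF i1] has_integral_mult_right[OF integrable_integral[OF i2], of t]]
  have "ell t + t * integral {0..1} (\<lambda>\<tau>. \<tau> * eta' (t * \<tau>)) = eta t"
    unfolding ell_def using has_integral_unique[OF fa fb] by simp
  then show ?thesis
    using 1 by (auto intro!: derivative_eq_intros simp: cbox_interval mult.commute)
qed


lemma moment_mono: "s \<le> t \<Longrightarrow> s * ell s \<le> t * ell t"
  by (rule DERIV_nonneg_imp_nondecreasing[where f="\<lambda>t. t * ell t"])
     (use moment_has_derivative eta_nonneg in blast)+

lemma moment_const:
  assumes "t \<ge> 1" shows "t * ell t = theta"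
proof (cases "t = 1")
  case False
  have "(\<lambda>t. t * ell t) t = (\<lambda>t. t * ell t) 1"
  proof (rule DERIV_isconst_end[of 1 t "\<lambda>t. t * ell t"])
    show "1 < t" using assms False by simp
    show "continuous_on {1..t} (\<lambda>t. t * ell t)"
      by (intro continuous_intros continuous_ell)
    show "((\<lambda>t. t * ell t) has_real_derivative 0) (at x)" if "1 < x" "x < t" for x
      using moment_has_derivative[of x] eta_eq_0[of x] that by simp
  qed
  then show ?thesis by (simp add: theta_def)
qed (simp add: theta_def)

lemma ell_nonneg: "0 \<le> t \<Longrightarrow> ell t \<ge> 0"
  unfolding ell_def by (intro integral_nonneg integrable_continuous_real)
    (auto intro!: eta_nonneg continuous_on_compose2[OF continuous_eta[of UNIV]] continuous_intros)

lemma theta_pos: "theta > 0"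
proof -
  have "(\<lambda>t. t * ell t) (0::real) < (\<lambda>t. t * ell t) 1"
    by (rule DERIV_pos_imp_increasing_open[of 0 1 "\<lambda>t. t * ell t"])
       (use moment_has_derivative eta_pos in \<open>auto intro!: continuous_intros continuous_ell\<close>)
  then show ?thesis by (simp add: theta_def)
qed

lemma ell_mult_le: "0 \<le> t \<Longrightarrow> t * ell t \<le> theta"
  using moment_mono[of t 1] moment_const[of t] by (cases "t \<le> 1") (auto simp: theta_def)

text \<open>Normalised at 1 so that it equals theta ln t for t \<ge> 1 without an additive
  constant.\<close>

definition Lg :: "real \<Rightarrow> real" where
  "Lg = (SOME F. (\<forall>t. (F has_real_derivative ell t) (at t)) \<and> F 1 = 0)"

lemma Lg_props: "(\<forall>t. (Lg has_real_derivative ell t) (at t)) \<and> Lg 1 = 0"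
proof -
  have "\<exists>F. \<forall>x :: real. - \<infinity> < ereal x \<longrightarrow> ereal x < \<infinity> \<longrightarrow> (F has_vector_derivative ell x) (at x)"
    using continuous_ell[of UNIV] by (intro einterval_antiderivative) (auto simp: continuous_on_eq_continuous_at)
  then obtain F where F: "\<And>x. (F has_real_derivative ell x) (at x)"
    by (auto simp: has_real_derivative_iff_has_vector_derivative)
  have "((\<lambda>t. F t - F 1) has_real_derivative ell x) (at x)" for x
    using F by (auto intro!: derivative_eq_intros)
  then have "\<exists>F. (\<forall>t. (F has_real_derivative ell t) (at t)) \<and> F 1 = 0"
    by (intro exI[of _ "\<lambda>t. F t - F 1"]) auto
  from someI_ex[OF this] show ?thesis unfolding Lg_def .
qed

lemma Lg_has_derivative: "(Lg has_real_derivative ell t) (at t)"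
  and Lg_1: "Lg 1 = 0"
  using Lg_props by auto

lemma C_k_real_Lg: "C_k_real k Lg"
  using C_k_real_ell Lg_has_derivative by (cases k) (auto intro!: continuous_at_imp_continuous_on DERIV_isCont)

lemmas continuous_Lg = C_k_real_imp_continuous[OF C_k_real_Lg]

lemma Lg_mono: "0 \<le> s \<Longrightarrow> s \<le> t \<Longrightarrow> Lg s \<le> Lg t"
  by (rule DERIV_nonneg_imp_nondecreasing[where f=Lg])
     (use Lg_has_derivative ell_nonneg in \<open>auto intro!: exI\<close>)

text \<open>The derivative ell(x) - theta / x is at most 0 by \<open>ell_mult_le\<close>. Together
  with the monotonicity of \<open>Lg\<close> this gives the signs and monotonicity of the truncated
  logarithms.\<close>

lemma Lg_ln_antimono:
  assumes "0 < s" "s \<le> t" shows "Lg t - theta * ln t \<le> Lg s - theta * ln s"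
proof (rule DERIV_nonpos_imp_nonincreasing[where f="\<lambda>t. Lg t - theta * ln t"])
  fix x assume x: "s \<le> x" "x \<le> t"
  have "((\<lambda>t. Lg t - theta * ln t) has_real_derivative ell x - theta / x) (at x)"
    using x assms by (auto intro!: derivative_eq_intros Lg_has_derivative)
  moreover have "ell x - theta / x \<le> 0"
    using ell_mult_le[of x] x assms by (simp add: field_simps)
  ultimately show "\<exists>y. ((\<lambda>t. Lg t - theta * ln t) has_real_derivative y) (at x) \<and> y \<le> 0" by blast
qed fact

lemma Lg_eq_ln:
  assumes "t \<ge> 1" shows "Lg t = theta * ln t"
proof (cases "t = 1")
  case False
  have "(\<lambda>t. Lg t - theta * ln t) t = (\<lambda>t. Lg t - theta * ln t) 1"
  proof (rule DERIV_isconst_end[of 1 t "\<lambda>t. Lg t - theta * ln t"])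
    show "1 < t" using assms False by simp
    show "continuous_on {1..t} (\<lambda>t. Lg t - theta * ln t)"
      by (intro continuous_intros continuous_Lg) auto
    show "((\<lambda>t. Lg t - theta * ln t) has_real_derivative 0) (at x)" if "1 < x" "x < t" for x
    proof -
      have "((\<lambda>t. Lg t - theta * ln t) has_real_derivative ell x - theta / x) (at x)"
        using that by (auto intro!: derivative_eq_intros Lg_has_derivative)
      then show ?thesis using moment_const[of x] that by (simp add: field_simps)
    qed
  qed
  then show ?thesis by (simp add: Lg_1)
qed (simp add: Lg_1)

section \<open>Radial test functions\<close>

lemma C_k_Suc_imp: "C_k (Suc k) f \<Longrightarrow> C_k k f"
proof (induction k arbitrary: f)
  case 0
  then show ?case using differentiable_imp_continuous_on by auto
next
  case (Suc k)
  then show ?case by (metis C_k.simps(2))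
qed

lemma partial_deriv_eqI: "(f has_derivative f') (at x) \<Longrightarrow> partial_deriv i f x = f' i"
  unfolding partial_deriv_def by (metis frechet_derivative_at)

lemma C_k_SucI:
  assumes "\<And>x. (f has_derivative f' x) (at x)" "\<And>i. i \<in> Basis \<Longrightarrow> C_k k (\<lambda>x. f' x i)"
  shows "C_k (Suc k) f"
proof -
  have "partial_deriv i f = (\<lambda>x. f' x i)" for i
    using partial_deriv_eqI[OF assms(1)] by auto
  moreover have "f differentiable_on UNIV"
    using assms(1) by (auto simp: differentiable_on_def differentiable_def)
  ultimately show ?thesis using assms(2) by simp
qed

lemma C_k_SucD:
  assumes "C_k (Suc k) f"
  shows "(f has_derivative frechet_derivative f (at x)) (at x)"
    "i \<in> Basis \<Longrightarrow> C_k k (\<lambda>x. frechet_derivative f (at x) i)"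
  using assms by (auto simp: differentiable_on_def frechet_derivative_works partial_deriv_def[abs_def])

lemma C_k_add: "C_k k f \<Longrightarrow> C_k k g \<Longrightarrow> C_k k (\<lambda>x. f x + g x)"
proof (induction k arbitrary: f g)
  case (Suc k)
  show ?case
    using C_k_SucD[OF Suc.prems(1)] C_k_SucD[OF Suc.prems(2)]
    by (intro C_k_SucI[OF has_derivative_add] Suc.IH) auto
qed (auto intro: continuous_intros)

lemma C_k_mult: "C_k k f \<Longrightarrow> C_k k g \<Longrightarrow> C_k k (\<lambda>x. f x * g x)"
proof (induction k arbitrary: f g)
  case (Suc k)
  show ?case
  proof (rule C_k_SucI[OF has_derivative_mult[OF C_k_SucD(1)[OF Suc.prems(1)] C_k_SucD(1)[OF Suc.prems(2)]]])
    fix i :: "real^2" assume "i \<in> Basis"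
    then show "C_k k (\<lambda>x. f x * frechet_derivative g (at x) i + frechet_derivative f (at x) i * g x)"
      using C_k_SucD(2)[OF Suc.prems(1)] C_k_SucD(2)[OF Suc.prems(2)] Suc.prems[THEN C_k_Suc_imp]
      by (intro C_k_add Suc.IH)
  qed
qed (auto intro: continuous_intros)

lemma C_k_const: "C_k k (\<lambda>x. c)"
  by (induction k arbitrary: c) (auto intro!: C_k_SucI[OF has_derivative_const] simp del: C_k.simps(2))

lemma C_k_coord: "C_k k (\<lambda>x. c * ((x - x0) \<bullet> i))"
proof (cases k)
  case (Suc m)
  have "((\<lambda>x. c * ((x - x0) \<bullet> i)) has_derivative (\<lambda>v. c * (v \<bullet> i))) (at x)" for x
    by (auto intro!: derivative_eq_intros)
  then show ?thesis unfolding Suc by (rule C_k_SucI) (rule C_k_const)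
qed (auto intro!: continuous_intros)

lemma has_derivative_radial:
  fixes x0 :: "'a::real_inner"
  assumes "\<And>t. (h has_real_derivative h' t) (at t)"
  shows "((\<lambda>x. h ((norm (x - x0))\<^sup>2)) has_derivative
     (\<lambda>v. 2 * ((x - x0) \<bullet> v) * h' ((norm (x - x0))\<^sup>2))) (at x)"
proof -
  have 1: "((\<lambda>x. (norm (x - x0))\<^sup>2) has_derivative (\<lambda>v. 2 * ((x - x0) \<bullet> v))) (at x)"
    unfolding power2_norm_eq_inner
    by (auto intro!: derivative_eq_intros simp: inner_commute)
  have "(h has_derivative (*) (h' ((norm (x - x0))\<^sup>2))) (at ((norm (x - x0))\<^sup>2))"
    using assms by (simp add: has_field_derivative_def)
  from has_derivative_compose[OF 1 this] show ?thesis by (simp add: mult.commute)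
qed

lemma C_k_radial: "C_k_real k h \<Longrightarrow> C_k k (\<lambda>x. h ((norm (x - x0))\<^sup>2))"
proof (induction k arbitrary: h)
  case 0
  then show ?case
    by (auto intro!: continuous_intros continuous_on_compose2[of UNIV h])
next
  case (Suc k)
  then obtain h' where h': "\<And>x. (h has_real_derivative h' x) (at x)" "C_k_real k h'" by auto
  show ?case
  proof (rule C_k_SucI[OF has_derivative_radial[OF h'(1)]])
    fix i :: "real^2"
    have "C_k k (\<lambda>x. 2 * ((x - x0) \<bullet> i) * h' ((norm (x - x0))\<^sup>2))"
      by (rule C_k_mult[OF C_k_coord Suc.IH[OF h'(2)]])
    then show "C_k k (\<lambda>x. 2 * ((x - x0) \<bullet> i) * h' ((norm (x - x0))\<^sup>2))" .
  qed
qed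

lemma laplacian_radial:
  assumes h: "\<And>t. (h has_real_derivative h1 t) (at t)" "\<And>t. (h1 has_real_derivative h2 t) (at t)"
  shows "laplacian (\<lambda>x. h ((norm (x - x0))\<^sup>2)) x =
    4 * (h1 ((norm (x - x0))\<^sup>2) + (norm (x - x0))\<^sup>2 * h2 ((norm (x - x0))\<^sup>2))"
proof -
  let ?t = "(norm (x - x0))\<^sup>2"
  have p1: "partial_deriv i (\<lambda>x. h ((norm (x - x0))\<^sup>2)) =
      (\<lambda>x. 2 * ((x - x0) \<bullet> i) * h1 ((norm (x - x0))\<^sup>2))" for i
    using partial_deriv_eqI[OF has_derivative_radial[OF h(1)]] by auto
  have p2: "partial_deriv i (\<lambda>x. 2 * ((x - x0) \<bullet> i) * h1 ((norm (x - x0))\<^sup>2)) x =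
      2 * h1 ?t + 4 * (((x - x0) \<bullet> i) * ((x - x0) \<bullet> i)) * h2 ?t" if "i \<in> Basis" for i
  proof -
    have "((\<lambda>x. 2 * ((x - x0) \<bullet> i)) has_derivative (\<lambda>v. 2 * (v \<bullet> i))) (at x)"
      by (auto intro!: derivative_eq_intros)
    from partial_deriv_eqI[OF has_derivative_mult[OF this has_derivative_radial[OF h(2)]], of i]
    show ?thesis by (rule trans) (use that in \<open>simp add: algebra_simps\<close>)
  qed
  have "(\<Sum>i\<in>Basis. ((x - x0) \<bullet> i) * ((x - x0) \<bullet> i)) = ?t"
    by (simp add: power2_norm_eq_inner flip: euclidean_inner)
  moreover have "laplacian (\<lambda>x. h ((norm (x - x0))\<^sup>2)) x =
      (\<Sum>i\<in>Basis. 2 * h1 ?t + 4 * (((x - x0) \<bullet> i) * ((x - x0) \<bullet> i)) * h2 ?t)"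
    unfolding laplacian_def p1 by (rule sum.cong[OF refl p2])
  ultimately show ?thesis
    by (simp add: sum.distrib flip: sum_distrib_left sum_distrib_right)
qed

lemma C_k_real_const: "C_k_real k (\<lambda>x. c)"
proof (induction k arbitrary: c)
  case (Suc k)
  show ?case by (rule C_k_real_SucI[OF _ Suc[of 0]]) simp
qed simp

text \<open>The Laplacian of this test function is the difference of the averaging kernels at the scales
  \<open>\<rho>\<close> and \<open>s\<close>; the limit \<open>s \<rightarrow> 0\<close> gives a mean value formula.\<close>

definition cutlog :: "real \<Rightarrow> real \<Rightarrow> real^2 \<Rightarrow> real^2 \<Rightarrow> real" where
  "cutlog s \<rho> x0 x = Lg ((norm (x - x0))\<^sup>2 / \<rho>\<^sup>2) - Lg ((norm (x - x0))\<^sup>2 / s\<^sup>2) + 2 * theta * ln (\<rho> / s)"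

lemma cutlog_smooth: "C_k k (cutlog s \<rho> x0)"
proof -
  have "C_k_real k (\<lambda>t. (1 * Lg (t * (1 / \<rho>\<^sup>2) + 0) + (-1) * Lg (t * (1 / s\<^sup>2) + 0)) + 2 * theta * ln (\<rho> / s))"
    by (intro C_k_real_add C_k_real_scale C_k_real_Lg C_k_real_const)
  from C_k_radial[OF this] show ?thesis by (simp add: cutlog_def[abs_def])
qed

lemma laplacian_cutlog:
  assumes "s > 0" "\<rho> > 0"
  shows "laplacian (cutlog s \<rho> x0) x =
    4 * (eta ((norm (x - x0))\<^sup>2 / \<rho>\<^sup>2) / \<rho>\<^sup>2 - eta ((norm (x - x0))\<^sup>2 / s\<^sup>2) / s\<^sup>2)"
proof -
  obtain ell' where e: "\<And>t. (ell has_real_derivative ell' t) (at t)"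
    using C_k_real_ell[of "Suc 0"] by auto
  \<comment> \<open>Up to the factor 4 the left side is the radial Laplacian of
    \<open>Lg\<close>.\<close>
  have m: "ell t + t * ell' t = eta t" for t
  proof -
    have "((\<lambda>t. t * ell t) has_real_derivative ell t + t * ell' t) (at t)"
      by (auto intro!: derivative_eq_intros e)
    then show ?thesis using moment_has_derivative DERIV_unique by blast
  qed
  define h where "h = (\<lambda>t. Lg (t / \<rho>\<^sup>2) - Lg (t / s\<^sup>2) + 2 * theta * ln (\<rho> / s))"
  define h1 where "h1 = (\<lambda>t. ell (t / \<rho>\<^sup>2) / \<rho>\<^sup>2 - ell (t / s\<^sup>2) / s\<^sup>2)"
  define h2 where "h2 = (\<lambda>t. ell' (t / \<rho>\<^sup>2) / \<rho>\<^sup>2 / \<rho>\<^sup>2 - ell' (t / s\<^sup>2) / s\<^sup>2 / s\<^sup>2)"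
  have aff: "((\<lambda>t. f (t / c)) has_real_derivative f' (t / c) / c) (at t)"
    if "\<And>t. (f has_real_derivative f' t) (at t)" for f f' :: "real \<Rightarrow> real" and c t :: real
    using has_derivative_affine[OF that, of "1 / c" 0 t] by simp
  have "(h has_real_derivative h1 t) (at t)" for t
    unfolding h_def h1_def by (auto intro!: derivative_eq_intros aff[OF Lg_has_derivative])
  moreover have "(h1 has_real_derivative h2 t) (at t)" for t
    unfolding h1_def h2_def by (intro DERIV_diff DERIV_cdivide aff[OF e])
  ultimately have "laplacian (\<lambda>x. h ((norm (x - x0))\<^sup>2)) x =
      4 * (h1 ((norm (x - x0))\<^sup>2) + (norm (x - x0))\<^sup>2 * h2 ((norm (x - x0))\<^sup>2))"
    by (rule laplacian_radial)
  also have "h1 t + t * h2 t = eta (t / \<rho>\<^sup>2) / \<rho>\<^sup>2 - eta (t / s\<^sup>2) / s\<^sup>2" for t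
    unfolding h1_def h2_def m[symmetric] by (simp add: add_divide_distrib right_diff_distrib)
  finally show ?thesis by (simp add: h_def cutlog_def[abs_def])
qed


text \<open>Beyond both radii the two terms in \<open>Lg\<close> are logarithms with difference -2
  theta ln(\<rho> / s), which the additive constant in \<open>cutlog\<close> cancels. This gives the
  compact support.\<close>

lemma cutlog_eq_0:
  assumes "0 < s" "s \<le> \<rho>" "norm (x - x0) \<ge> \<rho>"
  shows "cutlog s \<rho> x0 x = 0"
proof -
  have \<rho>: "\<rho> > 0" and t: "norm (x - x0) > 0" using assms by linarith+
  have "(norm (x - x0))\<^sup>2 \<ge> \<rho>\<^sup>2" "(norm (x - x0))\<^sup>2 \<ge> s\<^sup>2"
    using assms by (auto intro!: power_mono)
  then have "(norm (x - x0))\<^sup>2 / \<rho>\<^sup>2 \<ge> 1" "(norm (x - x0))\<^sup>2 / s\<^sup>2 \<ge> 1"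
    using assms \<rho> by simp_all
  then show ?thesis
    using assms \<rho> t by (simp add: cutlog_def Lg_eq_ln ln_div ln_realpow algebra_simps)
qed

lemma cutlog_bounds:
  assumes "0 < s" "s \<le> \<rho>"
  shows "0 \<le> cutlog s \<rho> x0 x" "cutlog s \<rho> x0 x \<le> 2 * theta * ln (\<rho> / s)"
proof -
  let ?t = "(norm (x - x0))\<^sup>2"
  have \<rho>: "\<rho> > 0" using assms by linarith
  have le: "?t / \<rho>\<^sup>2 \<le> ?t / s\<^sup>2"
    using assms \<rho> by (intro divide_left_mono) (auto intro!: power_mono)
  then show "cutlog s \<rho> x0 x \<le> 2 * theta * ln (\<rho> / s)"
    unfolding cutlog_def using Lg_mono[OF _ le] by simp
  show "0 \<le> cutlog s \<rho> x0 x"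
  proof (cases "x = x0")
    case True
    then show ?thesis using assms \<rho> theta_pos by (simp add: cutlog_def)
  next
    case False
    then have "?t > 0" by simp
    then show ?thesis
      using Lg_ln_antimono[OF _ le] assms \<rho> by (simp add: cutlog_def ln_div ln_realpow algebra_simps)
  qed
qed

text \<open>Shrinking the inner scale increases \<open>cutlog\<close>, as the monotone convergence
  for s -> 0 requires.\<close>

lemma cutlog_mono:
  assumes "0 < s" "s \<le> s'" "s' \<le> \<rho>" "x \<noteq> x0"
  shows "cutlog s' \<rho> x0 x \<le> cutlog s \<rho> x0 x"
proof -
  let ?t = "(norm (x - x0))\<^sup>2"
  have \<rho>: "\<rho> > 0" using assms by linarith
  have le: "?t / s'\<^sup>2 \<le> ?t / s\<^sup>2"
    using assms \<rho> by (intro divide_left_mono) (auto intro!: power_mono)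
  then show ?thesis
    using Lg_ln_antimono[OF _ le] assms \<rho> by (simp add: cutlog_def ln_div ln_realpow algebra_simps)
qed

text \<open>The limit of \<open>cutlog s 1\<close> as s -> 0, as a function of the distance: a
  logarithmic pole at 0, cut off smoothly at distance 1. The default value at the pole concerns one
  point only.\<close>

definition Gam :: "real \<Rightarrow> real" where
  "Gam r = (if r = 0 then 0 else Lg (r\<^sup>2) - 2 * theta * ln r)"

lemma Gam_eq_0: "r \<ge> 1 \<Longrightarrow> Gam r = 0"
  by (auto simp: Gam_def Lg_eq_ln ln_realpow)

lemma Gam_nonneg: "r \<ge> 0 \<Longrightarrow> Gam r \<ge> 0"
  using Lg_ln_antimono[of "r\<^sup>2" 1] Gam_eq_0[of r]
  by (cases "r \<le> 1") (auto simp: Gam_def Lg_1 ln_realpow power_le_one)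

lemma Gam_lower: "0 < r \<Longrightarrow> Gam r \<ge> Lg 0 - 2 * theta * ln r"
  using Lg_mono[of 0 "r\<^sup>2"] by (auto simp: Gam_def)

lemma Gam_upper: "0 < r \<Longrightarrow> r \<le> 1 \<Longrightarrow> Gam r \<le> - 2 * theta * ln r"
  using Lg_mono[of "r\<^sup>2" 1] by (auto simp: Gam_def Lg_1 power_le_one)

text \<open>At distance at least s the inner \<open>Lg\<close> is already an exact logarithm. Off
  the centre the convergence for s -> 0 is therefore eventual equality.\<close>

lemma cutlog_eq_Gam:
  assumes "0 < s" "s \<le> \<rho>" "s \<le> norm (x - x0)"
  shows "cutlog s \<rho> x0 x = Gam (norm (x0 - x) / \<rho>)"
proof -
  have \<rho>: "\<rho> > 0" "norm (x - x0) > 0" using assms by linarith+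
  have "1 \<le> (norm (x - x0))\<^sup>2 / s\<^sup>2" using assms by simp
  then show ?thesis
    using assms \<rho> by (simp add: cutlog_def Gam_def Lg_eq_ln ln_div ln_realpow power_divide norm_minus_commute algebra_simps)
qed

lemma Gam_measurable[measurable]: "Gam \<in> borel_measurable borel"
proof -
  have [measurable]: "Lg \<in> borel_measurable borel"
    by (rule borel_measurable_continuous_onI[OF continuous_Lg])
  show ?thesis unfolding Gam_def[abs_def] by measurable
qed

lemma eta_measurable[measurable]: "eta \<in> borel_measurable borel"
  by (rule borel_measurable_continuous_onI[OF continuous_eta])

lemma cutlog_test_function:
  assumes "0 < s" "s \<le> \<rho>" "cball x0 \<rho> \<subseteq> S"
  shows "cutlog s \<rho> x0 \<in> test_functions S"
proof -
  have "{x. cutlog s \<rho> x0 x \<noteq> 0} \<subseteq> cball x0 \<rho>"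
    using cutlog_eq_0[OF assms(1,2)] by (force simp: dist_norm norm_minus_commute)
  then have "closure {x. cutlog s \<rho> x0 x \<noteq> 0} \<subseteq> cball x0 \<rho>"
    using closure_minimal by blast
  then show ?thesis
    using assms(3) cutlog_smooth bounded_subset[OF bounded_cball] unfolding test_functions_def
    by (auto simp: compact_eq_bounded_closed)
qed

section \<open>Dilations of the Lebesgue integral\<close>

lemma integrable_lebesgue_if_lborel:
  "integrable lborel f \<Longrightarrow> integrable lebesgue f" for f :: "'a::euclidean_space \<Rightarrow> real"
  by (simp add: integrable_completion borel_measurable_integrable)

lemma lebesgue_scale_aux:
  fixes f :: "real^2 \<Rightarrow> real"
  assumes r: "r \<noteq> 0" and f: "integrable lebesgue f"
  shows "integrable lebesgue (\<lambda>y. f (x0 + r *\<^sub>R y)) \<and>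
    (LINT y|lebesgue. f y) = r\<^sup>2 * (LINT y|lebesgue. f (x0 + r *\<^sub>R y))"
proof -
  have T: "x0 + (\<Sum>j\<in>Basis. (r * (x \<bullet> j)) *\<^sub>R j) = x0 + r *\<^sub>R x" for x :: "real^2"
    by (simp add: euclidean_representation flip: scaleR_scaleR scaleR_sum_right)
  have meas: "(\<lambda>x. x0 + r *\<^sub>R x) \<in> lebesgue \<rightarrow>\<^sub>M lebesgue"
    using lebesgue_affine_measurable[of "\<lambda>_. r" x0] r unfolding T by simp
  have leb: "lebesgue = density (distr lebesgue lebesgue (\<lambda>x. x0 + r *\<^sub>R x)) (\<lambda>_. ennreal (r\<^sup>2))"
    using lebesgue_affine_euclidean[of "\<lambda>_. r" x0] r unfolding T by (simp add: power2_abs)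
  have fm: "f \<in> borel_measurable lebesgue" using f by simp
  have fm': "f \<in> borel_measurable (distr lebesgue lebesgue (\<lambda>x. x0 + r *\<^sub>R x))" using fm by simp
  have "integrable (density (distr lebesgue lebesgue (\<lambda>x. x0 + r *\<^sub>R x)) (\<lambda>_. ennreal (r\<^sup>2))) f"
    using f leb by simp
  then have "integrable (distr lebesgue lebesgue (\<lambda>x. x0 + r *\<^sub>R x)) (\<lambda>x. r\<^sup>2 *\<^sub>R f x)"
    by (subst (asm) integrable_density) (use fm' in auto)
  then have i: "integrable lebesgue (\<lambda>y. f (x0 + r *\<^sub>R y))"
    using r by (subst (asm) integrable_distr_eq) (use meas fm in auto)
  have "(LINT y|lebesgue. f y) = (LINT y|density (distr lebesgue lebesgue (\<lambda>x. x0 + r *\<^sub>R x)) (\<lambda>_. ennreal (r\<^sup>2)). f y)"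
    using leb by simp
  also have "\<dots> = (LINT y|(distr lebesgue lebesgue (\<lambda>x. x0 + r *\<^sub>R x)). r\<^sup>2 *\<^sub>R f y)"
    by (rule integral_density) (use fm' in auto)
  also have "\<dots> = (LINT y|lebesgue. r\<^sup>2 *\<^sub>R f (x0 + r *\<^sub>R y))"
    by (rule integral_distr) (use meas fm in auto)
  finally show ?thesis using i by simp
qed

lemma integrable_lebesgue_scale:
  fixes f :: "real^2 \<Rightarrow> real"
  assumes "r \<noteq> 0"
  shows "integrable lebesgue (\<lambda>y. f (x0 + r *\<^sub>R y)) \<longleftrightarrow> integrable lebesgue f"
proof
  assume "integrable lebesgue (\<lambda>y. f (x0 + r *\<^sub>R y))"
  from lebesgue_scale_aux[OF _ this, of "1 / r" "- (1 / r) *\<^sub>R x0"] show "integrable lebesgue f"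
    using assms by (simp add: algebra_simps)
qed (use lebesgue_scale_aux[OF assms] in blast)

text \<open>The non-integrable case is covered too: integrability fails on both sides at once, and
  both integrals then have the default value 0.\<close>

lemma integral_lebesgue_scale:
  fixes f :: "real^2 \<Rightarrow> real"
  assumes "r \<noteq> 0"
  shows "(LINT y|lebesgue. f y) = r\<^sup>2 * (LINT y|lebesgue. f (x0 + r *\<^sub>R y))"
proof (cases "integrable lebesgue f")
  case True
  then show ?thesis using lebesgue_scale_aux[OF assms] by blast
next
  case False
  then show ?thesis
    using integrable_lebesgue_scale[OF assms] by (simp add: not_integrable_integral_eq)
qed

section \<open>The representation formula\<close>

abbreviation bump :: "real \<Rightarrow> 'a::real_normed_vector \<Rightarrow> 'a \<Rightarrow> real" where
  "bump \<rho> x y \<equiv> eta ((norm (x - y) / \<rho>)\<^sup>2)"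

abbreviation Green :: "real \<Rightarrow> 'a::real_normed_vector \<Rightarrow> 'a \<Rightarrow> real" where
  "Green \<rho> x y \<equiv> Gam (norm (x - y) / \<rho>)"

definition eta_mass :: real where
  "eta_mass = (LINT y|lebesgue. eta ((norm (y :: real^2))\<^sup>2))"

text \<open>A form of \<open>-\<Delta>v = F\<close> in \<open>S\<close> that needs no derivatives of \<open>v\<close>. The value of \<open>theta / (2 * eta_mass)\<close>
  is \<open>1 / (2\<pi>)\<close>, but it cancels in the end and is never computed.\<close>

definition rep :: "(real^2) set \<Rightarrow> (real^2 \<Rightarrow> real) \<Rightarrow> (real^2 \<Rightarrow> real) \<Rightarrow> bool" where
  "rep S v F \<longleftrightarrow> (\<forall>x \<rho>. 0 < \<rho> \<and> cball x \<rho> \<subseteq> S \<longrightarrow>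
     integrable lebesgue (\<lambda>y. F y * Green \<rho> x y) \<and>
     4 * eta_mass * v x =
       4 / \<rho>\<^sup>2 * (LINT y|lebesgue. v y * bump \<rho> x y)
       + (LINT y|lebesgue. F y * Green \<rho> x y))"

lemma borel_imp_lebesgue:
  "f \<in> borel_measurable borel \<Longrightarrow> f \<in> borel_measurable lebesgue"
  by (intro measurable_completion) simp

lemma eta_kernel_eq_0: "\<rho> > 0 \<Longrightarrow> norm (x - y) \<ge> \<rho> \<Longrightarrow> bump \<rho> x y = 0"
  by (intro eta_eq_0) auto

lemma integrable_lebesgue_compact:
  fixes f :: "'a::euclidean_space \<Rightarrow> real"
  assumes "compact K" "continuous_on K f"
  shows "integrable lebesgue (\<lambda>x. indicator K x * f x)"
  using integrable_lebesgue_if_lborel[OF borel_integrable_compact[OF assms]] by simp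

lemma integrable_eta_kernel:
  assumes "\<rho> > 0" "continuous_on (cball x \<rho>) u"
  shows "integrable lebesgue (\<lambda>y. u y * bump \<rho> x y)"
proof -
  have "integrable lebesgue (\<lambda>y. indicator (cball x \<rho>) y * (u y * bump \<rho> x y))"
    using assms by (intro integrable_lebesgue_compact continuous_intros
        continuous_on_compose2[OF continuous_eta[of UNIV]]) auto
  also have "(\<lambda>y. indicator (cball x \<rho>) y * (u y * bump \<rho> x y)) =
      (\<lambda>y. u y * bump \<rho> x y)"
    using eta_kernel_eq_0[OF assms(1), of x] by (force simp: indicator_def dist_norm fun_eq_iff)
  finally show ?thesis .
qed

lemma integral_eta_kernel:
  fixes x :: "real^2"
  assumes "\<rho> > 0"
  shows "(LINT y|lebesgue. bump \<rho> x y) = \<rho>\<^sup>2 * eta_mass"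
  using integral_lebesgue_scale[of \<rho> "\<lambda>y. bump \<rho> x y" x] assms
  by (simp add: eta_mass_def)

lemma eta_mass_pos: "eta_mass > 0"
proof -
  have i: "integrable lebesgue (\<lambda>y::real^2. eta ((norm y)\<^sup>2))"
    using integrable_eta_kernel[of 1 "0::real^2" "\<lambda>_. 1"] by simp
  have "eta_mass \<noteq> 0"
  proof
    assume "eta_mass = 0"
    then have "AE y in lebesgue. eta ((norm (y::real^2))\<^sup>2) = 0"
      unfolding eta_mass_def using integral_nonneg_eq_0_iff_AE[OF i] eta_nonneg by auto
    then have "AE y in lebesgue. (y::real^2) \<notin> ball 0 1"
    proof eventually_elim
      case (elim y)
      then have "\<not> (norm y)\<^sup>2 < 1" using eta_pos[of "(norm y)\<^sup>2"] by auto
      then show ?case by (auto simp: abs_square_less_1)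
    qed
    then have "ball (0::real^2) 1 \<in> null_sets lebesgue"
      by (subst (asm) AE_iff_null_sets[symmetric]) (auto)
    then have "emeasure lborel (ball (0::real^2) 1) = 0" by auto
    moreover have "emeasure lborel (ball (0::real^2) 1) > 0"
      by (subst emeasure_ball) (auto simp: unit_ball_vol_def)
    ultimately show False by simp
  qed
  moreover have "eta_mass \<ge> 0" unfolding eta_mass_def using eta_nonneg by (intro integral_nonneg_AE) auto
  ultimately show ?thesis by simp
qed

text \<open>After rescaling, the kernel is the fixed function eta(|y|^2) and only the argument of u
  moves; a bound of u on the disc provides the dominating function.\<close>

lemma eta_average_tendsto:
  fixes x0 :: "real^2"
  assumes u: "continuous_on (cball x0 \<rho>) u" and \<rho>: "\<rho> > 0"
    and s: "s \<longlonglongrightarrow> 0" "\<And>n. 0 < s n" "\<And>n. s n \<le> \<rho>"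
  shows "(\<lambda>n. 1 / (s n)\<^sup>2 * (LINT y|lebesgue. u y * bump (s n) x0 y))
    \<longlonglongrightarrow> eta_mass * u x0"
proof -
  obtain B where B: "\<And>y. y \<in> cball x0 \<rho> \<Longrightarrow> \<bar>u y\<bar> \<le> B"
    using compact_imp_bounded[OF compact_continuous_image[OF u compact_cball]]
    unfolding bounded_iff by (metis image_eqI real_norm_def)
  have B0: "B \<ge> 0" using B[of x0] \<rho> by auto
  have eq: "1 / (s n)\<^sup>2 * (LINT y|lebesgue. u y * bump (s n) x0 y) =
      (LINT y|lebesgue. u (x0 + s n *\<^sub>R y) * eta ((norm y)\<^sup>2))" for n
    using s(2)[of n] by (subst integral_lebesgue_scale[of "s n" _ x0]) auto
  have "(\<lambda>n. LINT y|lebesgue. u (x0 + s n *\<^sub>R y) * eta ((norm y)\<^sup>2))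
      \<longlonglongrightarrow> (LINT y|lebesgue. u x0 * eta ((norm (y::real^2))\<^sup>2))"
  proof (rule integral_dominated_convergence[where w="\<lambda>y. B * eta ((norm (y::real^2))\<^sup>2)"])
    show "integrable lebesgue (\<lambda>y. B * eta ((norm (y::real^2))\<^sup>2))"
      using integrable_eta_kernel[of 1 "0::real^2" "\<lambda>_. B"] by simp
    have "integrable lebesgue (\<lambda>y. u y * bump (s n) x0 y)" for n
      using integrable_eta_kernel[OF s(2) continuous_on_subset[OF u subset_cball[OF s(3)]]] .
    then have "integrable lebesgue (\<lambda>y. u (x0 + s n *\<^sub>R y) * eta ((norm (x0 - (x0 + s n *\<^sub>R y)) / s n)\<^sup>2))" for n
      using s(2)[of n] by (subst integrable_lebesgue_scale[of "s n"
          "\<lambda>y. u y * bump (s n) x0 y"]) auto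
    moreover have "norm (x0 - (x0 + s n *\<^sub>R y)) / s n = norm y" for n and y :: "real^2"
      using s(2)[of n] by simp
    ultimately have "integrable lebesgue (\<lambda>y. u (x0 + s n *\<^sub>R y) * eta ((norm y)\<^sup>2))" for n
      by simp
    then show "(\<lambda>y. u (x0 + s n *\<^sub>R y) * eta ((norm y)\<^sup>2)) \<in> borel_measurable lebesgue" for n
      using borel_measurable_integrable by blast
    show "(\<lambda>y. u x0 * eta ((norm (y::real^2))\<^sup>2)) \<in> borel_measurable lebesgue"
      by (intro measurable_completion) simp
    show "AE y in lebesgue. (\<lambda>n. u (x0 + s n *\<^sub>R y) * eta ((norm y)\<^sup>2)) \<longlonglongrightarrow> u x0 * eta ((norm y)\<^sup>2)"
    proof (rule AE_I2)
      fix y :: "real^2"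
      have "isCont u x0"
        using u \<rho> continuous_on_interior by fastforce
      moreover have "(\<lambda>n. x0 + s n *\<^sub>R y) \<longlonglongrightarrow> x0"
        using s(1) by (auto intro!: tendsto_eq_intros)
      ultimately have "(\<lambda>n. u (x0 + s n *\<^sub>R y)) \<longlonglongrightarrow> u x0"
        by (rule isCont_tendsto_compose)
      then show "(\<lambda>n. u (x0 + s n *\<^sub>R y) * eta ((norm y)\<^sup>2)) \<longlonglongrightarrow> u x0 * eta ((norm y)\<^sup>2)"
        by (intro tendsto_intros)
    qed
    show "AE y in lebesgue. norm (u (x0 + s n *\<^sub>R y) * eta ((norm y)\<^sup>2)) \<le> B * eta ((norm y)\<^sup>2)" for n
    proof (rule AE_I2)
      fix y :: "real^2"
      show "norm (u (x0 + s n *\<^sub>R y) * eta ((norm y)\<^sup>2)) \<le> B * eta ((norm y)\<^sup>2)"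
      proof (cases "norm y < 1")
        case True
        then have "s n * norm y \<le> s n * 1" using s(2)[of n] by (intro mult_left_mono) auto
        then have "s n * norm y \<le> \<rho>" using s(3)[of n] by linarith
        then have "x0 + s n *\<^sub>R y \<in> cball x0 \<rho>" using s(2)[of n] by (simp add: dist_norm)
        from B[OF this] show ?thesis
          using eta_nonneg by (simp add: abs_mult mult_right_mono)
      next
        case False
        then have "eta ((norm y)\<^sup>2) = 0" by (intro eta_eq_0) auto
        then show ?thesis by simp
      qed
    qed
  qed
  then show ?thesis unfolding eq by (simp add: eta_mass_def mult.commute)
qed

text \<open>Testing with \<open>cutlog (s n) \<rho> x0\<close> gives the difference of the averages
  of u at the scales s n and \<rho>. As s n -> 0 the first average tends to the value at the centre,
  and the right-hand side converges monotonically because f \<ge> 0. The same argument proves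
  integrability against the unbounded kernel \<open>Green\<close>.\<close>

lemma rep_if_distributional_solution:
  assumes S: "open S" and u: "continuous_on S u" and f: "\<And>x. x \<in> S \<Longrightarrow> f x \<ge> 0"
    and sol: "distributional_solution S u f"
  shows "rep S u f"
  unfolding rep_def
proof (intro allI impI, elim conjE)
  fix x0 \<rho> assume \<rho>: "(0::real) < \<rho>" and sub: "cball x0 \<rho> \<subseteq> S"
  have uc: "continuous_on (cball x0 \<rho>) u" using u sub continuous_on_subset by blast
  have fi: "integrable lebesgue (\<lambda>x. indicator S x * f x)"
    using sol by (simp add: distributional_solution_def set_integrable_def)
  define s where "s n = \<rho> / (real n + 1)" for n
  have s0: "0 < s n" and s\<rho>: "s n \<le> \<rho>" for n
    using \<rho> by (auto simp: s_def field_simps)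
  have smono: "s n \<le> s m" if "m \<le> n" for m n
    using that \<rho> by (auto simp: s_def intro!: divide_left_mono)
  have slim: "s \<longlonglongrightarrow> 0"
    unfolding s_def by real_asymp
  define P where "P r = 1 / r\<^sup>2 * (LINT y|lebesgue. u y * bump r x0 y)" for r
  have ie: "integrable lebesgue (\<lambda>y. u y * bump r x0 y)" if "0 < r" "r \<le> \<rho>" for r
    using integrable_eta_kernel[OF that(1) continuous_on_subset[OF uc subset_cball[OF that(2)]]] .
  have lap: "(LINT y|lebesgue. indicator S y * (f y * cutlog (s n) \<rho> x0 y)) = 4 * (P (s n) - P \<rho>)" for n
  proof -
    have "- (LINT x:S|lebesgue. u x * laplacian (cutlog (s n) \<rho> x0) x) = (LINT x:S|lebesgue. f x * cutlog (s n) \<rho> x0 x)"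
      using sol cutlog_test_function[OF s0 s\<rho> sub] by (auto simp: distributional_solution_def)
    moreover have "(LINT x:S|lebesgue. u x * laplacian (cutlog (s n) \<rho> x0) x) =
      (LINT y|lebesgue. 4 / \<rho>\<^sup>2 * (u y * bump \<rho> x0 y) - 4 / (s n)\<^sup>2 * (u y * bump (s n) x0 y))"
      unfolding set_lebesgue_integral_def
    proof (rule Bochner_Integration.integral_cong[OF refl])
      fix y
      show "indicator S y *\<^sub>R (u y * laplacian (cutlog (s n) \<rho> x0) y) =
        4 / \<rho>\<^sup>2 * (u y * bump \<rho> x0 y) - 4 / (s n)\<^sup>2 * (u y * bump (s n) x0 y)"
      proof (cases "y \<in> S")
        case True
        then show ?thesis
          using s0 \<rho> by (simp add: laplacian_cutlog norm_minus_commute power_divide field_simps)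
      next
        case False
        then have "norm (x0 - y) \<ge> \<rho>" using sub by (force simp: dist_norm)
        then have "bump \<rho> x0 y = 0" "bump (s n) x0 y = 0"
          using s\<rho>[of n] by (auto intro!: eta_kernel_eq_0 \<rho> s0)
        then show ?thesis using False by simp
      qed
    qed
    moreover have "\<dots> = 4 * P \<rho> - 4 * P (s n)"
      unfolding P_def using ie[OF s0 s\<rho>] ie[OF \<rho>] by simp
    ultimately show ?thesis
      by (simp add: set_lebesgue_integral_def)
  qed
  have "integrable lebesgue (\<lambda>y. f y * Green \<rho> x0 y) \<and>
     (LINT y|lebesgue. f y * Green \<rho> x0 y) = 4 * (eta_mass * u x0 - P \<rho>)"
  proof -
    \<comment> \<open>Integrability and measurability of f are known only after restriction to S;
      the kernel vanishes off the disc, so the restriction changes nothing.\<close>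
    have G: "f y * Green \<rho> x0 y = (indicator S y * f y) * Green \<rho> x0 y" for y
    proof (cases "y \<in> S")
      case False
      then have "norm (x0 - y) \<ge> \<rho>" using sub by (force simp: dist_norm)
      then show ?thesis using False Gam_eq_0 \<rho> by simp
    qed auto
    have cm: "cutlog (s n) \<rho> x0 \<in> borel_measurable borel" for n
      using cutlog_smooth[of 0 "s n" \<rho> x0] borel_measurable_continuous_onI by auto
    have i: "integrable lebesgue (\<lambda>y. indicator S y * (f y * cutlog (s n) \<rho> x0 y))" for n
    proof (rule Bochner_Integration.integrable_bound[of _ "\<lambda>y. (2 * theta * ln (\<rho> / s n)) * (indicator S y * f y)"])
      show "integrable lebesgue (\<lambda>y. (2 * theta * ln (\<rho> / s n)) * (indicator S y * f y))"
        using fi by simp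
      show "(\<lambda>y. indicator S y * (f y * cutlog (s n) \<rho> x0 y)) \<in> borel_measurable lebesgue"
        using borel_measurable_times[OF borel_measurable_integrable[OF fi] borel_imp_lebesgue[OF cm[of n]]]
        by (simp add: mult.assoc)
      show "AE y in lebesgue. norm (indicator S y * (f y * cutlog (s n) \<rho> x0 y))
          \<le> norm ((2 * theta * ln (\<rho> / s n)) * (indicator S y * f y))"
      proof (rule AE_I2)
        fix y
        have "\<bar>cutlog (s n) \<rho> x0 y\<bar> \<le> \<bar>2 * theta * ln (\<rho> / s n)\<bar>"
          using cutlog_bounds[OF s0[of n] s\<rho>[of n], of x0 y] by linarith
        from mult_left_mono[OF this, of "\<bar>indicator S y * f y\<bar>"]
        show "norm (indicator S y * (f y * cutlog (s n) \<rho> x0 y))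
            \<le> norm ((2 * theta * ln (\<rho> / s n)) * (indicator S y * f y))"
          by (simp add: abs_mult ac_simps)
      qed
    qed
    have ne: "AE y in lebesgue. y \<noteq> x0"
      by (rule AE_completion) (rule AE_lborel_singleton)
    have "has_bochner_integral lebesgue (\<lambda>y. f y * Green \<rho> x0 y) (4 * (eta_mass * u x0 - P \<rho>))"
    proof (rule has_bochner_integral_monotone_convergence[where f="\<lambda>n y. indicator S y * (f y * cutlog (s n) \<rho> x0 y)"])
      show "AE y in lebesgue. mono (\<lambda>n. indicator S y * (f y * cutlog (s n) \<rho> x0 y))"
        using ne
      proof eventually_elim
        case (elim y)
        then show ?case
          using f smono s\<rho> s0 by (auto simp: mono_def indicator_def intro!: mult_left_mono cutlog_mono)
      qed
      show "AE y in lebesgue. (\<lambda>n. indicator S y * (f y * cutlog (s n) \<rho> x0 y)) \<longlonglongrightarrow> f y * Green \<rho> x0 y"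
        using ne
      proof eventually_elim
        case (elim y)
        then have "\<forall>\<^sub>F n in sequentially. s n < norm (y - x0)"
          using order_tendstoD(2)[OF slim] by simp
        then have "\<forall>\<^sub>F n in sequentially. f y * Green \<rho> x0 y = indicator S y * (f y * cutlog (s n) \<rho> x0 y)"
          by eventually_elim (use G cutlog_eq_Gam[OF s0 s\<rho>] in \<open>simp add: mult.assoc\<close>)
        then show ?case by (rule Lim_transform_eventually[OF tendsto_const])
      qed
      show "(\<lambda>n. LINT y|lebesgue. indicator S y * (f y * cutlog (s n) \<rho> x0 y)) \<longlonglongrightarrow> 4 * (eta_mass * u x0 - P \<rho>)"
        unfolding lap P_def by (intro tendsto_intros eta_average_tendsto[OF uc \<rho> slim s0 s\<rho>])
      have "(\<lambda>y. (indicator S y * f y) * Green \<rho> x0 y) \<in> borel_measurable lebesgue"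
        by (intro borel_measurable_times borel_measurable_integrable[OF fi] measurable_completion) simp
      then show "(\<lambda>y. f y * Green \<rho> x0 y) \<in> borel_measurable lebesgue"
        unfolding G .
    qed (rule i)
    then show ?thesis by (simp add: has_bochner_integral_iff)
  qed
  then show "integrable lebesgue (\<lambda>y. f y * Green \<rho> x0 y) \<and>
     4 * eta_mass * u x0 =
       4 / \<rho>\<^sup>2 * (LINT y|lebesgue. u y * bump \<rho> x0 y)
       + (LINT y|lebesgue. f y * Green \<rho> x0 y)"
    by (simp add: P_def)
qed

section \<open>Integrals of the singular kernels\<close>

lemma cball_borel[measurable]: "cball x r \<in> sets borel" for x :: "'a::euclidean_space"
  by simp

lemma single_le_suminf: "f j \<le> (\<Sum>j. f j)" for f :: "nat \<Rightarrow> ennreal"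
  using sum_le_suminf[of f "{j}"] by simp

text \<open>A substitute for polar coordinates: the function is dominated by the sum of the
  constants c j on the discs of radius r j, and the given series is the integral of this sum up to
  the area of the unit disc.\<close>

lemma integrable_cball_series:
  fixes f :: "real^2 \<Rightarrow> real"
  assumes f[measurable]: "f \<in> borel_measurable borel" and f0: "\<And>y. f y \<ge> 0"
    and c: "\<And>j. c j \<ge> 0" and r: "\<And>j. r j \<ge> 0"
    and cov: "\<And>y. f y > 0 \<Longrightarrow> \<exists>j. norm y \<le> r j \<and> f y \<le> c j"
    and sm: "summable (\<lambda>j. c j * (r j)\<^sup>2)"
  shows "integrable lebesgue f"
proof (rule integrable_lebesgue_if_lborel, rule integrableI_nonneg)
  have nn: "0 \<le> unit_ball_vol 2 * (c j * (r j)\<^sup>2)" for j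
    using c by (auto simp: unit_ball_vol_def)
  have "(\<integral>\<^sup>+y. ennreal (f y) \<partial>lborel) \<le> (\<integral>\<^sup>+y. (\<Sum>j. ennreal (c j) * indicator (cball (0::real^2) (r j)) y) \<partial>lborel)"
  proof (rule nn_integral_mono)
    fix y :: "real^2"
    show "ennreal (f y) \<le> (\<Sum>j. ennreal (c j) * indicator (cball 0 (r j)) y)"
    proof (cases "f y > 0")
      case True
      then obtain j where j: "norm y \<le> r j" "f y \<le> c j" using cov by blast
      have "ennreal (f y) \<le> ennreal (c j) * indicator (cball 0 (r j)) y"
        using j by (simp add: ennreal_leI)
      also have "\<dots> \<le> (\<Sum>j. ennreal (c j) * indicator (cball 0 (r j)) y)"
        by (rule single_le_suminf)
      finally show ?thesis .
    next
      case False
      then show ?thesis using f0[of y] by (simp add: ennreal_neg)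
    qed
  qed
  also have "\<dots> = (\<Sum>j. \<integral>\<^sup>+y. ennreal (c j) * indicator (cball (0::real^2) (r j)) y \<partial>lborel)"
    by (rule nn_integral_suminf) measurable
  also have "\<dots> = (\<Sum>j. ennreal (unit_ball_vol 2 * (c j * (r j)\<^sup>2)))"
  proof (rule suminf_cong)
    fix j
    have "(\<integral>\<^sup>+y. ennreal (c j) * indicator (cball (0::real^2) (r j)) y \<partial>lborel) = ennreal (c j) * ennreal (unit_ball_vol 2 * (r j)\<^sup>2)"
      using emeasure_cball[OF r[of j], of "0::real^2"] by (subst nn_integral_cmult_indicator) auto
    also have "\<dots> = ennreal (unit_ball_vol 2 * (c j * (r j)\<^sup>2))"
      using c by (subst ennreal_mult[symmetric]) (auto simp: ac_simps unit_ball_vol_def)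
    finally show "(\<integral>\<^sup>+y. ennreal (c j) * indicator (cball (0::real^2) (r j)) y \<partial>lborel) = ennreal (unit_ball_vol 2 * (c j * (r j)\<^sup>2))" .
  qed
  also have "\<dots> < \<infinity>"
    using ennreal_suminf_neq_top[OF summable_mult[OF sm, of "unit_ball_vol 2"] nn]
    unfolding infinity_ennreal_def by (simp only: top.not_eq_extremum)
  finally show "(\<integral>\<^sup>+y. ennreal (f y) \<partial>lborel) < \<infinity>" .
qed (use f0 in auto)

definition npow :: "real \<Rightarrow> real" where
  "npow p = (LINT y|lebesgue. indicator (cball 0 1) y * norm (y :: real^2) powr (-p))"

text \<open>The exponent 4 is \<mu> times the exponent 4 / \<mu> dual to 1 / lam, hence the same for
  every \<mu>.\<close>

definition ntail :: real where
  "ntail = (LINT y|lebesgue. indicator (- cball 0 1) y * norm (y :: real^2) powr (-4))"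

lemma npow_nonneg: "npow p \<ge> 0" and ntail_nonneg: "ntail \<ge> 0"
  unfolding npow_def ntail_def by (auto intro!: integral_nonneg_AE)

lemma dyadic_exists_below:
  assumes "0 < t" "t \<le> (1::real)"
  shows "\<exists>j. t \<le> (1/2) ^ j \<and> (1/2) ^ Suc j \<le> t"
proof -
  have "\<exists>n. (1/2::real) ^ n \<le> t" using real_arch_pow_inv[of t "1/2"] assms by (auto intro: less_imp_le)
  then obtain n where n: "(1/2::real) ^ n \<le> t" and min: "\<And>m. m < n \<Longrightarrow> \<not> (1/2::real) ^ m \<le> t"
    using exists_least_iff[of "\<lambda>n. (1/2::real) ^ n \<le> t"] by blast
  show ?thesis
  proof (cases n)
    case 0
    then show ?thesis using n assms by (intro exI[of _ 0]) auto
  next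
    case (Suc m)
    then show ?thesis using n min[of m] by (intro exI[of _ m]) auto
  qed
qed

text \<open>On the shell between the radii 2^(-j-1) and 2^(-j) the integrand is at most 2^(p (j +
  1)), and the area is of order 4^(-j); the ratio 2^p / 4 is less than 1 because p < 2.\<close>

lemma integrable_npow:
  assumes "0 \<le> p" "p < 2"
  shows "integrable lebesgue (\<lambda>y. indicator (cball 0 1) y * norm (y :: real^2) powr (-p))"
proof (rule integrable_cball_series[where c="\<lambda>j. 2 powr p * (2 powr p) ^ j" and r="\<lambda>j. (1/2) ^ j"])
  fix y :: "real^2" assume "indicator (cball 0 1) y * norm y powr - p > 0"
  then have y: "0 < norm y" "norm y \<le> 1" by (auto simp: indicator_def zero_less_mult_iff)
  then obtain j where j: "norm y \<le> (1/2) ^ j" "(1/2) ^ Suc j \<le> norm y" using dyadic_exists_below by blast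
  have "norm y powr (-p) \<le> ((1/2) ^ Suc j) powr (-p)"
    using j(2) y assms by (intro powr_mono2') auto
  also have "\<dots> = 2 powr p * (2 powr p) ^ j"
    by (simp add: powr_minus powr_mult powr_power powr_divide power_divide powr_realpow[symmetric] powr_powr field_simps
          flip: powr_add)
  finally show "\<exists>j. norm y \<le> (1 / 2) ^ j \<and> indicator (cball 0 1) y * norm y powr - p \<le> 2 powr p * (2 powr p) ^ j"
    using j(1) by (intro exI[of _ j]) (simp add: indicator_def)
next
  have eq: "2 powr p * (2 powr p) ^ j * ((1/2) ^ j)\<^sup>2 = 2 powr p * (2 powr p / 4) ^ j" for j :: nat
    by (induction j) (auto simp: power2_eq_square field_simps)
  have "summable (\<lambda>j. 2 powr p * (2 powr p / 4) ^ j)"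
    using assms powr_less_mono[of p 2 2] by (intro summable_mult summable_geometric) auto
  then show "summable (\<lambda>j. 2 powr p * (2 powr p) ^ j * ((1/2) ^ j)\<^sup>2)" unfolding eq .
qed auto

lemma integrable_ntail:
  "integrable lebesgue (\<lambda>y. indicator (- cball 0 1) y * norm (y :: real^2) powr (-4))"
proof (rule integrable_cball_series[where c="\<lambda>j. (1/16) ^ j" and r="\<lambda>j. 2 ^ Suc j"])
  fix y :: "real^2" assume "indicator (- cball 0 1) y * norm y powr - 4 > 0"
  then have y: "norm y > 1" by (auto simp: indicator_def zero_less_mult_iff)
  then have np: "norm y > 0" by linarith
  then have y': "0 < 1 / norm y" "1 / norm y \<le> 1" using y by (simp_all only: zero_less_divide_1_iff divide_le_eq_1_pos)
  from dyadic_exists_below[OF y'] obtain j where j: "1 / norm y \<le> (1/2) ^ j" "(1/2) ^ Suc j \<le> 1 / norm y"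
    by blast
  have "norm y powr - 4 = (1 / norm y) ^ 4"
    using y by (simp add: powr_minus power_divide inverse_eq_divide flip: powr_realpow)
  also have "\<dots> \<le> ((1/2) ^ j) ^ 4" using j(1) y by (intro power_mono) auto
  also have "\<dots> = ((1/2) ^ 4) ^ j" by (metis power_mult mult.commute)
  also have "\<dots> = (1/16) ^ j" by (simp add: power_divide)
  finally have "norm y powr - 4 \<le> (1/16) ^ j" .
  moreover have "norm y \<le> 2 ^ Suc j" using j(2) np by (simp add: field_simps)
  ultimately show "\<exists>j. norm y \<le> 2 ^ Suc j \<and> indicator (- cball 0 1) y * norm y powr - 4 \<le> (1 / 16) ^ j"
    using y by (intro exI[of _ j]) (auto simp: indicator_def)
next
  have eq: "(1 / 16) ^ j * (2 ^ Suc j)\<^sup>2 = 4 * (1/4::real) ^ j" for j :: nat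
    by (induction j) (auto simp: power2_eq_square field_simps)
  have "summable (\<lambda>j. 4 * (1/4::real) ^ j)" by (intro summable_mult summable_geometric) auto
  then show "summable (\<lambda>j. (1 / 16) ^ j * (2 ^ Suc j)\<^sup>2 :: real)" unfolding eq .
qed auto

lemma near_power:
  fixes x :: "real^2"
  assumes "0 \<le> p" "p < 2" "R > 0"
  shows "integrable lebesgue (\<lambda>y. indicator (cball x R) y * norm (x - y) powr (-p))"
    "(LINT y|lebesgue. indicator (cball x R) y * norm (x - y) powr (-p)) = R powr (2 - p) * npow p"
proof -
  have eq: "indicator (cball x R) (x + R *\<^sub>R y) * norm (x - (x + R *\<^sub>R y)) powr (-p) =
      R powr (-p) * (indicator (cball 0 1) y * norm y powr (-p))" for y
    using assms by (auto simp: indicator_def dist_norm powr_mult)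
  show "integrable lebesgue (\<lambda>y. indicator (cball x R) y * norm (x - y) powr (-p))"
    using integrable_lebesgue_scale[of R "\<lambda>y. indicator (cball x R) y * norm (x - y) powr (-p)" x]
      integrable_npow[OF assms(1,2)] assms(3) unfolding eq by simp
  show "(LINT y|lebesgue. indicator (cball x R) y * norm (x - y) powr (-p)) = R powr (2 - p) * npow p"
    using integral_lebesgue_scale[of R "\<lambda>y. indicator (cball x R) y * norm (x - y) powr (-p)" x] assms(3)
    unfolding eq by (simp add: npow_def powr_diff) (simp add: powr_minus divide_inverse)
qed

lemma far_power:
  fixes x :: "real^2"
  assumes "R > 0"
  shows "integrable lebesgue (\<lambda>y. indicator (- cball x R) y * norm (x - y) powr (-4))"
    "(LINT y|lebesgue. indicator (- cball x R) y * norm (x - y) powr (-4)) = ntail / R\<^sup>2"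
proof -
  have eq: "indicator (- cball x R) (x + R *\<^sub>R y) * norm (x - (x + R *\<^sub>R y)) powr (-4) =
      R powr (-4) * (indicator (- cball 0 1) y * norm y powr (-4))" for y
    using assms by (auto simp: indicator_def dist_norm powr_mult)
  show "integrable lebesgue (\<lambda>y. indicator (- cball x R) y * norm (x - y) powr (-4))"
    using integrable_lebesgue_scale[of R "\<lambda>y. indicator (- cball x R) y * norm (x - y) powr (-4)" x]
      integrable_ntail assms unfolding eq by simp
  have "R powr (-4) = 1 / (R\<^sup>2 * R\<^sup>2)"
  proof -
    have "R powr (-4) = inverse (R powr (real 4))" by (simp add: powr_minus)
    also have "\<dots> = inverse (R ^ 4)" using assms by (subst powr_realpow) auto
    finally show ?thesis by (simp add: divide_inverse power2_eq_square power4_eq_xxxx mult.assoc)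
  qed
  then show "(LINT y|lebesgue. indicator (- cball x R) y * norm (x - y) powr (-4)) = ntail / R\<^sup>2"
    using integral_lebesgue_scale[of R "\<lambda>y. indicator (- cball x R) y * norm (x - y) powr (-4)" x] assms
    unfolding eq by (simp add: ntail_def) (simp add: divide_simps power2_eq_square power4_eq_xxxx)
qed

text \<open>Within distance 1 of x the bound C is paired with the locally integrable kernel; beyond,
  the kernel is at most 1 and the mass of F suffices.\<close>

lemma singular_kernel_bound:
  fixes x :: "real^2"
  assumes p: "0 \<le> p" "p < 2" and F: "integrable lebesgue F" "\<And>y. F y \<ge> 0"
    and C: "\<And>y. norm (x - y) \<le> 1 \<Longrightarrow> F y \<le> C"
  shows "integrable lebesgue (\<lambda>y. F y * norm (x - y) powr (-p))"
    "(LINT y|lebesgue. F y * norm (x - y) powr (-p)) \<le> C * npow p + (LINT y|lebesgue. F y)"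
proof -
  let ?w = "\<lambda>y. C * (indicator (cball x 1) y * norm (x - y) powr (-p)) + F y"
  have w: "integrable lebesgue ?w"
    using near_power[OF p, of 1 x] F(1) by simp
  have le: "F y * norm (x - y) powr (-p) \<le> ?w y" for y
  proof (cases "norm (x - y) \<le> 1")
    case True
    then show ?thesis using C[OF True] F(2)[of y] by (simp add: dist_norm indicator_def add_increasing2 mult_right_mono)
  next
    case False
    then have "norm (x - y) powr (-p) \<le> 1" using p by (simp add: powr_minus inverse_le_1_iff ge_one_powr_ge_zero)
    then show ?thesis using False F(2)[of y] by (simp add: dist_norm mult_left_le)
  qed
  show i: "integrable lebesgue (\<lambda>y. F y * norm (x - y) powr (-p))"
  proof (rule Bochner_Integration.integrable_bound[OF w])
    show "(\<lambda>y. F y * norm (x - y) powr (-p)) \<in> borel_measurable lebesgue"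
      by (rule borel_measurable_times[OF borel_measurable_integrable[OF F(1)] borel_imp_lebesgue]) measurable
    show "AE y in lebesgue. norm (F y * norm (x - y) powr (-p)) \<le> norm (?w y)"
      using le F(2) by (intro AE_I2) (smt (verit) mult_nonneg_nonneg powr_ge_zero real_norm_def)
  qed
  have "(LINT y|lebesgue. F y * norm (x - y) powr (-p)) \<le> (LINT y|lebesgue. ?w y)"
    by (intro integral_mono i w le)
  also have "\<dots> = C * npow p + (LINT y|lebesgue. F y)"
    using near_power[OF p, of 1 x] F(1) by simp
  finally show "(LINT y|lebesgue. F y * norm (x - y) powr (-p)) \<le> C * npow p + (LINT y|lebesgue. F y)" .
qed

text \<open>Young's inequality with the exponents 1 / lam and 4 / \<mu>, which are conjugate because
  lam + \<mu> / 4 = 1. The weight \<delta> shifts the loss between the factors: a small \<delta>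
  makes the first term small, and then a large S the second, uniformly in g.\<close>

lemma riesz_tail:
  fixes x :: "real^2"
  assumes \<mu>: "0 < \<mu>" "\<mu> < 2" and lam: "lam = (4 - \<mu>) / 4"
    and g: "g \<in> borel_measurable lebesgue" "\<And>y. g y \<ge> 0"
    and gi: "integrable lebesgue (\<lambda>y. g y powr (1 / lam))" "(LINT y|lebesgue. g y powr (1 / lam)) \<le> c0"
    and S: "S > 0" and \<delta>: "\<delta> > 0"
  shows "integrable lebesgue (\<lambda>y. indicator (- cball x S) y * (g y / norm (x - y) powr \<mu>))"
    "(LINT y|lebesgue. indicator (- cball x S) y * (g y / norm (x - y) powr \<mu>))
      \<le> \<delta> powr (1 / lam) * c0 + \<delta> powr (- 4 / \<mu>) * ntail / S\<^sup>2"
proof -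
  have l: "0 < lam" "lam < 1" using \<mu> lam by auto
  let ?w = "\<lambda>y. \<delta> powr (1 / lam) * g y powr (1 / lam) + \<delta> powr (- 4 / \<mu>) * (indicator (- cball x S) y * norm (x - y) powr (-4))"
  have w: "integrable lebesgue ?w"
    using far_power[OF S, of x] gi(1) by simp
  have le: "indicator (- cball x S) y * (g y / norm (x - y) powr \<mu>) \<le> ?w y" for y
  proof (cases "norm (x - y) \<le> S")
    case True
    then show ?thesis by (simp add: dist_norm)
  next
    case False
    then have pos: "norm (x - y) > 0" using S by linarith
    have Y: "(\<delta> * g y) * (norm (x - y) powr (-\<mu>) / \<delta>) \<le>
        (\<delta> * g y) powr (1/lam) / (1/lam) + (norm (x - y) powr (-\<mu>) / \<delta>) powr (4/\<mu>) / (4/\<mu>)"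
      using \<mu> l g(2)[of y] \<delta> by (intro Youngs_inequality) (auto simp: lam field_simps)
    have e1: "(\<delta> * g y) powr (1/lam) = \<delta> powr (1/lam) * g y powr (1/lam)"
      using \<delta> g(2) by (simp add: powr_mult)
    have e2: "(norm (x - y) powr (-\<mu>) / \<delta>) powr (4/\<mu>) = \<delta> powr (- 4 / \<mu>) * norm (x - y) powr (-4)"
    proof -
      have "(norm (x - y) powr (-\<mu>)) powr (4/\<mu>) = norm (x - y) powr (-4)"
        using \<mu> by (simp only: powr_powr) simp
      moreover have "\<delta> powr (- 4 / \<mu>) = 1 / \<delta> powr (4 / \<mu>)"
        by (simp flip: powr_minus_divide)
      ultimately show ?thesis using \<delta> by (subst powr_divide) simp_all
    qed
    have "(\<delta> * g y) powr (1/lam) / (1/lam) \<le> (\<delta> * g y) powr (1/lam)"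
      using l by (simp add: mult_left_le)
    moreover have "(norm (x - y) powr (-\<mu>) / \<delta>) powr (4/\<mu>) / (4/\<mu>) \<le> (norm (x - y) powr (-\<mu>) / \<delta>) powr (4/\<mu>)"
      using \<mu> by (simp add: divide_le_eq mult_left_mono)
    moreover have "(\<delta> * g y) * (norm (x - y) powr (-\<mu>) / \<delta>) = g y / norm (x - y) powr \<mu>"
      using \<delta> by (simp add: powr_minus field_simps)
    ultimately have "g y / norm (x - y) powr \<mu> \<le> \<delta> powr (1 / lam) * g y powr (1 / lam) + \<delta> powr (- 4 / \<mu>) * norm (x - y) powr (-4)"
      using Y unfolding e1 e2 by linarith
    then show ?thesis using False by (simp add: dist_norm)
  qed
  show i: "integrable lebesgue (\<lambda>y. indicator (- cball x S) y * (g y / norm (x - y) powr \<mu>))"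
  proof (rule Bochner_Integration.integrable_bound[OF w])
    show "(\<lambda>y. indicator (- cball x S) y * (g y / norm (x - y) powr \<mu>)) \<in> borel_measurable lebesgue"
      by (intro borel_measurable_times borel_measurable_divide g(1)) (rule borel_imp_lebesgue, measurable)+
    show "AE y in lebesgue. norm (indicator (- cball x S) y * (g y / norm (x - y) powr \<mu>)) \<le> norm (?w y)"
    proof (rule AE_I2)
      fix y
      have "0 \<le> indicator (- cball x S) y * (g y / norm (x - y) powr \<mu>)" using g(2) by simp
      then show "norm (indicator (- cball x S) y * (g y / norm (x - y) powr \<mu>)) \<le> norm (?w y)"
        using le[of y] by simp
    qed
  qed
  have "(LINT y|lebesgue. indicator (- cball x S) y * (g y / norm (x - y) powr \<mu>)) \<le> (LINT y|lebesgue. ?w y)"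
    by (intro integral_mono i w le)
  also have "\<dots> = \<delta> powr (1 / lam) * (LINT y|lebesgue. g y powr (1 / lam)) + \<delta> powr (- 4 / \<mu>) * ntail / S\<^sup>2"
    using far_power[OF S, of x] gi(1) by simp
  also have "\<dots> \<le> \<delta> powr (1 / lam) * c0 + \<delta> powr (- 4 / \<mu>) * ntail / S\<^sup>2"
    using gi(2) by (intro add_right_mono mult_left_mono) auto
  finally show "(LINT y|lebesgue. indicator (- cball x S) y * (g y / norm (x - y) powr \<mu>))
      \<le> \<delta> powr (1 / lam) * c0 + \<delta> powr (- 4 / \<mu>) * ntail / S\<^sup>2" .
qed

text \<open>Inside the unit disc about x the bound B meets the locally integrable kernel; outside,
  \<open>riesz_tail\<close> is used with S = \<delta> = 1.\<close>

lemma riesz_bound: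
  fixes x :: "real^2"
  assumes \<mu>: "0 < \<mu>" "\<mu> < 2" and lam: "lam = (4 - \<mu>) / 4"
    and g: "g \<in> borel_measurable lebesgue" "\<And>y. g y \<ge> 0"
    and gi: "integrable lebesgue (\<lambda>y. g y powr (1 / lam))" "(LINT y|lebesgue. g y powr (1 / lam)) \<le> c0"
    and B: "\<And>y. norm (x - y) \<le> 1 \<Longrightarrow> g y \<le> B"
  shows "integrable lebesgue (\<lambda>y. g y / norm (x - y) powr \<mu>)"
    "riesz_potential \<mu> g x \<le> B * npow \<mu> + c0 + ntail"
    "riesz_potential \<mu> g x \<ge> 0"
proof -
  note t = riesz_tail[OF \<mu> lam g gi, of 1 1 x, simplified]
  let ?w = "\<lambda>y. B * (indicator (cball x 1) y * norm (x - y) powr (-\<mu>)) + indicator (- cball x 1) y * (g y / norm (x - y) powr \<mu>)"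
  have \<mu>': "0 \<le> \<mu>" using \<mu> by simp
  have w: "integrable lebesgue ?w"
    using near_power(1)[OF \<mu>' \<mu>(2), of 1 x] t(1) by simp
  have le: "g y / norm (x - y) powr \<mu> \<le> ?w y" for y
    using B[of y] by (auto simp: indicator_def dist_norm powr_minus divide_inverse mult_right_mono)
  show i: "integrable lebesgue (\<lambda>y. g y / norm (x - y) powr \<mu>)"
  proof (rule Bochner_Integration.integrable_bound[OF w])
    show "(\<lambda>y. (g y / norm (x - y) powr \<mu>)) \<in> borel_measurable lebesgue"
      by (intro borel_measurable_divide g(1)) (rule borel_imp_lebesgue, measurable)
    show "AE y in lebesgue. norm (g y / norm (x - y) powr \<mu>) \<le> norm (?w y)"
    proof (rule AE_I2)
      fix y
      have "0 \<le> (g y / norm (x - y) powr \<mu>)" using g(2) by simp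
      then show "norm (g y / norm (x - y) powr \<mu>) \<le> norm (?w y)"
        using le[of y] by simp
    qed
  qed
  have "riesz_potential \<mu> g x \<le> (LINT y|lebesgue. ?w y)"
    unfolding riesz_potential_def by (intro integral_mono i w le)
  also have "\<dots> = B * npow \<mu> + (LINT y|lebesgue. indicator (- cball x 1) y * (g y / norm (x - y) powr \<mu>))"
    using near_power[OF \<mu>' \<mu>(2), of 1 x] t(1) by simp
  also have "\<dots> \<le> B * npow \<mu> + (c0 + ntail)"
    using t(2) by (intro add_left_mono) auto
  finally show "riesz_potential \<mu> g x \<le> B * npow \<mu> + c0 + ntail" by simp
  show "riesz_potential \<mu> g x \<ge> 0"
    unfolding riesz_potential_def using g(2) by (intro integral_nonneg_AE) auto
qed

section \<open>Differences of logarithmic kernels at two points\<close>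

lemma ln_norm_diff_bound:
  fixes a b :: "'a::real_normed_vector"
  assumes ab: "a \<noteq> 0" "b \<noteq> 0"
  shows "\<bar>ln (norm a) - ln (norm b)\<bar> \<le> norm (a - b) * (norm a powr (-1) + norm b powr (-1))"
proof -
  have *: "ln (norm a) - ln (norm b) \<le> norm (a - b) * norm b powr (-1)" if "a \<noteq> 0" "b \<noteq> 0" for a b :: 'a
  proof -
    have "ln (norm a) - ln (norm b) = ln (norm a / norm b)" using that by (simp add: ln_div)
    also have "\<dots> \<le> norm a / norm b - 1" using that by (intro ln_le_minus_one) auto
    also have "\<dots> = (norm a - norm b) / norm b" using that by (simp add: field_simps)
    also have "\<dots> \<le> norm (a - b) / norm b" by (intro divide_right_mono norm_triangle_ineq2) auto
    finally show ?thesis using that by (simp add: powr_minus divide_inverse)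
  qed
  have "0 \<le> norm (a - b) * norm a powr (-1)" "0 \<le> norm (a - b) * norm b powr (-1)" by auto
  moreover have "ln (norm b) - ln (norm a) \<le> norm (a - b) * norm a powr (-1)"
    using *[OF ab(2,1)] by (simp only: norm_minus_commute[of b a])
  ultimately show ?thesis
    using *[OF ab] unfolding distrib_left by linarith
qed

text \<open>Gam(r) is Lg(r^2) - theta ln(r^2): it decreases by \<open>Lg_ln_antimono\<close>, and
  since \<open>Lg\<close> increases it falls no faster than -2 theta ln r.\<close>

lemma Gam_diff_le_ln:
  assumes "0 < r" "0 < s" shows "\<bar>Gam r - Gam s\<bar> \<le> 2 * theta * \<bar>ln r - ln s\<bar>"
proof -
  have *: "\<bar>Gam r - Gam s\<bar> \<le> 2 * theta * \<bar>ln r - ln s\<bar>" if rs: "0 < r" "r \<le> s" for r s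
  proof -
    have "Lg (r\<^sup>2) \<le> Lg (s\<^sup>2)" using rs by (intro Lg_mono power_mono) auto
    moreover have "Lg (s\<^sup>2) - theta * ln (s\<^sup>2) \<le> Lg (r\<^sup>2) - theta * ln (r\<^sup>2)"
      using rs by (intro Lg_ln_antimono power_mono) auto
    moreover have "ln r \<le> ln s" using rs by simp
    ultimately show ?thesis
      using rs theta_pos by (simp add: Gam_def ln_realpow algebra_simps)
  qed
  show ?thesis
    using *[of r s] *[of s r] assms by (cases "r \<le> s") (auto simp: abs_minus_commute)
qed

text \<open>The bound does not involve \<rho>, so it can dominate the kernels while \<rho> tends to
  infinity.\<close>

lemma Gam_norm_diff_bound:
  fixes x x' y :: "real^2"
  assumes "x \<noteq> y" "x' \<noteq> y" "\<rho> > 0"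
  shows "\<bar>Green \<rho> x y - Green \<rho> x' y\<bar>
    \<le> 2 * theta * norm (x - x') * (norm (x - y) powr (-1) + norm (x' - y) powr (-1))"
proof -
  have "\<bar>Green \<rho> x y - Green \<rho> x' y\<bar> \<le> 2 * theta * \<bar>ln (norm (x - y)) - ln (norm (x' - y))\<bar>"
    using Gam_diff_le_ln[of "norm (x - y) / \<rho>" "norm (x' - y) / \<rho>"] assms by (simp add: ln_div)
  also have "\<dots> \<le> 2 * theta * (norm (x - x') * (norm (x - y) powr (-1) + norm (x' - y) powr (-1)))"
    using ln_norm_diff_bound[of "x - y" "x' - y"] assms theta_pos by (intro mult_left_mono) auto
  finally show ?thesis by (simp add: mult.assoc)
qed

section \<open>An almost conformal dilation\<close>

text \<open>A bounded vector field with Lipschitz constant 1 that tends to the identity as \<open>\<epsilon> \<rightarrow> 0\<close>.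
  Deforming along it instead of dilating makes all integrals in the Pohozaev argument converge
  without any decay of the solution.\<close>

definition Xf :: "real \<Rightarrow> 'a::real_inner \<Rightarrow> 'a" where
  "Xf \<epsilon> x = (1 / (1 + \<epsilon> * (norm x)\<^sup>2)) *\<^sub>R x"

definition Tf :: "real \<Rightarrow> real \<Rightarrow> 'a::real_inner \<Rightarrow> 'a" where
  "Tf s \<epsilon> x = x + s *\<^sub>R Xf \<epsilon> x"

text \<open>Over the common denominator (p q)^2 the squared left side has the numerator p q |x -
  y|^2 - \<epsilon> (|x|^2 - |y|^2)^2. Dropping the square and using p q \<ge> 1 gives the Lipschitz
  constant 1.\<close>

lemma norm_Xf_diff_le:
  assumes "\<epsilon> \<ge> 0" shows "norm (Xf \<epsilon> x - Xf \<epsilon> y) \<le> norm (x - y)"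
proof -
  define a b c where "a = (norm x)\<^sup>2" and "b = (norm y)\<^sup>2" and "c = x \<bullet> y"
  define p q where "p = 1 + \<epsilon> * a" and "q = 1 + \<epsilon> * b"
  have pq: "p \<ge> 1" "q \<ge> 1" using assms by (auto simp: p_def q_def a_def b_def)
  have d: "(norm (x - y))\<^sup>2 = a + b - 2 * c"
    by (simp add: a_def b_def c_def power2_norm_eq_inner inner_diff_left inner_diff_right inner_commute)
  have "(norm (Xf \<epsilon> x - Xf \<epsilon> y))\<^sup>2 = a / p\<^sup>2 + b / q\<^sup>2 - 2 * c / (p * q)"
  proof -
    have "Xf \<epsilon> x = (1 / p) *\<^sub>R x" "Xf \<epsilon> y = (1 / q) *\<^sub>R y"
      by (simp_all add: Xf_def p_def q_def a_def b_def)
    moreover have "a = x \<bullet> x" "b = y \<bullet> y" by (simp_all add: a_def b_def power2_norm_eq_inner)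
    ultimately show ?thesis
      unfolding c_def power2_norm_eq_inner
      by (simp add: inner_diff_left inner_diff_right inner_commute power2_eq_square)
  qed
  also have "\<dots> = (a * q\<^sup>2 + b * p\<^sup>2 - 2 * c * (p * q)) / (p * q)\<^sup>2"
    using pq by (simp add: divide_simps power2_eq_square)
  also have "a * q\<^sup>2 + b * p\<^sup>2 - 2 * c * (p * q) = (a + b - 2 * c) * (p * q) - \<epsilon> * (a - b)\<^sup>2"
    unfolding p_def q_def by (simp add: power2_eq_square algebra_simps)
  also have "((a + b - 2 * c) * (p * q) - \<epsilon> * (a - b)\<^sup>2) / (p * q)\<^sup>2 \<le> ((a + b - 2 * c) * (p * q)) / (p * q)\<^sup>2"
    using assms by (intro divide_right_mono) auto
  also have "\<dots> = (a + b - 2 * c) / (p * q)" using pq by (simp add: power2_eq_square)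
  also have "\<dots> \<le> (a + b - 2 * c) / 1"
    using pq mult_mono[of 1 p 1 q] zero_le_power2[of "norm (x - y)"] unfolding d
    by (intro divide_left_mono) auto
  also have "\<dots> = (norm (x - y))\<^sup>2" by (simp add: d)
  finally show ?thesis by (rule power2_le_imp_le) simp
qed

text \<open>This is (1 - \<epsilon> |x|^2)^2 \<ge> 0 in disguise.\<close>

lemma norm_Xf_le:
  assumes "\<epsilon> > 0" shows "(norm (Xf \<epsilon> x))\<^sup>2 \<le> 1 / (4 * \<epsilon>)"
proof -
  define a where "a = (norm x)\<^sup>2"
  have a: "a \<ge> 0" by (simp add: a_def)
  then have p: "1 + \<epsilon> * a > 0" using assms by (simp add: add_pos_nonneg)
  have "(norm (Xf \<epsilon> x))\<^sup>2 = a / (1 + \<epsilon> * a)\<^sup>2"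
    using p by (simp add: Xf_def a_def power_divide)
  moreover have "4 * \<epsilon> * a \<le> (1 + \<epsilon> * a)\<^sup>2"
    using zero_le_power2[of "1 - \<epsilon> * a"] by (simp add: power2_eq_square algebra_simps)
  moreover have "(1 + \<epsilon> * a)\<^sup>2 > 0" using p by simp
  ultimately show ?thesis
    using assms by (simp add: pos_divide_le_eq pos_le_divide_eq mult.commute mult.left_commute)
qed

lemma norm_Tf_diff_upper:
  assumes "\<epsilon> \<ge> 0" "s \<ge> 0" shows "norm (Tf s \<epsilon> x - Tf s \<epsilon> y) \<le> (1 + s) * norm (x - y)"
proof -
  have "Tf s \<epsilon> x - Tf s \<epsilon> y = (x - y) + s *\<^sub>R (Xf \<epsilon> x - Xf \<epsilon> y)" by (simp add: Tf_def algebra_simps)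
  then have "norm (Tf s \<epsilon> x - Tf s \<epsilon> y) \<le> norm (x - y) + s * norm (Xf \<epsilon> x - Xf \<epsilon> y)"
    using assms norm_triangle_ineq[of "x - y" "s *\<^sub>R (Xf \<epsilon> x - Xf \<epsilon> y)"] by simp
  also have "\<dots> \<le> norm (x - y) + s * norm (x - y)"
    using assms norm_Xf_diff_le[of \<epsilon> x y] by (intro add_left_mono mult_left_mono) auto
  finally show ?thesis by (simp add: algebra_simps)
qed

text \<open>\<open>Tf\<close> is the identity plus a contraction with constant s < 1.\<close>

lemma inj_Tf:
  assumes "\<epsilon> \<ge> 0" "0 \<le> s" "s < 1" shows "inj (Tf s \<epsilon>)"
proof (rule injI)
  fix x y :: 'a assume "Tf s \<epsilon> x = Tf s \<epsilon> y"
  then have "x - y = s *\<^sub>R (Xf \<epsilon> y - Xf \<epsilon> x)" by (simp add: Tf_def algebra_simps)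
  then have "norm (x - y) = s * norm (Xf \<epsilon> x - Xf \<epsilon> y)" using assms by (simp add: norm_minus_commute)
  also have "\<dots> \<le> s * norm (x - y)" using assms norm_Xf_diff_le by (intro mult_left_mono) auto
  finally have "(1 - s) * norm (x - y) \<le> 0" by (simp add: algebra_simps)
  then show "x = y" using assms by (simp add: mult_le_0_iff)
qed

definition Tf_deriv :: "real \<Rightarrow> real \<Rightarrow> 'a::real_inner \<Rightarrow> 'a \<Rightarrow> 'a" where
  "Tf_deriv s \<epsilon> x h = (1 + s / (1 + \<epsilon> * (norm x)\<^sup>2)) *\<^sub>R h
     - (2 * s * \<epsilon> * (x \<bullet> h) / (1 + \<epsilon> * (norm x)\<^sup>2)\<^sup>2) *\<^sub>R x"

lemma Tf_has_derivative:
  assumes "\<epsilon> \<ge> 0" shows "(Tf s \<epsilon> has_derivative Tf_deriv s \<epsilon> x) (at x within A)"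
proof -
  have p: "1 + \<epsilon> * (x \<bullet> x) \<noteq> 0" using assms
    by (metis add_pos_nonneg inner_ge_zero less_irrefl mult_nonneg_nonneg zero_less_one)
  have "((\<lambda>x. 1 / (1 + \<epsilon> * (x \<bullet> x))) has_derivative (\<lambda>h. - (2 * \<epsilon> * (x \<bullet> h)) / (1 + \<epsilon> * (x \<bullet> x))\<^sup>2)) (at x within A)"
    using p by (auto intro!: derivative_eq_intros simp: inner_commute power2_eq_square divide_simps)
  from has_derivative_add[OF has_derivative_ident has_derivative_scaleR_right[OF has_derivative_scaleR[OF this has_derivative_ident], of s]]
  have "((\<lambda>x. x + s *\<^sub>R ((1 / (1 + \<epsilon> * (x \<bullet> x))) *\<^sub>R x)) has_derivative Tf_deriv s \<epsilon> x) (at x within A)"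
    by (rule has_derivative_eq_rhs)
       (simp add: fun_eq_iff Tf_deriv_def power2_norm_eq_inner algebra_simps)
  then show ?thesis by (simp add: Tf_def[abs_def] Xf_def power2_norm_eq_inner)
qed

text \<open>The Jacobian of \<open>Tf\<close>. With p = 1 + \<epsilon> |x|^2 the derivative has the
  tangential eigenvalue 1 + s / p and the radial eigenvalue 1 - s / p + 2 s / p^2.\<close>

definition Jf :: "real \<Rightarrow> real \<Rightarrow> real^2 \<Rightarrow> real" where
  "Jf s \<epsilon> x = (1 + s / (1 + \<epsilon> * (norm x)\<^sup>2)) *
     (1 - s / (1 + \<epsilon> * (norm x)\<^sup>2) + 2 * s / (1 + \<epsilon> * (norm x)\<^sup>2)\<^sup>2)"

lemma det_Tf_deriv:
  assumes "\<epsilon> \<ge> 0" shows "det (matrix (Tf_deriv s \<epsilon> (x :: real^2))) = Jf s \<epsilon> x"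
proof -
  define p where "p = 1 + \<epsilon> * (norm x)\<^sup>2"
  have n: "(norm x)\<^sup>2 = x $ 1 * x $ 1 + x $ 2 * x $ 2"
    unfolding power2_norm_eq_inner inner_vec_def by (simp add: sum_2)
  have p: "p \<ge> 1" using assms by (simp add: p_def)
  have e: "\<epsilon> * (x $ 1 * x $ 1 + x $ 2 * x $ 2) = p - 1" by (simp add: p_def n)
  define \<alpha> \<beta> where "\<alpha> = 1 + s / p" and "\<beta> = 2 * s * \<epsilon> / p\<^sup>2"
  have D: "Tf_deriv s \<epsilon> x h = \<alpha> *\<^sub>R h - (\<beta> * (x \<bullet> h)) *\<^sub>R x" for h
    by (simp add: Tf_deriv_def p_def \<alpha>_def \<beta>_def)
  have "det (matrix (Tf_deriv s \<epsilon> x)) = \<alpha> * (\<alpha> - \<beta> * (x $ 1 * x $ 1 + x $ 2 * x $ 2))"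
    unfolding det_2 matrix_def D by (simp add: inner_axis) (simp add: axis_def algebra_simps)
  also have "\<beta> * (x $ 1 * x $ 1 + x $ 2 * x $ 2) = 2 * s / p\<^sup>2 * (p - 1)"
    unfolding \<beta>_def e[symmetric] by simp
  also have "\<alpha> - 2 * s / p\<^sup>2 * (p - 1) = 1 - s / p + 2 * s / p\<^sup>2"
    using p by (simp add: \<alpha>_def divide_simps power2_eq_square) (simp add: algebra_simps)
  finally show ?thesis by (simp add: Jf_def \<alpha>_def p_def)
qed

text \<open>Each of the two factors is 1 + z with |z| \<le> s \<le> 1/2, and ln(1 + z) \<ge> z - 2
  s^2. The first-order terms add up to s times the divergence 2 / (1 + \<epsilon> |x|^2)^2 of
  \<open>Xf\<close>.\<close>

lemma Jf_lower:
  assumes "\<epsilon> \<ge> 0" "0 \<le> s" "s \<le> 1/2"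
  shows "Jf s \<epsilon> x > 0" "ln (Jf s \<epsilon> x) \<ge> 2 * s / (1 + \<epsilon> * (norm x)\<^sup>2)\<^sup>2 - 4 * s\<^sup>2"
proof -
  define r where "r = 1 / (1 + \<epsilon> * (norm x)\<^sup>2)"
  have r: "0 < r" "r \<le> 1" using assms by (auto simp: r_def divide_le_eq add_pos_nonneg)
  have J: "Jf s \<epsilon> x = (1 + s * r) * (1 + s * (2 * r\<^sup>2 - r))"
    by (simp add: Jf_def r_def power_divide algebra_simps)
  have "\<bar>2 * r\<^sup>2 - r\<bar> \<le> 1"
    using r mult_left_le[of r r] zero_le_square[of r] unfolding abs_le_iff power2_eq_square by linarith
  then have b: "\<bar>s * (2 * r\<^sup>2 - r)\<bar> \<le> s" using assms by (simp add: abs_mult mult_left_le)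
  have a: "\<bar>s * r\<bar> \<le> s" using r assms by (simp add: abs_mult mult_left_le)
  have pos: "1 + s * r > 0" "1 + s * (2 * r\<^sup>2 - r) > 0" using a b assms by linarith+
  then show "Jf s \<epsilon> x > 0" unfolding J by simp
  have l: "ln (1 + z) \<ge> z - 2 * s\<^sup>2" if "\<bar>z\<bar> \<le> s" for z
  proof -
    have "\<bar>ln (1 + z) - z\<bar> \<le> 2 * z\<^sup>2" using that assms by (intro abs_ln_one_plus_x_minus_x_bound) linarith
    moreover have "z\<^sup>2 \<le> s\<^sup>2" using that by (metis abs_le_square_iff abs_of_nonneg assms(2))
    ultimately show ?thesis by linarith
  qed
  have "ln (Jf s \<epsilon> x) = ln (1 + s * r) + ln (1 + s * (2 * r\<^sup>2 - r))"
    unfolding J using pos by (simp add: ln_mult)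
  also have "\<dots> \<ge> (s * r - 2 * s\<^sup>2) + (s * (2 * r\<^sup>2 - r) - 2 * s\<^sup>2)"
    by (intro add_mono l a b)
  finally have "ln (Jf s \<epsilon> x) \<ge> 2 * s * r\<^sup>2 - 4 * s\<^sup>2" by (simp add: algebra_simps)
  then show "ln (Jf s \<epsilon> x) \<ge> 2 * s / (1 + \<epsilon> * (norm x)\<^sup>2)\<^sup>2 - 4 * s\<^sup>2"
    by (simp add: r_def power_divide)
qed

text \<open>An inequality, because the left side is the integral of h over the range of the
  injective map \<open>Tf\<close>, which may be smaller than the plane; h \<ge> 0 absorbs the
  difference.\<close>

lemma Tf_change_of_variables:
  fixes h :: "real^2 \<Rightarrow> real"
  assumes "\<epsilon> \<ge> 0" "0 \<le> s" "s \<le> 1/2" and h: "integrable lebesgue h" "\<And>x. h x \<ge> 0"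
  shows "integrable lebesgue (\<lambda>x. h (Tf s \<epsilon> x) * Jf s \<epsilon> x)"
    "(LINT x|lebesgue. h (Tf s \<epsilon> x) * Jf s \<epsilon> x) \<le> (LINT x|lebesgue. h x)"
proof -
  \<comment> \<open>Values in \<open>real^1\<close> fit the form of the change of variables
    theorem.\<close>
  define f :: "real^2 \<Rightarrow> real^1" where "f = (\<lambda>x. vec (h x))"
  have ha: "h absolutely_integrable_on UNIV"
    using h(1) by (simp add: set_integrable_def)
  have Tm: "range (Tf s \<epsilon> :: real^2 \<Rightarrow> real^2) \<in> sets lebesgue"
    using Tf_has_derivative[OF assms(1)]
    by (intro differentiable_image_in_sets_lebesgue) (auto simp: differentiable_on_def differentiable_def)
  have hT: "h absolutely_integrable_on range (Tf s \<epsilon>)"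
    using set_integrable_subset[OF ha Tm] by simp
  have fT: "f absolutely_integrable_on range (Tf s \<epsilon>)"
    using hT by (subst absolutely_integrable_componentwise_iff) (auto simp: f_def Basis_vec_def inner_axis)
  have inj: "inj_on (Tf s \<epsilon>) (UNIV :: (real^2) set)"
    using inj_Tf[of \<epsilon> s] assms by simp
  have cv: "(\<lambda>x. \<bar>det (matrix (Tf_deriv s \<epsilon> x))\<bar> *\<^sub>R f (Tf s \<epsilon> x)) absolutely_integrable_on UNIV \<and>
      integral UNIV (\<lambda>x. \<bar>det (matrix (Tf_deriv s \<epsilon> x))\<bar> *\<^sub>R f (Tf s \<epsilon> x)) = integral (range (Tf s \<epsilon>)) f"
    using has_absolute_integral_change_of_variables[of UNIV "Tf s \<epsilon>" "Tf_deriv s \<epsilon>" f "integral (range (Tf s \<epsilon>)) f",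
        OF _ Tf_has_derivative[OF assms(1)] inj] fT by simp
  have J: "\<bar>det (matrix (Tf_deriv s \<epsilon> x))\<bar> = Jf s \<epsilon> x" for x :: "real^2"
    using det_Tf_deriv[OF assms(1), of s x] Jf_lower(1)[OF assms(1-3), of x] by simp
  have comp: "(\<bar>det (matrix (Tf_deriv s \<epsilon> x))\<bar> *\<^sub>R f (Tf s \<epsilon> x)) $ 1 = h (Tf s \<epsilon> x) * Jf s \<epsilon> x" for x
    by (simp add: J f_def)
  have ai: "(\<lambda>x. h (Tf s \<epsilon> x) * Jf s \<epsilon> x) absolutely_integrable_on UNIV"
    using absolutely_integrable_component[OF conjunct1[OF cv], of "axis 1 1"]
    by (simp add: J f_def inner_axis mult.commute)
  then show i: "integrable lebesgue (\<lambda>x. h (Tf s \<epsilon> x) * Jf s \<epsilon> x)"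
    by (simp add: set_integrable_def)
  have "(LINT x|lebesgue. h (Tf s \<epsilon> x) * Jf s \<epsilon> x) = integral UNIV (\<lambda>x. h (Tf s \<epsilon> x) * Jf s \<epsilon> x)"
    using set_lebesgue_integral_eq_integral(2)[OF ai] by (simp add: set_lebesgue_integral_def)
  also have "\<dots> = integral UNIV (\<lambda>x. (\<bar>det (matrix (Tf_deriv s \<epsilon> x))\<bar> *\<^sub>R f (Tf s \<epsilon> x)) \<bullet> axis 1 1)"
    unfolding inner_axis comp by simp
  also have "\<dots> = integral UNIV (\<lambda>x. (\<bar>det (matrix (Tf_deriv s \<epsilon> x))\<bar> *\<^sub>R f (Tf s \<epsilon> x))) \<bullet> axis 1 1"
    using cv absolutely_integrable_on_def by (intro integral_component_eq) blast
  also have "\<dots> = integral (range (Tf s \<epsilon>)) f \<bullet> axis 1 1" using cv by simp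
  also have "\<dots> = integral (range (Tf s \<epsilon>)) (\<lambda>x. f x \<bullet> axis 1 1)"
    using fT absolutely_integrable_on_def by (intro integral_component_eq[symmetric]) blast
  also have "\<dots> = integral (range (Tf s \<epsilon>)) h"
    by (simp add: inner_axis f_def)
  also have "\<dots> \<le> integral UNIV h"
    using hT ha h(2) by (intro integral_subset_le) (auto simp: absolutely_integrable_on_def)
  also have "\<dots> = (LINT x|lebesgue. h x)"
    using set_lebesgue_integral_eq_integral(2)[OF ha] by (simp add: set_lebesgue_integral_def)
  finally show "(LINT x|lebesgue. h (Tf s \<epsilon> x) * Jf s \<epsilon> x) \<le> (LINT x|lebesgue. h x)" .
qed

section \<open>Entire solutions\<close>

lemma eta_Lipschitz:
  obtains L where "L \<ge> 0" "\<And>s t. 0 \<le> s \<Longrightarrow> 0 \<le> t \<Longrightarrow> \<bar>eta s - eta t\<bar> \<le> L * \<bar>s - t\<bar>"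
proof -
  obtain eta' where e': "\<And>x. (eta has_real_derivative eta' x) (at x)" "C_k_real 0 eta'"
    using C_k_real_eta[of "Suc 0"] by auto
  have "bounded (eta' ` {0..1})"
    by (intro compact_imp_bounded compact_continuous_image C_k_real_imp_continuous[OF e'(2)]) auto
  then obtain L where L: "\<And>x. x \<in> {0..1} \<Longrightarrow> norm (eta' x) \<le> L"
    unfolding bounded_iff by (metis image_eqI)
  have L0: "L \<ge> 0" using L[of 0] by (smt (verit) atLeastAtMost_iff norm_ge_zero zero_le_one)
  have *: "\<bar>eta s - eta t\<bar> \<le> L * \<bar>s - t\<bar>" if "s \<in> {0..1}" "t \<in> {0..1}" for s t
    using field_differentiable_bound[of "{0..1}" eta eta' L s t] e'(1) L that
    by (auto intro: has_field_derivative_at_within)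
  have "\<bar>eta s - eta t\<bar> \<le> L * \<bar>s - t\<bar>" if "0 \<le> s" "0 \<le> t" for s t
  proof -
    have e: "eta r = eta (min r 1)" for r using eta_eq_0[of r] eta_eq_0[of 1] by (auto simp: min_def)
    have "\<bar>eta s - eta t\<bar> \<le> L * \<bar>min s 1 - min t 1\<bar>"
      using *[of "min s 1" "min t 1"] that unfolding e[of s] e[of t] by auto
    also have "\<dots> \<le> L * \<bar>s - t\<bar>" using L0 by (intro mult_left_mono) auto
    finally show ?thesis .
  qed
  with L0 that show ?thesis by blast
qed

text \<open>Where either small bump is nonzero, |y| \<le> 2 \<rho>, so the bump of radius 4 \<rho>
  about the origin is at least eta(1/4) there and can absorb the Lipschitz bound. Differences of
  averages of a nonnegative function are thereby bounded by a single average.\<close>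

lemma eta_kernel_diff:
  "\<exists>C\<ge>0. \<forall>\<rho>>0. \<forall>x x' y :: real^2. norm x \<le> \<rho> \<longrightarrow> norm x' \<le> \<rho> \<longrightarrow>
    \<bar>bump \<rho> x y - bump \<rho> x' y\<bar>
      \<le> C * norm (x - x') / \<rho> * eta ((norm y / (4 * \<rho>))\<^sup>2)"
proof -
  obtain L where L: "L \<ge> 0" "\<And>s t. 0 \<le> s \<Longrightarrow> 0 \<le> t \<Longrightarrow> \<bar>eta s - eta t\<bar> \<le> L * \<bar>s - t\<bar>"
    using eta_Lipschitz by blast
  have e4: "eta (1/4) > 0" by (rule eta_pos) simp
  have main: "\<bar>bump \<rho> x y - bump \<rho> x' y\<bar>
      \<le> 4 * L / eta (1/4) * norm (x - x') / \<rho> * eta ((norm y / (4 * \<rho>))\<^sup>2)"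
    if \<rho>: "\<rho> > 0" and x: "norm x \<le> \<rho>" "norm x' \<le> \<rho>" for \<rho> and x x' y :: "real^2"
  proof (cases "norm (x - y) \<ge> \<rho> \<and> norm (x' - y) \<ge> \<rho>")
    case True
    then have "bump \<rho> x y = 0" "bump \<rho> x' y = 0"
      using eta_kernel_eq_0[OF \<rho>] by blast+
    moreover have "0 \<le> 4 * L / eta (1/4) * norm (x - x') / \<rho> * eta ((norm y / (4 * \<rho>))\<^sup>2)"
      using L(1) e4 \<rho> by (intro mult_nonneg_nonneg divide_nonneg_nonneg eta_nonneg) auto
    ultimately show ?thesis by simp
  next
    case False
    define a b where "a = norm (x - y) / \<rho>" and "b = norm (x' - y) / \<rho>"
    have ab0: "a \<ge> 0" "b \<ge> 0" using \<rho> by (auto simp: a_def b_def)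
    have t1: "\<bar>norm (x - y) - norm (x' - y)\<bar> \<le> norm (x - x')"
      using norm_triangle_ineq3[of "x - y" "x' - y"] by simp
    then have d: "\<bar>a - b\<bar> \<le> norm (x - x') / \<rho>"
      using \<rho> by (simp add: a_def b_def flip: diff_divide_distrib) (simp add: divide_right_mono)
    have t2: "norm (x - x') \<le> 2 * \<rho>" using norm_triangle_ineq4[of x x'] x by simp
    have "norm (x - y) + norm (x' - y) \<le> 4 * \<rho>" using False t1 t2 by linarith
    then have s: "a + b \<le> 4" using \<rho> by (simp add: a_def b_def field_simps)
    have "norm y \<le> 2 * \<rho>"
      using False x norm_triangle_ineq4[of x "x - y"] norm_triangle_ineq4[of x' "x' - y"] by auto
    then have "(norm y / (4 * \<rho>))\<^sup>2 \<le> (1/2)\<^sup>2" using \<rho> by (intro power_mono) (auto simp: field_simps)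
    then have ey: "eta (1/4) \<le> eta ((norm y / (4 * \<rho>))\<^sup>2)" by (intro eta_antimono) (simp add: power_divide)
    have "\<bar>eta (a\<^sup>2) - eta (b\<^sup>2)\<bar> \<le> L * \<bar>a\<^sup>2 - b\<^sup>2\<bar>" by (rule L(2)) auto
    also have "\<bar>a\<^sup>2 - b\<^sup>2\<bar> = \<bar>a - b\<bar> * (a + b)"
      using ab0 by (simp add: power2_eq_square square_diff_square_factored abs_mult)
    also have "\<bar>a - b\<bar> * (a + b) \<le> norm (x - x') / \<rho> * 4"
      using d s ab0 \<rho> by (intro mult_mono) auto
    finally have "\<bar>eta (a\<^sup>2) - eta (b\<^sup>2)\<bar> \<le> L * (norm (x - x') / \<rho> * 4)" using L(1) by (simp add: mult_left_mono)
    also have "\<dots> = 4 * L / eta (1/4) * norm (x - x') / \<rho> * eta (1/4)" using e4 by simp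
    also have "\<dots> \<le> 4 * L / eta (1/4) * norm (x - x') / \<rho> * eta ((norm y / (4 * \<rho>))\<^sup>2)"
      using ey L(1) e4 \<rho> by (intro mult_left_mono) auto
    finally show ?thesis by (simp add: a_def b_def)
  qed
  show ?thesis
    by (rule exI[of _ "4 * L / eta (1/4)"]) (use main L(1) e4 in auto)
qed

definition osc :: real where
  "osc = (SOME C. 0 \<le> C \<and> (\<forall>\<rho>>0. \<forall>x x' y :: real^2. norm x \<le> \<rho> \<longrightarrow> norm x' \<le> \<rho> \<longrightarrow>
    \<bar>bump \<rho> x y - bump \<rho> x' y\<bar>
      \<le> C * norm (x - x') / \<rho> * eta ((norm y / (4 * \<rho>))\<^sup>2)))"

lemma osc_nonneg: "osc \<ge> 0"
  and osc_bound: "\<rho> > 0 \<Longrightarrow> norm x \<le> \<rho> \<Longrightarrow> norm x' \<le> \<rho> \<Longrightarrow>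
    \<bar>bump \<rho> x y - bump \<rho> x' y\<bar>
      \<le> osc * norm (x - x') / \<rho> * eta ((norm (y :: real^2) / (4 * \<rho>))\<^sup>2)"
  using someI_ex[OF eta_kernel_diff, folded osc_def] by auto

text \<open>Harnack inequality and gradient estimate in one: since \<open>B - v \<ge> 0\<close>, its averages
  are controlled by its value at the origin.\<close>

lemma rep_difference:
  assumes r: "rep S v F" and S: "cball 0 (4 * \<rho>) \<subseteq> S" and vc: "continuous_on (cball 0 (4 * \<rho>)) v"
    and vB: "\<And>y. norm y \<le> 4 * \<rho> \<Longrightarrow> v y \<le> B" and \<rho>: "\<rho> > 0" and x: "norm x \<le> \<rho>" "norm x' \<le> \<rho>"
  shows "\<bar>4 * eta_mass * (v x - v x') - ((LINT y|lebesgue. F y * Green \<rho> x y)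
      - (LINT y|lebesgue. F y * Green \<rho> x' y))\<bar>
    \<le> 16 * osc * norm (x - x') / \<rho> * (4 * eta_mass * (B - v 0) + (LINT y|lebesgue. F y * Gam (norm y / (4 * \<rho>))))"
proof -
  have sub: "cball z \<rho> \<subseteq> cball 0 (4 * \<rho>)" if "norm z \<le> \<rho>" for z :: "real^2"
    using that \<rho> by (auto simp: cball_subset_cball_iff)
  have rz: "4 * eta_mass * v z = 4 / \<rho>\<^sup>2 * (LINT y|lebesgue. v y * bump \<rho> z y)
     + (LINT y|lebesgue. F y * Green \<rho> z y)" if "norm z \<le> \<rho>" for z
    using r sub[OF that] S \<rho> unfolding rep_def by blast
  have r0: "4 * eta_mass * v 0 = 4 / (4 * \<rho>)\<^sup>2 * (LINT y|lebesgue. v y * bump (4 * \<rho>) 0 y)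
     + (LINT y|lebesgue. F y * Green (4 * \<rho>) 0 y)"
  proof -
    have "0 < 4 * \<rho>" using \<rho> by simp
    with r S show ?thesis unfolding rep_def by blast
  qed
  define w where "w y = B - v y" for y
  have wc: "continuous_on (cball 0 (4 * \<rho>)) w" unfolding w_def by (intro continuous_intros vc)
  have iw: "integrable lebesgue (\<lambda>y. w y * bump \<rho> z y)"
    and iv: "integrable lebesgue (\<lambda>y. v y * bump \<rho> z y)"
    and i1: "integrable lebesgue (\<lambda>y. B * bump \<rho> z y)" if "norm z \<le> \<rho>" for z
    using integrable_eta_kernel[OF \<rho> continuous_on_subset[OF wc sub[OF that]]]
      integrable_eta_kernel[OF \<rho> continuous_on_subset[OF vc sub[OF that]]]
      integrable_eta_kernel[OF \<rho>, of z "\<lambda>_. B"] by auto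
  have iw4: "integrable lebesgue (\<lambda>y. w y * bump (4 * \<rho>) 0 y)"
    and iv4: "integrable lebesgue (\<lambda>y. v y * bump (4 * \<rho>) 0 y)"
    and i14: "integrable lebesgue (\<lambda>y::real^2. B * bump (4 * \<rho>) 0 y)"
    using integrable_eta_kernel[OF _ wc] integrable_eta_kernel[OF _ vc]
      integrable_eta_kernel[of "4 * \<rho>" "0::real^2" "\<lambda>_. B"] \<rho> by auto
  have vw: "(LINT y|lebesgue. v y * bump \<rho> z y) =
      B * (\<rho>\<^sup>2 * eta_mass) - (LINT y|lebesgue. w y * bump \<rho> z y)" if "norm z \<le> \<rho>" for z
    using Bochner_Integration.integral_diff[OF i1[OF that] iw[OF that]] integral_eta_kernel[OF \<rho>, of z]
    by (simp add: w_def algebra_simps)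
  have vw4: "(LINT y|lebesgue. v y * bump (4 * \<rho>) 0 y) =
      B * ((4 * \<rho>)\<^sup>2 * eta_mass) - (LINT y|lebesgue. w y * bump (4 * \<rho>) 0 y)"
    using Bochner_Integration.integral_diff[OF i14 iw4] integral_eta_kernel[of "4 * \<rho>" "0::real^2"] \<rho>
    by (simp add: w_def algebra_simps)
  let ?k = "osc * norm (x - x') / \<rho>"
  have "\<bar>(LINT y|lebesgue. w y * bump \<rho> x y) - (LINT y|lebesgue. w y * bump \<rho> x' y)\<bar>
     = \<bar>LINT y|lebesgue. w y * bump \<rho> x y - w y * bump \<rho> x' y\<bar>"
    using iw[OF x(1)] iw[OF x(2)] by simp
  also have "\<dots> \<le> (LINT y|lebesgue. \<bar>w y * bump \<rho> x y - w y * bump \<rho> x' y\<bar>)"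
    by (rule integral_abs_bound)
  also have "\<dots> \<le> (LINT y|lebesgue. ?k * (w y * bump (4 * \<rho>) 0 y))"
  proof (rule integral_mono)
    show "integrable lebesgue (\<lambda>y. \<bar>w y * bump \<rho> x y - w y * bump \<rho> x' y\<bar>)"
      using iw[OF x(1)] iw[OF x(2)] by simp
    show "integrable lebesgue (\<lambda>y. ?k * (w y * bump (4 * \<rho>) 0 y))"
      by (rule integrable_mult_right) (rule iw4)
    fix y
    have d: "\<bar>bump \<rho> x y - bump \<rho> x' y\<bar> \<le> ?k * eta ((norm y / (4 * \<rho>))\<^sup>2)"
      by (rule osc_bound[OF \<rho> x])
    show "\<bar>w y * bump \<rho> x y - w y * bump \<rho> x' y\<bar> \<le> ?k * (w y * bump (4 * \<rho>) 0 y)"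
    proof (cases "norm y \<le> 4 * \<rho>")
      case True
      then have "w y \<ge> 0" using vB by (simp add: w_def)
      then show ?thesis
        using mult_left_mono[OF d, of "w y"] by (simp add: abs_mult ac_simps flip: right_diff_distrib)
    next
      case False
      then have "eta ((norm y / (4 * \<rho>))\<^sup>2) = 0" using \<rho> by (intro eta_eq_0) auto
      then show ?thesis using d by simp
    qed
  qed
  also have "\<dots> = ?k * (LINT y|lebesgue. w y * bump (4 * \<rho>) 0 y)"
    by (rule integral_mult_right_zero)
  \<comment> \<open>The representation at the origin with radius 4 \<rho>, solved for the average of
    w = B - v.\<close>
  also have "(LINT y|lebesgue. w y * bump (4 * \<rho>) 0 y) =
      16 * \<rho>\<^sup>2 * (eta_mass * (B - v 0)) + 4 * \<rho>\<^sup>2 * (LINT y|lebesgue. F y * Gam (norm y / (4 * \<rho>)))"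
    using r0 vw4 \<rho> by (simp add: field_simps)
  finally have E: "\<bar>(LINT y|lebesgue. w y * bump \<rho> x y) - (LINT y|lebesgue. w y * bump \<rho> x' y)\<bar>
     \<le> ?k * (16 * \<rho>\<^sup>2 * (eta_mass * (B - v 0)) + 4 * \<rho>\<^sup>2 * (LINT y|lebesgue. F y * Gam (norm y / (4 * \<rho>))))" .
  have "4 * eta_mass * (v x - v x') - ((LINT y|lebesgue. F y * Green \<rho> x y)
        - (LINT y|lebesgue. F y * Green \<rho> x' y)) = - (4 / \<rho>\<^sup>2) * ((LINT y|lebesgue. w y * bump \<rho> x y) - (LINT y|lebesgue. w y * bump \<rho> x' y))"
    using rz[OF x(1)] rz[OF x(2)] unfolding vw[OF x(1)] vw[OF x(2)] by (simp add: algebra_simps)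
  also have "\<bar>\<dots>\<bar> = 4 / \<rho>\<^sup>2 * \<bar>(LINT y|lebesgue. w y * bump \<rho> x y) - (LINT y|lebesgue. w y * bump \<rho> x' y)\<bar>"
    unfolding abs_mult by simp
  also have "\<dots> \<le> 4 / \<rho>\<^sup>2 * (?k * (16 * \<rho>\<^sup>2 * (eta_mass * (B - v 0)) + 4 * \<rho>\<^sup>2 * (LINT y|lebesgue. F y * Gam (norm y / (4 * \<rho>)))))"
    by (intro mult_left_mono E) auto
  also have "\<dots> = 16 * osc * norm (x - x') / \<rho> * (4 * eta_mass * (B - v 0) + (LINT y|lebesgue. F y * Gam (norm y / (4 * \<rho>))))"
    using \<rho> by (simp add: field_simps)
  finally show ?thesis .
qed

text \<open>From ln t \<le> t - 1 at t = r^(-1/2). Trading the logarithm for this power makes the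
  potentials at radius \<rho> grow at most like the square root of \<rho>.\<close>

lemma Gam_le_powr:
  assumes "r \<ge> 0" shows "Gam r \<le> 4 * theta * r powr (-1/2)"
proof -
  consider "r = 0" | "0 < r" "r \<le> 1" | "r > 1" using assms by linarith
  then show ?thesis
  proof cases
    case 2
    have "ln (r powr (-1/2)) \<le> r powr (-1/2)"
      using ln_le_minus_one[of "r powr (-1/2)"] 2 by auto
    then have "- 2 * ln r \<le> 4 * r powr (-1/2)" using 2 by (simp add: ln_powr)
    then have "- 2 * theta * ln r \<le> 4 * theta * r powr (-1/2)"
      using mult_left_mono[of "- 2 * ln r" "4 * r powr (-1/2)" theta] theta_pos by (simp add: ac_simps)
    then show ?thesis using Gam_upper[of r] 2 by linarith
  qed (use Gam_eq_0[of r] theta_pos in \<open>auto simp: Gam_def\<close>)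
qed

lemma AE_lebesgue_neq: "AE y in lebesgue. y \<noteq> (x :: 'a::euclidean_space)"
  by (rule AE_completion) (rule AE_lborel_singleton)

lemma sqrt_growth_limit:
  fixes a b c :: real
  shows "((\<lambda>t. c / t * (a + b * (4 * t) powr (1/2))) \<longlongrightarrow> 0) at_top"
proof -
  have "((\<lambda>t::real. 1 / t) \<longlongrightarrow> 0) at_top" "((\<lambda>t::real. (4 * t) powr (1/2) / t) \<longlongrightarrow> 0) at_top"
    by real_asymp+
  then have "((\<lambda>t::real. c * a * (1 / t) + c * b * ((4 * t) powr (1/2) / t)) \<longlongrightarrow> c * a * 0 + c * b * 0) at_top"
    by (intro tendsto_intros)
  then show ?thesis by (simp add: algebra_simps)
qed

definition kappa :: real where "kappa = theta / (2 * eta_mass)"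

lemma kappa_pos: "kappa > 0" using theta_pos eta_mass_pos by (simp add: kappa_def)

text \<open>The limit problem. Its hypotheses on the behaviour at infinity are the upper bound of v
  and the two finite masses; finer information is drawn from \<open>rep_v\<close>.\<close>

locale entire_solution =
  fixes \<mu> lam W B :: real and v F :: "real^2 \<Rightarrow> real"
  assumes \<mu>: "0 < \<mu>" "\<mu> < 2" and lam: "lam = (4 - \<mu>) / 4" and W: "W > 0"
    and v_cont: "continuous_on UNIV v" and v_le: "\<And>x. v x \<le> B"
    and exp_int: "integrable lebesgue (\<lambda>x. exp (v x))"
    and F_eq: "\<And>x. F x = W * riesz_potential \<mu> (\<lambda>y. exp (lam * v y)) x * exp (lam * v x)"
    and rep_v: "rep UNIV v F"
    and F_int: "integrable lebesgue F"
begin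

abbreviation "g x \<equiv> exp (lam * v x)"
abbreviation "I x \<equiv> riesz_potential \<mu> (\<lambda>y. exp (lam * v y)) x"
definition "\<beta> = (LINT x|lebesgue. F x)"

lemma lam_pos: "lam > 0" using \<mu> lam by simp

lemma v_meas[measurable]: "v \<in> borel_measurable borel"
  by (rule borel_measurable_continuous_onI[OF v_cont])

lemma I_eq_lborel: "I x = (LINT y|lborel. g y / norm (x - y) powr \<mu>)"
  unfolding riesz_potential_def by (rule integral_completion) measurable

lemma I_meas[measurable]: "(\<lambda>x. I x) \<in> borel_measurable borel"
  unfolding I_eq_lborel by measurable

lemma F_meas[measurable]: "F \<in> borel_measurable borel"
  unfolding F_eq[abs_def] by measurable

lemma riesz_facts:
  shows I_int: "integrable lebesgue (\<lambda>y. g y / norm (x - y) powr \<mu>)"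
    and I_le: "I x \<le> exp (lam * B) * npow \<mu> + (LINT x|lebesgue. exp (v x)) + ntail"
    and I_nonneg: "I x \<ge> 0"
proof -
  have p: "exp (lam * v y) powr (1 / lam) = exp (v y)" for y
    using lam_pos by (simp add: powr_def)
  have m: "(\<lambda>y. g y) \<in> borel_measurable lebesgue" by (rule borel_imp_lebesgue) measurable
  have b: "g y \<le> exp (lam * B)" for y using lam_pos v_le by simp
  note * = riesz_bound[OF \<mu> lam m, of "LINT x|lebesgue. exp (v x)" x "exp (lam * B)", unfolded p, OF _ exp_int order.refl b]
  show "integrable lebesgue (\<lambda>y. g y / norm (x - y) powr \<mu>)"
    "I x \<le> exp (lam * B) * npow \<mu> + (LINT x|lebesgue. exp (v x)) + ntail" "I x \<ge> 0"
    using * by auto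
qed

text \<open>In \<open>I_pos\<close> the exceptional point is the pole of the kernel, where division
  by 0 gives the value 0.\<close>

lemma not_AE_False: "\<not> (AE y in lebesgue. (P :: real^2 \<Rightarrow> bool) y)" if "\<And>y. y \<noteq> x \<Longrightarrow> \<not> P y"
proof
  assume "AE y in lebesgue. P y"
  then have "AE y in (lebesgue :: (real^2) measure). False"
    using AE_lebesgue_neq[of x] by eventually_elim (use that in auto)
  then show False by (simp add: ae_filter_eq_bot_iff flip: trivial_limit_def)
qed

lemma I_pos: "I x > 0"
proof -
  have "I x \<noteq> 0"
  proof
    assume "I x = 0"
    then have "AE y in lebesgue. g y / norm (x - y) powr \<mu> = 0"
      unfolding riesz_potential_def using integral_nonneg_eq_0_iff_AE[OF I_int] by auto
    then show False using not_AE_False[of x] by auto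
  qed
  then show ?thesis using I_nonneg[of x] by linarith
qed

lemma F_pos: "F x > 0" unfolding F_eq using W I_pos by simp

lemma F_nonneg: "F x \<ge> 0" using F_pos[of x] by simp

definition "CF = W * (exp (lam * B) * npow \<mu> + (LINT x|lebesgue. exp (v x)) + ntail) * exp (lam * B)"

lemma F_le: "F x \<le> CF"
  unfolding F_eq CF_def using W I_nonneg I_le lam_pos v_le order_trans[OF I_nonneg I_le]
  by (intro mult_mono mult_left_mono) auto

lemma \<beta>_pos: "\<beta> > 0"
proof -
  have "\<beta> \<noteq> 0"
  proof
    assume "\<beta> = 0"
    then have "AE y in lebesgue. F y = 0"
      unfolding \<beta>_def using integral_nonneg_eq_0_iff_AE[OF F_int] F_nonneg by auto
    moreover have "F y \<noteq> 0" for y using F_pos[of y] by simp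
    ultimately show False using not_AE_False[of 0 "\<lambda>y. F y = 0"] by blast
  qed
  moreover have "\<beta> \<ge> 0" unfolding \<beta>_def using F_nonneg by (intro integral_nonneg_AE) auto
  ultimately show ?thesis by linarith
qed

definition "Ks p = CF * npow p + \<beta>"

lemma sing_int: "0 \<le> p \<Longrightarrow> p < 2 \<Longrightarrow> integrable lebesgue (\<lambda>y. F y * norm (x - y) powr (-p))"
  and sing_le: "0 \<le> p \<Longrightarrow> p < 2 \<Longrightarrow> (LINT y|lebesgue. F y * norm (x - y) powr (-p)) \<le> Ks p"
  unfolding Ks_def \<beta>_def using singular_kernel_bound[OF _ _ F_int F_nonneg F_le] by auto

definition q :: "real^2 \<Rightarrow> real^2 \<Rightarrow> real^2 \<Rightarrow> real" where
  "q x x' y = ln (norm (x - y)) - ln (norm (x' - y))"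

lemma q_meas[measurable]: "(\<lambda>y. q x x' y) \<in> borel_measurable borel"
  unfolding q_def by measurable

lemma q_bound: "x \<noteq> y \<Longrightarrow> x' \<noteq> y \<Longrightarrow>
    \<bar>q x x' y\<bar> \<le> norm (x - x') * (norm (x - y) powr (-1) + norm (x' - y) powr (-1))"
  unfolding q_def using ln_norm_diff_bound[of "x - y" "x' - y"] by auto

lemma Fq_dom_int: "integrable lebesgue (\<lambda>y. c * norm (x - x') * (F y * norm (x - y) powr (-1) + F y * norm (x' - y) powr (-1)))"
  using sing_int[of 1] by simp

lemma Fq_int: "integrable lebesgue (\<lambda>y. F y * q x x' y)"
proof (rule Bochner_Integration.integrable_bound[OF Fq_dom_int[of 1 x x']])
  show "(\<lambda>y. F y * q x x' y) \<in> borel_measurable lebesgue" by (rule borel_imp_lebesgue) measurable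
  show "AE y in lebesgue. norm (F y * q x x' y)
      \<le> norm (1 * norm (x - x') * (F y * norm (x - y) powr (-1) + F y * norm (x' - y) powr (-1)))"
    using AE_lebesgue_neq[of x] AE_lebesgue_neq[of x']
  proof eventually_elim
    case (elim y)
    then have "F y * \<bar>q x x' y\<bar> \<le> F y * (norm (x - x') * (norm (x - y) powr (-1) + norm (x' - y) powr (-1)))"
      using F_nonneg by (intro mult_left_mono q_bound) auto
    then have "\<bar>F y * q x x' y\<bar> \<le> 1 * norm (x - x') * (F y * norm (x - y) powr (-1) + F y * norm (x' - y) powr (-1))"
      using F_nonneg[of y] by (simp add: abs_mult algebra_simps)
    then show ?case unfolding real_norm_def by linarith
  qed
qed

lemma Fq_bound: "(LINT y|lebesgue. \<bar>F y * q x x' y\<bar>) \<le> 2 * norm (x - x') * Ks 1"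
proof -
  have "(LINT y|lebesgue. \<bar>F y * q x x' y\<bar>) \<le> (LINT y|lebesgue. 1 * norm (x - x') * (F y * norm (x - y) powr (-1) + F y * norm (x' - y) powr (-1)))"
  proof (rule integral_mono_AE)
    show "AE y in lebesgue. \<bar>F y * q x x' y\<bar> \<le> 1 * norm (x - x') * (F y * norm (x - y) powr (-1) + F y * norm (x' - y) powr (-1))"
      using AE_lebesgue_neq[of x] AE_lebesgue_neq[of x']
    proof eventually_elim
      case (elim y)
      then have "F y * \<bar>q x x' y\<bar> \<le> F y * (norm (x - x') * (norm (x - y) powr (-1) + norm (x' - y) powr (-1)))"
        using F_nonneg by (intro mult_left_mono q_bound) auto
      then show "\<bar>F y * q x x' y\<bar> \<le> 1 * norm (x - x') * (F y * norm (x - y) powr (-1) + F y * norm (x' - y) powr (-1))"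
        using F_nonneg[of y] by (simp add: abs_mult algebra_simps)
    qed
  qed (use Fq_int Fq_dom_int[of 1 x x'] in auto)
  also have "\<dots> = norm (x - x') * ((LINT y|lebesgue. F y * norm (x - y) powr (-1)) + (LINT y|lebesgue. F y * norm (x' - y) powr (-1)))"
    using sing_int[of 1] by simp
  also have "\<dots> \<le> norm (x - x') * (Ks 1 + Ks 1)"
    by (intro mult_left_mono add_mono sing_le) auto
  finally show ?thesis by simp
qed

lemma Gam_int: "\<rho> > 0 \<Longrightarrow> integrable lebesgue (\<lambda>y. F y * Green \<rho> x y)"
  using rep_v by (auto simp: rep_def)

lemma Gam_integral_le:
  assumes "\<rho> > 0"
  shows "(LINT y|lebesgue. F y * Gam (norm y / \<rho>)) \<le> 4 * theta * Ks (1/2) * \<rho> powr (1/2)"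
    "(LINT y|lebesgue. F y * Gam (norm y / \<rho>)) \<ge> 0"
proof -
  have le: "F y * Gam (norm y / \<rho>) \<le> 4 * theta * \<rho> powr (1/2) * (F y * norm (0 - y) powr (-(1/2)))" for y
  proof -
    have "F y * Gam (norm y / \<rho>) \<le> F y * (4 * theta * (norm y / \<rho>) powr (-1/2))"
      using F_nonneg assms by (intro mult_left_mono Gam_le_powr) auto
    also have "(norm y / \<rho>) powr (-1/2) = norm (0 - y) powr (-(1/2)) * \<rho> powr (1/2)"
      using assms by (simp add: powr_divide powr_minus_divide)
    finally show ?thesis by (simp add: ac_simps)
  qed
  have "(LINT y|lebesgue. F y * Gam (norm y / \<rho>)) \<le> (LINT y|lebesgue. 4 * theta * \<rho> powr (1/2) * (F y * norm (0 - y) powr (-(1/2))))"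
    using Gam_int[OF assms, of 0] sing_int[of "1/2" 0] le by (intro integral_mono) auto
  also have "\<dots> = 4 * theta * \<rho> powr (1/2) * (LINT y|lebesgue. F y * norm (0 - y) powr (-(1/2)))" by simp
  also have "\<dots> \<le> 4 * theta * \<rho> powr (1/2) * Ks (1/2)"
    using theta_pos by (intro mult_left_mono sing_le) auto
  finally show "(LINT y|lebesgue. F y * Gam (norm y / \<rho>)) \<le> 4 * theta * Ks (1/2) * \<rho> powr (1/2)" by (simp add: ac_simps)
  show "(LINT y|lebesgue. F y * Gam (norm y / \<rho>)) \<ge> 0"
    using F_nonneg Gam_nonneg assms by (intro integral_nonneg_AE) auto
qed

text \<open>v plus kappa times the logarithmic potential of F is formally harmonic, and B - v \<ge>
  0 forces it to be constant: in \<open>rep_difference\<close> at radius r the error is of order (1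
  + sqrt r) / r, because the potential of F at the origin grows only like sqrt r. As r grows, the
  differences of \<open>Green\<close> tend to -2 theta q under a bound independent of r.\<close>

lemma Liouville: "v x - v x' = - kappa * (LINT y|lebesgue. F y * q x x' y)"
proof -
  define r where "r n = real n + 1 + norm x + norm x'" for n
  have r: "r n > 0" "norm x \<le> r n" "norm x' \<le> r n" for n
    unfolding r_def using norm_ge_zero[of x] norm_ge_zero[of x'] by linarith+
  have rlim: "filterlim r at_top sequentially"
    unfolding r_def by real_asymp
  define G where "G n = (LINT y|lebesgue. F y * Green (r n) x y) - (LINT y|lebesgue. F y * Green (r n) x' y)" for n
  have "G \<longlonglongrightarrow> 4 * eta_mass * (v x - v x')"
  proof -
    have bd: "\<bar>4 * eta_mass * (v x - v x') - G n\<bar> \<le> 16 * osc * norm (x - x') / r n * (4 * eta_mass * (B - v 0) + 4 * theta * Ks (1/2) * (4 * r n) powr (1/2))" for n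
    proof -
      have "\<bar>4 * eta_mass * (v x - v x') - G n\<bar> \<le> 16 * osc * norm (x - x') / r n * (4 * eta_mass * (B - v 0) + (LINT y|lebesgue. F y * Gam (norm y / (4 * r n))))"
        unfolding G_def by (rule rep_difference[OF rep_v]) (use r v_le v_cont in \<open>auto intro: continuous_on_subset\<close>)
      also have "\<dots> \<le> 16 * osc * norm (x - x') / r n * (4 * eta_mass * (B - v 0) + 4 * theta * Ks (1/2) * (4 * r n) powr (1/2))"
        using r(1)[of n] osc_nonneg by (intro mult_left_mono add_left_mono Gam_integral_le) auto
      finally show ?thesis .
    qed
    have "((\<lambda>t. 16 * osc * norm (x - x') / t * (4 * eta_mass * (B - v 0) + 4 * theta * Ks (1/2) * (4 * t) powr (1/2))) \<longlongrightarrow> 0) at_top"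
      by (rule sqrt_growth_limit)
    then have "(\<lambda>n. 16 * osc * norm (x - x') / r n * (4 * eta_mass * (B - v 0) + 4 * theta * Ks (1/2) * (4 * r n) powr (1/2))) \<longlonglongrightarrow> 0"
      using rlim by (rule filterlim_compose)
    then have "(\<lambda>n. 4 * eta_mass * (v x - v x') - G n) \<longlonglongrightarrow> 0"
      by (rule Lim_null_comparison[rotated]) (use bd in auto)
    then show ?thesis using tendsto_diff[OF tendsto_const[of "4 * eta_mass * (v x - v x')"]] by fastforce
  qed
  moreover have "G \<longlonglongrightarrow> (LINT y|lebesgue. - 2 * theta * (F y * q x x' y))"
  proof -
    have "(\<lambda>n. LINT y|lebesgue. F y * (Green (r n) x y - Green (r n) x' y)) \<longlonglongrightarrow> (LINT y|lebesgue. - 2 * theta * (F y * q x x' y))"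
    proof (rule integral_dominated_convergence[OF _ _ Fq_dom_int[of "2 * theta" x x']])
      show "(\<lambda>y. - 2 * theta * (F y * q x x' y)) \<in> borel_measurable lebesgue" by (rule borel_imp_lebesgue) measurable
      show "(\<lambda>y. F y * (Green (r n) x y - Green (r n) x' y)) \<in> borel_measurable lebesgue" for n
        by (rule borel_imp_lebesgue) measurable
      show "AE y in lebesgue. norm (F y * (Green (r n) x y - Green (r n) x' y))
          \<le> 2 * theta * norm (x - x') * (F y * norm (x - y) powr (-1) + F y * norm (x' - y) powr (-1))" for n
        using AE_lebesgue_neq[of x] AE_lebesgue_neq[of x']
      proof eventually_elim
        case (elim y)
        then have "F y * \<bar>Green (r n) x y - Green (r n) x' y\<bar> \<le> F y * (2 * theta * norm (x - x') * (norm (x - y) powr (-1) + norm (x' - y) powr (-1)))"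
          using F_nonneg r by (intro mult_left_mono Gam_norm_diff_bound) auto
        moreover have "norm (F y * (Green (r n) x y - Green (r n) x' y)) = F y * \<bar>Green (r n) x y - Green (r n) x' y\<bar>"
          using F_nonneg[of y] by (simp add: abs_mult)
        moreover have "F y * (2 * theta * norm (x - x') * (norm (x - y) powr (-1) + norm (x' - y) powr (-1))) =
            2 * theta * norm (x - x') * (F y * norm (x - y) powr (-1) + F y * norm (x' - y) powr (-1))"
          by (simp only: distrib_left ac_simps)
        ultimately show ?case by (simp only:)
      qed
      show "AE y in lebesgue. (\<lambda>n. F y * (Green (r n) x y - Green (r n) x' y)) \<longlonglongrightarrow> - 2 * theta * (F y * q x x' y)"
        using AE_lebesgue_neq[of x] AE_lebesgue_neq[of x']
      proof eventually_elim
        case (elim y)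
        \<comment> \<open>The terms ln(r n) cancel in the difference, and the two \<open>Lg\<close>
          terms will both tend to \<open>Lg 0\<close>.\<close>
        have e: "Green (r n) x y - Green (r n) x' y =
            Lg ((norm (x - y) / r n)\<^sup>2) - Lg ((norm (x' - y) / r n)\<^sup>2) - 2 * theta * q x x' y" for n
          using elim r(1)[of n] by (simp add: Gam_def q_def ln_div algebra_simps)
        have l: "(\<lambda>n. Lg ((c / r n)\<^sup>2)) \<longlonglongrightarrow> Lg 0" for c
        proof -
          have "(\<lambda>n. c / r n) \<longlonglongrightarrow> 0" using rlim by (rule real_tendsto_divide_at_top[OF tendsto_const])
          then have "(\<lambda>n. (c / r n)\<^sup>2) \<longlonglongrightarrow> 0" by (auto intro!: tendsto_eq_intros)
          then show ?thesis
            using continuous_Lg[of UNIV] by (auto simp: continuous_on_eq_continuous_at intro: isCont_tendsto_compose)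
        qed
        have "(\<lambda>n. F y * (Green (r n) x y - Green (r n) x' y)) \<longlonglongrightarrow> F y * (Lg 0 - Lg 0 - 2 * theta * q x x' y)"
          unfolding e by (intro tendsto_intros l)
        then show ?case by (simp add: ac_simps)
      qed
    qed
    moreover have "(LINT y|lebesgue. F y * (Green (r n) x y - Green (r n) x' y)) = G n" for n
      unfolding G_def right_diff_distrib using Gam_int[OF r(1)] by (intro Bochner_Integration.integral_diff) auto
    ultimately show ?thesis by simp
  qed
  ultimately have "4 * eta_mass * (v x - v x') = (LINT y|lebesgue. - 2 * theta * (F y * q x x' y))"
    by (rule LIMSEQ_unique)
  also have "\<dots> = - 2 * theta * (LINT y|lebesgue. F y * q x x' y)"
    by (rule integral_mult_right_zero)
  finally have "v x - v x' = (- 2 * theta * (LINT y|lebesgue. F y * q x x' y)) / (4 * eta_mass)"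
    using eta_mass_pos by (subst nonzero_eq_divide_eq) (auto simp: ac_simps)
  then show ?thesis by (simp add: kappa_def)
qed

end

section \<open>The Pohozaev inequality\<close>

lemma ln_add_le: "0 < a \<Longrightarrow> 0 < b \<Longrightarrow> ln a + ln b \<le> 2 * ln ((a + b) / 2)" for a b :: real
proof -
  assume ab: "0 < a" "0 < b"
  have "a * b \<le> ((a + b) / 2)\<^sup>2"
    using zero_le_power2[of "a - b"] by (simp add: power2_eq_square field_simps)
  then have "ln (a * b) \<le> ln (((a + b) / 2)\<^sup>2)" using ab by (subst ln_le_cancel_iff) auto
  then show ?thesis using ab by (simp add: ln_mult ln_realpow)
qed

text \<open>The exponent 3/4 lies above 1/2, so that (s^2)^(3/4) = s^(3/2) is of higher order than
  s, and below 1, so that the resulting kernel |x - y|^(-3/2) is locally integrable in the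
  plane.\<close>

lemma ln_one_plus_powr_le:
  fixes z :: real
  assumes "z \<ge> 0" shows "ln (1 + z) \<le> 4/3 * z powr (3/4)"
proof -
  define w where "w = z powr (3/4)"
  have w: "w \<ge> 0" "w powr (4/3) = z" using assms by (simp_all add: w_def powr_powr)
  have "1 + z = 1 * 1 + w * w powr (1/3)"
    using w powr_add[of w 1 "1/3"] by simp
  also have "\<dots> \<le> 1 * (1 + w) powr (1/3) + w * (1 + w) powr (1/3)"
    using w by (intro add_mono mult_left_mono powr_mono2 ge_one_powr_ge_zero) auto
  also have "\<dots> = (1 + w) powr (4/3)"
    using w powr_add[of "1 + w" 1 "1/3"] by (simp add: distrib_right)
  finally have "1 + z \<le> (1 + z powr (3/4)) powr (4/3)" unfolding w_def .
  then have "ln (1 + z) \<le> ln ((1 + z powr (3/4)) powr (4/3))" using assms by (subst ln_le_cancel_iff) (auto intro: add_pos_nonneg)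
  also have "\<dots> = 4/3 * ln (1 + z powr (3/4))" by (simp add: ln_powr add_pos_nonneg)
  also have "\<dots> \<le> 4/3 * z powr (3/4)" using ln_add_one_self_le_self[of "z powr (3/4)"] by simp
  finally show ?thesis .
qed

text \<open>In each logarithm only one of the two points moves. The arithmetic-geometric mean
  inequality merges both into the logarithm of the mean squared distance, whose linear part in s is
  s (X - Y) \<bullet> (x - y) \<le> s d; the quadratic part is controlled by |Xf|^2 \<le> 1 / (4
  \<epsilon>).\<close>

lemma Tf_sym_bound:
  assumes "\<epsilon> > 0" "s \<ge> 0" "x \<noteq> y" "Tf s \<epsilon> x \<noteq> y" "Tf s \<epsilon> y \<noteq> x"
  shows "(ln (norm (Tf s \<epsilon> x - y)) - ln (norm (x - y))) + (ln (norm (Tf s \<epsilon> y - x)) - ln (norm (y - x)))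
    \<le> s + 4/3 * (s\<^sup>2 / (4 * \<epsilon>)) powr (3/4) * norm (x - y) powr (-(3/2))"
proof -
  define X Y where "X = Xf \<epsilon> x" and "Y = Xf \<epsilon> y"
  define d where "d = (norm (x - y))\<^sup>2"
  have d: "d > 0" using assms by (simp add: d_def)
  define A B where "A = (norm (Tf s \<epsilon> x - y))\<^sup>2" and "B = (norm (Tf s \<epsilon> y - x))\<^sup>2"
  have AB: "A > 0" "B > 0" using assms by (auto simp: A_def B_def)
  have A: "A = d + 2 * s * (X \<bullet> (x - y)) + s\<^sup>2 * (norm X)\<^sup>2"
    unfolding A_def d_def X_def Tf_def power2_norm_eq_inner
    by (simp add: inner_diff_left inner_diff_right inner_add_left inner_add_right inner_commute power2_eq_square algebra_simps)
  have B: "B = d - 2 * s * (Y \<bullet> (x - y)) + s\<^sup>2 * (norm Y)\<^sup>2"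
    unfolding B_def d_def Y_def Tf_def power2_norm_eq_inner
    by (simp add: inner_diff_left inner_diff_right inner_add_left inner_add_right inner_commute power2_eq_square algebra_simps)
  have XY: "(X - Y) \<bullet> (x - y) \<le> d"
  proof -
    have "(X - Y) \<bullet> (x - y) \<le> norm (X - Y) * norm (x - y)" by (rule norm_cauchy_schwarz)
    also have "\<dots> \<le> norm (x - y) * norm (x - y)"
      using norm_Xf_diff_le[of \<epsilon> x y] assms by (intro mult_right_mono) (auto simp: X_def Y_def)
    finally show ?thesis by (simp add: d_def power2_eq_square)
  qed
  have n: "(norm X)\<^sup>2 \<le> 1 / (4 * \<epsilon>)" "(norm Y)\<^sup>2 \<le> 1 / (4 * \<epsilon>)"
    using norm_Xf_le assms by (auto simp: X_def Y_def)
  define z where "z = s\<^sup>2 / (4 * \<epsilon>) / d"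
  have z: "z \<ge> 0" using assms d by (simp add: z_def)
  have "A + B = 2 * d + 2 * s * ((X - Y) \<bullet> (x - y)) + s\<^sup>2 * ((norm X)\<^sup>2 + (norm Y)\<^sup>2)"
    unfolding A B by (simp add: inner_diff_left algebra_simps)
  also have "\<dots> \<le> 2 * d + 2 * s * d + s\<^sup>2 * (1 / (4 * \<epsilon>) + 1 / (4 * \<epsilon>))"
    using XY n assms by (intro add_mono mult_left_mono) auto
  also have "\<dots> = 2 * d * (1 + s + z)"
    using d by (simp add: z_def field_simps)
  finally have "(A + B) / 2 / d \<le> 1 + s + z" using d by (simp add: field_simps)
  also have "\<dots> \<le> (1 + s) * (1 + z)" using assms z by (simp add: algebra_simps)
  finally have AB2: "(A + B) / 2 / d \<le> (1 + s) * (1 + z)" .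
  have "ln A + ln B - 2 * ln d \<le> 2 * (ln ((A + B) / 2) - ln d)" using ln_add_le[OF AB] by simp
  also have "ln ((A + B) / 2) - ln d = ln ((A + B) / 2 / d)" using AB d by (subst ln_div[of "(A + B) / 2" d]) auto
  also have "\<dots> \<le> ln ((1 + s) * (1 + z))" using AB2 AB d assms z by (subst ln_le_cancel_iff) auto
  also have "\<dots> = ln (1 + s) + ln (1 + z)" using assms z by (simp add: ln_mult)
  also have "\<dots> \<le> s + 4/3 * z powr (3/4)"
    using assms z by (intro add_mono ln_add_one_self_le_self ln_one_plus_powr_le) auto
  finally have *: "ln A + ln B - 2 * ln d \<le> 2 * (s + 4/3 * z powr (3/4))" by simp
  have "z powr (3/4) = (s\<^sup>2 / (4 * \<epsilon>)) powr (3/4) * d powr (-(3/4))"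
    unfolding z_def using assms d by (subst powr_divide) (auto simp: powr_minus_divide)
  also have "d powr (-(3/4)) = norm (x - y) powr (-(3/2))"
    using assms by (simp add: d_def powr_powr flip: powr_numeral)
  finally have z': "z powr (3/4) = (s\<^sup>2 / (4 * \<epsilon>)) powr (3/4) * norm (x - y) powr (-(3/2))" .
  have "ln A = 2 * ln (norm (Tf s \<epsilon> x - y))" "ln B = 2 * ln (norm (Tf s \<epsilon> y - x))" "ln d = 2 * ln (norm (x - y))"
    using assms by (auto simp: A_def B_def d_def ln_realpow)
  with * show ?thesis unfolding z' by (simp add: norm_minus_commute[of y x])
qed

lemma Tf_measurable[measurable]:
  assumes "\<epsilon> \<ge> 0" shows "(Tf s \<epsilon> :: real^2 \<Rightarrow> real^2) \<in> borel_measurable borel"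
proof (rule borel_measurable_continuous_onI)
  show "continuous_on UNIV (Tf s \<epsilon> :: real^2 \<Rightarrow> real^2)"
    using has_derivative_continuous_on Tf_has_derivative[OF assms] by blast
qed

lemma norm_Tf_diff_self:
  assumes "\<epsilon> > 0" "s \<ge> 0"
  shows "norm (Tf s \<epsilon> x - x) \<le> s * sqrt (1 / (4 * \<epsilon>))"
proof -
  have "norm (Xf \<epsilon> x) \<le> sqrt (1 / (4 * \<epsilon>))" using norm_Xf_le[OF assms(1)] by (rule real_le_rsqrt)
  then show ?thesis using assms by (simp add: Tf_def mult_left_mono)
qed

context entire_solution
begin

lemma Ks_nonneg: "Ks p \<ge> 0"
  unfolding Ks_def using order_trans[OF F_nonneg F_le] npow_nonneg \<beta>_pos by (simp add: add_nonneg_nonneg)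

lemma F_int_lborel: "integrable lborel F"
  using F_int F_meas by (simp add: integrable_completion)

lemma beta_lborel: "(LINT x|lborel. F x) = \<beta>"
  unfolding \<beta>_def by (rule integral_completion[symmetric]) simp

text \<open>Symmetrising in \<open>x\<close> and \<open>y\<close> turns the logarithmic derivative along \<open>Xf\<close> into
  \<open>(X x - X y) \<bullet> (x - y) / |x - y|\<^sup>2 \<le> 1\<close>, up to a term of higher order in \<open>s\<close>.\<close>

lemma log_interaction_bound:
  assumes \<epsilon>: "\<epsilon> > 0" and s: "0 < s" "s \<le> 1/2"
  shows "integrable lebesgue (\<lambda>x. F x * (v (Tf s \<epsilon> x) - v x))"
    "- (LINT x|lebesgue. F x * (v (Tf s \<epsilon> x) - v x))
      \<le> kappa / 2 * \<beta> * (s * \<beta> + 4/3 * (s\<^sup>2 / (4 * \<epsilon>)) powr (3/4) * Ks (3/2))"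
proof -
  let ?T = "Tf s \<epsilon> :: real^2 \<Rightarrow> real^2"
  have \<epsilon>0: "\<epsilon> \<ge> 0" using \<epsilon> by simp
  have [measurable]: "?T \<in> borel_measurable borel" by (rule Tf_measurable[OF \<epsilon>0])
  define H where "H x y = F x * (F y * q (?T x) x y)" for x y
  have [measurable]: "(\<lambda>(x, y). H x y) \<in> borel_measurable (borel \<Otimes>\<^sub>M borel)"
    unfolding H_def q_def by measurable
  have Fq_lb: "integrable lborel (\<lambda>y. F y * q x x' y)" for x x'
    using Fq_int[of x x'] by (subst (asm) integrable_completion) auto
  have Fq_eq: "(LINT y|lebesgue. F y * q x x' y) = (LINT y|lborel. F y * q x x' y)" for x x'
    by (rule integral_completion) simp
  have D: "v (?T x) - v x = - kappa * (LINT y|lborel. F y * q (?T x) x y)" for x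
    using Liouville[of "?T x" x] by (simp add: Fq_eq)
  have Db: "(LINT y|lborel. \<bar>F y * q (?T x) x y\<bar>) \<le> 2 * (s * sqrt (1 / (4 * \<epsilon>))) * Ks 1" for x
  proof -
    have "(LINT y|lborel. \<bar>F y * q (?T x) x y\<bar>) = (LINT y|lebesgue. \<bar>F y * q (?T x) x y\<bar>)"
      by (rule integral_completion[symmetric]) simp
    also have "\<dots> \<le> 2 * norm (?T x - x) * Ks 1" by (rule Fq_bound)
    also have "\<dots> \<le> 2 * (s * sqrt (1 / (4 * \<epsilon>))) * Ks 1"
      using norm_Tf_diff_self[OF \<epsilon>, of s x] s Ks_nonneg[of 1] by (intro mult_right_mono) auto
    finally show ?thesis .
  qed
  \<comment> \<open>\<open>Db\<close> bounds the inner integral uniformly in x, because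
    \<open>Tf\<close> moves every point by at most a fixed distance; the finite mass of F does the
    rest.\<close>
  have Ki: "integrable (lborel \<Otimes>\<^sub>M lborel) (\<lambda>(x, y). H x y)"
  proof (rule lborel_pair.Fubini_integrable)
    show "(\<lambda>(x, y). H x y) \<in> borel_measurable (lborel \<Otimes>\<^sub>M lborel)" by simp
    show "AE x in lborel. integrable lborel (\<lambda>y. case (x, y) of (x, y) \<Rightarrow> H x y)"
      unfolding H_def using Fq_lb by simp
    show "integrable lborel (\<lambda>x. LINT y|lborel. norm (case (x, y) of (x, y) \<Rightarrow> H x y))"
    proof (rule Bochner_Integration.integrable_bound[OF integrable_mult_right[OF F_int_lborel, of "2 * (s * sqrt (1 / (4 * \<epsilon>))) * Ks 1"]])
      show "(\<lambda>x. LINT y|lborel. norm (case (x, y) of (x, y) \<Rightarrow> H x y)) \<in> borel_measurable lborel"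
        by measurable
      show "AE x in lborel. norm (LINT y|lborel. norm (case (x, y) of (x, y) \<Rightarrow> H x y)) \<le> norm (2 * (s * sqrt (1 / (4 * \<epsilon>))) * Ks 1 * F x)"
      proof (rule AE_I2)
        fix x
        have "(LINT y|lborel. norm (case (x, y) of (x, y) \<Rightarrow> H x y)) = F x * (LINT y|lborel. \<bar>F y * q (?T x) x y\<bar>)"
          using F_nonneg[of x] by (simp add: H_def abs_mult[of "F x"])
        also have "\<dots> \<le> F x * (2 * (s * sqrt (1 / (4 * \<epsilon>))) * Ks 1)"
          using F_nonneg Db by (intro mult_left_mono) auto
        finally have 1: "(LINT y|lborel. norm (case (x, y) of (x, y) \<Rightarrow> H x y)) \<le> 2 * (s * sqrt (1 / (4 * \<epsilon>))) * Ks 1 * F x"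
          by (simp add: ac_simps)
        have "0 \<le> (LINT y|lborel. norm (case (x, y) of (x, y) \<Rightarrow> H x y))" by (intro integral_nonneg_AE) auto
        with 1 show "norm (LINT y|lborel. norm (case (x, y) of (x, y) \<Rightarrow> H x y)) \<le> norm (2 * (s * sqrt (1 / (4 * \<epsilon>))) * Ks 1 * F x)"
          by (simp only: real_norm_def abs_of_nonneg)
      qed
    qed
  qed
  have i1: "integrable lborel (\<lambda>x. LINT y|lborel. H x y)"
    using lborel_pair.integrable_fst[OF Ki] .
  have i2: "integrable lborel (\<lambda>y. LINT x|lborel. H x y)"
    using lborel_pair.integrable_snd[OF Ki] .
  have a1: "AE x in lborel. integrable lborel (\<lambda>y. H x y)"
    using lborel_pair.AE_integrable_fst[OF Ki] .
  have a2: "AE y in lborel. integrable lborel (\<lambda>x. H x y)"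
    using lborel_pair.AE_integrable_snd[OF Ki] .
  have sw: "(LINT y|lborel. LINT x|lborel. H x y) = (LINT x|lborel. LINT y|lborel. H x y)"
    by (rule lborel_pair.Fubini_integral[OF Ki])
  have FD: "F x * (v (?T x) - v x) = - kappa * (LINT y|lborel. H x y)" for x
    unfolding D H_def by simp
  have "integrable lborel (\<lambda>x. F x * (v (?T x) - v x))" unfolding FD using i1 by simp
  then show "integrable lebesgue (\<lambda>x. F x * (v (?T x) - v x))" by (rule integrable_lebesgue_if_lborel)
  have "(LINT x|lebesgue. F x * (v (?T x) - v x)) = (LINT x|lborel. F x * (v (?T x) - v x))"
    by (rule integral_completion) simp
  also have "\<dots> = - kappa * (LINT x|lborel. LINT y|lborel. H x y)" unfolding FD by simp
  finally have L: "- (LINT x|lebesgue. F x * (v (?T x) - v x)) = kappa * (LINT x|lborel. LINT y|lborel. H x y)" by simp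
  let ?c = "4/3 * (s\<^sup>2 / (4 * \<epsilon>)) powr (3/4)"
  \<comment> \<open>Both orders of integration agree, so twice the integral is that of H x y + H y
    x, to which \<open>Tf_sym_bound\<close> applies.\<close>
  have "2 * (LINT x|lborel. LINT y|lborel. H x y) = (LINT x|lborel. (LINT y|lborel. H x y) + (LINT y|lborel. H y x))"
    using i1 i2 sw by simp
  also have "\<dots> \<le> (LINT x|lborel. F x * (s * \<beta> + ?c * Ks (3/2)))"
  proof (rule integral_mono_AE)
    show "integrable lborel (\<lambda>x. (LINT y|lborel. H x y) + (LINT y|lborel. H y x))" using i1 i2 by simp
    show "integrable lborel (\<lambda>x. F x * (s * \<beta> + ?c * Ks (3/2)))" using F_int_lborel by simp
    show "AE x in lborel. (LINT y|lborel. H x y) + (LINT y|lborel. H y x) \<le> F x * (s * \<beta> + ?c * Ks (3/2))"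
      using a1 a2
    proof eventually_elim
      case (elim x)
      have si: "integrable lborel (\<lambda>y. F y * norm (x - y) powr (-(3/2)))"
      proof -
        have "integrable lebesgue (\<lambda>y. F y * norm (x - y) powr (-(3/2)))" by (rule sing_int) auto
        then show ?thesis by (subst (asm) integrable_completion) auto
      qed
      have sl: "(LINT y|lborel. F y * norm (x - y) powr (-(3/2))) \<le> Ks (3/2)"
      proof -
        have "(LINT y|lebesgue. F y * norm (x - y) powr (-(3/2))) \<le> Ks (3/2)" by (rule sing_le) auto
        then show ?thesis by (subst (asm) integral_completion) auto
      qed
      \<comment> \<open>Injectivity leaves at most one y with \<open>Tf s \<epsilon> y = x\<close>,
        so the poles form a null set.\<close>
      have ne: "AE y in lborel. y \<noteq> x \<and> ?T x \<noteq> y \<and> ?T y \<noteq> x"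
      proof -
        have "AE y in lborel. ?T y \<noteq> x"
        proof (cases "\<exists>y0. ?T y0 = x")
          case True
          then obtain y0 where y0: "?T y0 = x" by blast
          have "AE y in lborel. y \<noteq> y0" by (rule AE_lborel_singleton)
          then show ?thesis
            by eventually_elim (use inj_Tf[OF \<epsilon>0, of s] s y0 in \<open>auto simp: inj_def\<close>)
        qed auto
        then show ?thesis
          using AE_lborel_singleton[of x] AE_lborel_singleton[of "?T x"] by eventually_elim auto
      qed
      have "(LINT y|lborel. H x y) + (LINT y|lborel. H y x) = (LINT y|lborel. H x y + H y x)"
        using elim by simp
      also have "\<dots> \<le> (LINT y|lborel. F x * (s * F y + ?c * (F y * norm (x - y) powr (-(3/2)))))"
      proof (rule integral_mono_AE)
        show "integrable lborel (\<lambda>y. H x y + H y x)" using elim by simp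
        show "integrable lborel (\<lambda>y. F x * (s * F y + ?c * (F y * norm (x - y) powr (-(3/2)))))"
          using si F_int_lborel by simp
        show "AE y in lborel. H x y + H y x \<le> F x * (s * F y + ?c * (F y * norm (x - y) powr (-(3/2))))"
          using ne
        proof eventually_elim
          case (elim y)
          have "H x y + H y x = F x * F y * (q (?T x) x y + q (?T y) y x)" by (simp add: H_def algebra_simps)
          also have "\<dots> \<le> F x * F y * (s + ?c * norm (x - y) powr (-(3/2)))"
            using Tf_sym_bound[OF \<epsilon>, of s x y] s elim F_nonneg unfolding q_def
            by (intro mult_left_mono) auto
          finally show ?case by (simp add: algebra_simps)
        qed
      qed
      also have "\<dots> = F x * (s * \<beta> + ?c * (LINT y|lborel. F y * norm (x - y) powr (-(3/2))))"
        using si F_int_lborel beta_lborel by simp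
      also have "\<dots> \<le> F x * (s * \<beta> + ?c * Ks (3/2))"
        using F_nonneg sl by (intro mult_left_mono add_left_mono) auto
      finally show ?case .
    qed
  qed
  also have "\<dots> = \<beta> * (s * \<beta> + ?c * Ks (3/2))" using beta_lborel by simp
  finally have "(LINT x|lborel. LINT y|lborel. H x y) \<le> \<beta> / 2 * (s * \<beta> + ?c * Ks (3/2))" by simp
  then have "kappa * (LINT x|lborel. LINT y|lborel. H x y) \<le> kappa * (\<beta> / 2 * (s * \<beta> + ?c * Ks (3/2)))"
    using kappa_pos by (intro mult_left_mono) auto
  then show "- (LINT x|lebesgue. F x * (v (?T x) - v x)) \<le> kappa / 2 * \<beta> * (s * \<beta> + ?c * Ks (3/2))"
    unfolding L by (simp add: ac_simps)
qed

end

section \<open>The deformed interaction energy\<close>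

context entire_solution
begin

text \<open>The divergence of \<open>Xf \<epsilon>\<close>; it tends to 2 as \<epsilon> ->
  0.\<close>

definition div2 :: "real \<Rightarrow> real^2 \<Rightarrow> real" where
  "div2 \<epsilon> x = 2 / (1 + \<epsilon> * (norm x)\<^sup>2)\<^sup>2"

text \<open>A lower bound for the logarithm of g(Tf x) Jf(x) / g(x); the term 4 s^2 is the loss in
  \<open>Jf_lower\<close>.\<close>

definition ax :: "real \<Rightarrow> real \<Rightarrow> real^2 \<Rightarrow> real" where
  "ax s \<epsilon> x = lam * (v (Tf s \<epsilon> x) - v x) + (s * div2 \<epsilon> x - 4 * s\<^sup>2)"

lemma div2_meas[measurable]: "div2 \<epsilon> \<in> borel_measurable borel"
  unfolding div2_def[abs_def] by measurable

lemma div2_bounds: "\<epsilon> \<ge> 0 \<Longrightarrow> 0 \<le> div2 \<epsilon> x \<and> div2 \<epsilon> x \<le> 2"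
  unfolding div2_def by (auto simp: divide_le_eq intro!: one_le_power)

lemma ax_meas: "\<epsilon> \<ge> 0 \<Longrightarrow> ax s \<epsilon> \<in> borel_measurable borel"
proof -
  assume \<epsilon>: "\<epsilon> \<ge> 0"
  have [measurable]: "(Tf s \<epsilon> :: real^2 \<Rightarrow> real^2) \<in> borel_measurable borel" by (rule Tf_measurable[OF \<epsilon>])
  show ?thesis unfolding ax_def[abs_def] by measurable
qed

text \<open>M depends on s and \<epsilon> and serves to make the integrals below exist. As no lower
  bound of v is at hand, the difference of v is estimated through its logarithmic potential.\<close>

lemma ax_bounded:
  assumes "\<epsilon> > 0" "0 \<le> s" "s \<le> 1/2"
  obtains M where "M \<ge> 0" "\<And>x. \<bar>ax s \<epsilon> x\<bar> \<le> M"
proof -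
  define M where "M = lam * (kappa * (2 * (s * sqrt (1 / (4 * \<epsilon>))) * Ks 1)) + (2 * s + 4 * s\<^sup>2)"
  have "\<bar>ax s \<epsilon> x\<bar> \<le> M" for x
  proof -
    have "\<bar>v (Tf s \<epsilon> x) - v x\<bar> = kappa * \<bar>LINT y|lebesgue. F y * q (Tf s \<epsilon> x) x y\<bar>"
      using Liouville[of "Tf s \<epsilon> x" x] kappa_pos by (simp add: abs_mult)
    also have "\<dots> \<le> kappa * (LINT y|lebesgue. \<bar>F y * q (Tf s \<epsilon> x) x y\<bar>)"
      using kappa_pos by (intro mult_left_mono integral_abs_bound) auto
    also have "\<dots> \<le> kappa * (2 * norm (Tf s \<epsilon> x - x) * Ks 1)"
      using kappa_pos by (intro mult_left_mono Fq_bound) auto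
    also have "\<dots> \<le> kappa * (2 * (s * sqrt (1 / (4 * \<epsilon>))) * Ks 1)"
      using kappa_pos norm_Tf_diff_self[of \<epsilon> s x] assms Ks_nonneg by (intro mult_left_mono mult_right_mono) auto
    finally have "\<bar>lam * (v (Tf s \<epsilon> x) - v x)\<bar> \<le> lam * (kappa * (2 * (s * sqrt (1 / (4 * \<epsilon>))) * Ks 1))"
      using lam_pos by (simp add: abs_mult)
    moreover have "\<bar>s * div2 \<epsilon> x - 4 * s\<^sup>2\<bar> \<le> 2 * s + 4 * s\<^sup>2"
    proof -
      have "0 \<le> s * div2 \<epsilon> x" "s * div2 \<epsilon> x \<le> s * 2"
        using div2_bounds[of \<epsilon> x] assms by (auto intro!: mult_left_mono)
      then show ?thesis using zero_le_power2[of s] assms unfolding abs_le_iff by linarith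
    qed
    ultimately show ?thesis unfolding ax_def M_def by linarith
  qed
  moreover from this[of 0] have "M \<ge> 0" by linarith
  ultimately show ?thesis using that by blast
qed

text \<open>The double integral of \<open>g x * g y / |x - y|\<^sup>\<mu>\<close> does not change under the substitution \<open>Tf\<close>. Comparing
  integrands by \<open>1 + t \<le> exp t\<close> replaces differentiation of \<open>v\<close> and integration by parts.\<close>

lemma pointwise_Jensen:
  assumes "\<epsilon> > 0" "0 \<le> s" "s \<le> 1/2" "x \<noteq> y"
  shows "g y * ((1 + ax s \<epsilon> x + ax s \<epsilon> y - \<mu> * s) * (g x / norm (y - x) powr \<mu>))
    \<le> g (Tf s \<epsilon> y) * Jf s \<epsilon> y * (g (Tf s \<epsilon> x) / norm (Tf s \<epsilon> y - Tf s \<epsilon> x) powr \<mu> * Jf s \<epsilon> x)"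
proof -
  let ?T = "Tf s \<epsilon> :: real^2 \<Rightarrow> real^2"
  have \<epsilon>0: "\<epsilon> \<ge> 0" using assms by simp
  have gJ: "g z * exp (ax s \<epsilon> z) \<le> g (?T z) * Jf s \<epsilon> z" for z
  proof -
    have "exp (s * div2 \<epsilon> z - 4 * s\<^sup>2) \<le> exp (ln (Jf s \<epsilon> z))"
      using Jf_lower(2)[OF \<epsilon>0 assms(2,3), of z] by (simp add: div2_def mult.commute)
    also have "\<dots> = Jf s \<epsilon> z" using Jf_lower(1)[OF \<epsilon>0 assms(2,3), of z] by simp
    finally have "g (?T z) * exp (s * div2 \<epsilon> z - 4 * s\<^sup>2) \<le> g (?T z) * Jf s \<epsilon> z" by (intro mult_left_mono) auto
    moreover have "g z * exp (ax s \<epsilon> z) = g (?T z) * exp (s * div2 \<epsilon> z - 4 * s\<^sup>2)"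
      unfolding ax_def by (simp add: algebra_simps flip: exp_add)
    ultimately show ?thesis by simp
  qed
  have d: "norm (y - x) > 0" using assms by simp
  have "?T y \<noteq> ?T x" using inj_Tf[OF \<epsilon>0 assms(2)] assms by (auto simp: inj_def)
  then have Td: "norm (?T y - ?T x) > 0" by simp
  \<comment> \<open>\<open>Tf\<close> stretches distances by at most 1 + s \<le> exp s, which costs
    the kernel a factor exp(-\<mu> s).\<close>
  have k: "1 / norm (?T y - ?T x) powr \<mu> \<ge> exp (- \<mu> * s) / norm (y - x) powr \<mu>"
  proof -
    have "norm (?T y - ?T x) powr \<mu> \<le> (exp s * norm (y - x)) powr \<mu>"
    proof (rule powr_mono2)
      have "norm (?T y - ?T x) \<le> (1 + s) * norm (y - x)" by (rule norm_Tf_diff_upper[OF \<epsilon>0 assms(2)])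
      also have "\<dots> \<le> exp s * norm (y - x)" by (intro mult_right_mono exp_ge_add_one_self) auto
      finally show "norm (?T y - ?T x) \<le> exp s * norm (y - x)" .
    qed (use \<mu> in auto)
    also have "\<dots> = exp (\<mu> * s) * norm (y - x) powr \<mu>" by (simp add: powr_mult exp_powr_real mult.commute)
    finally have "norm (?T y - ?T x) powr \<mu> \<le> exp (\<mu> * s) * norm (y - x) powr \<mu>" .
    then have "1 / (exp (\<mu> * s) * norm (y - x) powr \<mu>) \<le> 1 / norm (?T y - ?T x) powr \<mu>"
      using Td d by (intro divide_left_mono mult_pos_pos) auto
    then show ?thesis by (simp add: exp_minus field_simps)
  qed
  have "g y * ((1 + ax s \<epsilon> x + ax s \<epsilon> y - \<mu> * s) * (g x / norm (y - x) powr \<mu>))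
      = (1 + ax s \<epsilon> x + ax s \<epsilon> y - \<mu> * s) * (g y * g x / norm (y - x) powr \<mu>)"
    by (simp only: times_divide_eq_right mult.left_commute)
  also have "\<dots> \<le> exp (ax s \<epsilon> x + ax s \<epsilon> y - \<mu> * s) * (g y * g x / norm (y - x) powr \<mu>)"
    by (rule mult_right_mono) (use exp_ge_add_one_self[of "ax s \<epsilon> x + ax s \<epsilon> y - \<mu> * s"] in \<open>auto simp: add_diff_eq add.assoc\<close>)
  also have "\<dots> = (g y * exp (ax s \<epsilon> y)) * (g x * exp (ax s \<epsilon> x)) * (exp (- \<mu> * s) / norm (y - x) powr \<mu>)"
    by (simp add: exp_add exp_diff exp_minus field_simps)
  also have "\<dots> \<le> (g (?T y) * Jf s \<epsilon> y) * (g (?T x) * Jf s \<epsilon> x) * (1 / norm (?T y - ?T x) powr \<mu>)"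
    using k by (intro mult_mono gJ) (auto intro!: mult_nonneg_nonneg less_imp_le[OF Jf_lower(1)[OF \<epsilon>0 assms(2,3)]])
  finally show ?thesis by (simp add: ac_simps)
qed

lemma gI_eq: "g x * I x = F x / W" using W by (simp add: F_eq)

lemma gI_int: "integrable lebesgue (\<lambda>x. g x * I x)"
  unfolding gI_eq using F_int by simp

text \<open>Integrating \<open>pointwise_Jensen\<close> over x and y bounds the pulled-back energy
  from below; by \<open>Tf_change_of_variables\<close> it is at most the energy itself, and the
  terms of order zero cancel. By the symmetry of the kernel \<open>ax\<close> contributes once for
  each variable, hence the factor 2.\<close>

lemma Jensen_inequality:
  assumes \<epsilon>: "\<epsilon> > 0" and s: "0 \<le> s" "s \<le> 1/2"
  shows "integrable lebesgue (\<lambda>x. F x * ax s \<epsilon> x)"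
    "2 * (LINT x|lebesgue. F x * ax s \<epsilon> x) \<le> \<mu> * s * \<beta>"
proof -
  let ?T = "Tf s \<epsilon> :: real^2 \<Rightarrow> real^2" and ?a = "ax s \<epsilon>"
  have \<epsilon>0: "\<epsilon> \<ge> 0" using \<epsilon> by simp
  have [measurable]: "?T \<in> borel_measurable borel" by (rule Tf_measurable[OF \<epsilon>0])
  have [measurable]: "?a \<in> borel_measurable borel" by (rule ax_meas[OF \<epsilon>0])
  obtain M where M: "M \<ge> 0" "\<And>x. \<bar>?a x\<bar> \<le> M" using ax_bounded[OF \<epsilon> s] by blast
  have bi: "integrable lebesgue (\<lambda>x. ?a x * h x)" if h: "integrable lebesgue h" "h \<in> borel_measurable borel" for h
  proof (rule Bochner_Integration.integrable_bound[OF integrable_mult_right[OF h(1), of M]])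
    show "(\<lambda>x. ?a x * h x) \<in> borel_measurable lebesgue" using h(2) by (intro borel_imp_lebesgue) measurable
    show "AE x in lebesgue. norm (?a x * h x) \<le> norm (M * h x)"
      using M by (intro AE_I2) (auto simp: abs_mult intro!: mult_right_mono)
  qed
  show aF: "integrable lebesgue (\<lambda>x. F x * ?a x)" using bi[OF F_int F_meas] by (simp add: mult.commute)
  define A where "A y = (LINT x|lebesgue. ?a x * (g x / norm (y - x) powr \<mu>))" for y
  have ki: "integrable lebesgue (\<lambda>x. g x / norm (y - x) powr \<mu>)" for y by (rule I_int)
  have Ai: "integrable lebesgue (\<lambda>x. ?a x * (g x / norm (y - x) powr \<mu>))" for y
    by (rule bi[OF ki]) measurable
  have A_lb: "A y = (LINT x|lborel. ?a x * (g x / norm (y - x) powr \<mu>))" for y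
    unfolding A_def by (rule integral_completion) measurable
  have [measurable]: "A \<in> borel_measurable borel"
    unfolding A_lb[abs_def] by measurable
  have A_abs: "\<bar>A y\<bar> \<le> M * I y" for y
  proof -
    have "\<bar>A y\<bar> \<le> (LINT x|lebesgue. \<bar>?a x * (g x / norm (y - x) powr \<mu>)\<bar>)" unfolding A_def by (rule integral_abs_bound)
    also have "\<dots> \<le> (LINT x|lebesgue. M * (g x / norm (y - x) powr \<mu>))"
    proof (rule integral_mono)
      show "integrable lebesgue (\<lambda>x. \<bar>?a x * (g x / norm (y - x) powr \<mu>)\<bar>)"
        by (rule integrable_abs[OF Ai])
      show "integrable lebesgue (\<lambda>x. M * (g x / norm (y - x) powr \<mu>))"
        by (rule integrable_mult_right[OF ki])
      show "\<bar>?a x * (g x / norm (y - x) powr \<mu>)\<bar> \<le> M * (g x / norm (y - x) powr \<mu>)" for x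
        unfolding abs_mult using M by (intro mult_mono) auto
    qed
    finally show ?thesis unfolding riesz_potential_def by (simp only: integral_mult_right_zero)
  qed
  have gA: "integrable lebesgue (\<lambda>y. g y * A y)"
  proof (rule Bochner_Integration.integrable_bound[OF integrable_mult_right[OF gI_int, of M]])
    show "(\<lambda>y. g y * A y) \<in> borel_measurable lebesgue" by (rule borel_imp_lebesgue) measurable
    show "AE y in lebesgue. norm (g y * A y) \<le> norm (M * (g y * I y))"
      using A_abs M I_nonneg by (intro AE_I2) (auto simp: abs_mult)
  qed
  have inner: "g y * ((1 + ?a y - \<mu> * s) * I y + A y) \<le> g (?T y) * I (?T y) * Jf s \<epsilon> y" for y
  proof -
    have id: "G * ((1 + b - m) * K + a * K) = G * ((1 + a + b - m) * K)" for G a b m K :: real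
      by (simp add: algebra_simps)
    note cv = Tf_change_of_variables[OF \<epsilon>0 s ki[of "?T y"]]
    have cv1: "integrable lebesgue (\<lambda>x. g (?T x) / norm (?T y - ?T x) powr \<mu> * Jf s \<epsilon> x)"
      and cv2: "(LINT x|lebesgue. g (?T x) / norm (?T y - ?T x) powr \<mu> * Jf s \<epsilon> x) \<le> I (?T y)"
      using cv unfolding riesz_potential_def by auto
    have "(LINT x|lebesgue. g y * ((1 + ?a x + ?a y - \<mu> * s) * (g x / norm (y - x) powr \<mu>)))
        \<le> (LINT x|lebesgue. g (?T y) * Jf s \<epsilon> y * (g (?T x) / norm (?T y - ?T x) powr \<mu> * Jf s \<epsilon> x))"
    proof (rule integral_mono_AE)
      have "integrable lebesgue (\<lambda>x. g y * ((1 + ?a y - \<mu> * s) * (g x / norm (y - x) powr \<mu>) + ?a x * (g x / norm (y - x) powr \<mu>)))"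
        using ki[of y] Ai[of y] by (intro integrable_mult_right Bochner_Integration.integrable_add)
      then show "integrable lebesgue (\<lambda>x. g y * ((1 + ?a x + ?a y - \<mu> * s) * (g x / norm (y - x) powr \<mu>)))"
        by (simp only: id)
      show "integrable lebesgue (\<lambda>x. g (?T y) * Jf s \<epsilon> y * (g (?T x) / norm (?T y - ?T x) powr \<mu> * Jf s \<epsilon> x))"
        using cv1 by (rule integrable_mult_right)
      show "AE x in lebesgue. g y * ((1 + ?a x + ?a y - \<mu> * s) * (g x / norm (y - x) powr \<mu>))
          \<le> g (?T y) * Jf s \<epsilon> y * (g (?T x) / norm (?T y - ?T x) powr \<mu> * Jf s \<epsilon> x)"
        using AE_lebesgue_neq[of y] by eventually_elim (rule pointwise_Jensen[OF \<epsilon> s])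
    qed
    also have "\<dots> = g (?T y) * Jf s \<epsilon> y * (LINT x|lebesgue. g (?T x) / norm (?T y - ?T x) powr \<mu> * Jf s \<epsilon> x)"
      by (rule integral_mult_right_zero)
    also have "\<dots> \<le> g (?T y) * Jf s \<epsilon> y * I (?T y)"
      using cv2 Jf_lower(1)[OF \<epsilon>0 s, of y] by (intro mult_left_mono) auto
    finally have 1: "(LINT x|lebesgue. g y * ((1 + ?a x + ?a y - \<mu> * s) * (g x / norm (y - x) powr \<mu>))) \<le> g (?T y) * Jf s \<epsilon> y * I (?T y)" .
    have "(LINT x|lebesgue. g y * ((1 + ?a x + ?a y - \<mu> * s) * (g x / norm (y - x) powr \<mu>))) =
        (LINT x|lebesgue. g y * ((1 + ?a y - \<mu> * s) * (g x / norm (y - x) powr \<mu>) + ?a x * (g x / norm (y - x) powr \<mu>)))"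
      by (simp only: id)
    also have "\<dots> = g y * ((1 + ?a y - \<mu> * s) * I y + A y)"
      unfolding riesz_potential_def A_def
      by (simp only: integral_mult_right_zero Bochner_Integration.integral_add[OF integrable_mult_right[OF ki] Ai])
    finally show ?thesis using 1 by (simp add: ac_simps)
  qed
  have gI_meas: "(\<lambda>x. g x * I x) \<in> borel_measurable borel" by measurable
  have agI: "integrable lebesgue (\<lambda>x. ?a x * (g x * I x))" by (rule bi[OF gI_int gI_meas])
  have gI_nn: "g x * I x \<ge> 0" for x using I_nonneg by simp
  note cvo = Tf_change_of_variables[OF \<epsilon>0 s gI_int gI_nn]
  have "(LINT y|lebesgue. (1 - \<mu> * s) * (g y * I y) + ?a y * (g y * I y) + g y * A y) \<le> (LINT y|lebesgue. g (?T y) * I (?T y) * Jf s \<epsilon> y)"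
  proof (rule integral_mono)
    show "integrable lebesgue (\<lambda>y. (1 - \<mu> * s) * (g y * I y) + ?a y * (g y * I y) + g y * A y)"
      using gI_int agI gA by simp
    show "(1 - \<mu> * s) * (g y * I y) + ?a y * (g y * I y) + g y * A y \<le> g (?T y) * I (?T y) * Jf s \<epsilon> y" for y
      using inner[of y] by (simp add: algebra_simps)
  qed (rule cvo(1))
  also have "\<dots> \<le> (LINT y|lebesgue. g y * I y)" by (rule cvo(2))
  also have "(LINT y|lebesgue. (1 - \<mu> * s) * (g y * I y) + ?a y * (g y * I y) + g y * A y) =
      (1 - \<mu> * s) * (LINT y|lebesgue. g y * I y) + (LINT y|lebesgue. ?a y * (g y * I y)) + (LINT y|lebesgue. g y * A y)"
    using gI_int agI gA by simp
  \<comment> \<open>Fubini and the symmetry of the kernel move the weight from the inner variable to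
    the outer one.\<close>
  also have "(LINT y|lebesgue. g y * A y) = (LINT y|lebesgue. ?a y * (g y * I y))"
  proof -
    define K where "K x y = ?a x * (g x * (g y / norm (y - x) powr \<mu>))" for x y
    have [measurable]: "(\<lambda>(x, y). K x y) \<in> borel_measurable (borel \<Otimes>\<^sub>M borel)"
      unfolding K_def by measurable
    have ki2: "integrable lborel (\<lambda>y. g y / norm (x - y) powr \<mu>)" for x
      using ki[of x] by (subst (asm) integrable_completion) auto
    have kk: "integrable lborel (\<lambda>y. K x y)" for x
      unfolding K_def norm_minus_commute[of _ x] by (intro integrable_mult_right ki2)
    have Ki: "integrable (lborel \<Otimes>\<^sub>M lborel) (\<lambda>(x, y). K x y)"
    proof (rule lborel_pair.Fubini_integrable)
      show "(\<lambda>(x, y). K x y) \<in> borel_measurable (lborel \<Otimes>\<^sub>M lborel)" by simp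
      show "AE x in lborel. integrable lborel (\<lambda>y. case (x, y) of (x, y) \<Rightarrow> K x y)"
        using kk by simp
      have e: "(LINT y|lborel. norm (case (x, y) of (x, y) \<Rightarrow> K x y)) = \<bar>?a x\<bar> * (g x * I x)" for x
      proof -
        have "norm (case (x, y) of (x, y) \<Rightarrow> K x y) = \<bar>?a x\<bar> * (g x * (g y / norm (x - y) powr \<mu>))" for y
          by (simp add: K_def abs_mult norm_minus_commute)
        then show ?thesis by (simp only: integral_mult_right_zero I_eq_lborel)
      qed
      have "integrable lebesgue (\<lambda>x. \<bar>?a x * (g x * I x)\<bar>)" using agI by simp
      then have "integrable lebesgue (\<lambda>x. \<bar>?a x\<bar> * (g x * I x))" using I_nonneg by (simp add: abs_mult)
      then show "integrable lborel (\<lambda>x. LINT y|lborel. norm (case (x, y) of (x, y) \<Rightarrow> K x y))"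
        unfolding e by (subst (asm) integrable_completion) auto
    qed
    have "(LINT y|lebesgue. g y * A y) = (LINT y|lborel. g y * A y)" by (rule integral_completion) simp
    also have "\<dots> = (LINT y|lborel. LINT x|lborel. K x y)"
      unfolding A_lb K_def by (simp add: ac_simps flip: integral_mult_right_zero)
    also have "\<dots> = (LINT x|lborel. LINT y|lborel. K x y)" by (rule lborel_pair.Fubini_integral[OF Ki])
    also have "\<dots> = (LINT x|lborel. ?a x * (g x * I x))"
    proof -
      have "(LINT y|lborel. K x y) = ?a x * (g x * I x)" for x
        unfolding K_def I_eq_lborel norm_minus_commute[of _ x] by (simp only: integral_mult_right_zero)
      then show ?thesis by simp
    qed
    also have "\<dots> = (LINT x|lebesgue. ?a x * (g x * I x))" by (rule integral_completion[symmetric]) simp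
    finally show ?thesis .
  qed
  finally have fin: "2 * (LINT y|lebesgue. ?a y * (g y * I y)) \<le> \<mu> * s * (LINT y|lebesgue. g y * I y)"
    by (simp add: algebra_simps)
  have "(LINT y|lebesgue. ?a y * (g y * I y)) = (LINT x|lebesgue. F x * ?a x) / W"
    unfolding gI_eq by (simp add: mult.commute)
  moreover have "(LINT y|lebesgue. g y * I y) = \<beta> / W" unfolding gI_eq \<beta>_def by simp
  ultimately have "2 * ((LINT x|lebesgue. F x * ?a x) / W) \<le> \<mu> * s * (\<beta> / W)"
    using fin by (simp only:)
  then show "2 * (LINT x|lebesgue. F x * ?a x) \<le> \<mu> * s * \<beta>"
    using W by (simp add: divide_le_cancel)
qed

text \<open>The number \<open>4 / kappa\<close> is \<open>8\<pi>\<close>.\<close>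

lemma mass_lower_bound: "\<beta> \<ge> 4 / kappa"
proof -
  have Fd: "integrable lebesgue (\<lambda>x. F x * div2 \<epsilon> x)" if "\<epsilon> \<ge> 0" for \<epsilon>
  proof (rule Bochner_Integration.integrable_bound[OF integrable_mult_right[OF F_int, of 2]])
    show "(\<lambda>x. F x * div2 \<epsilon> x) \<in> borel_measurable lebesgue" by (rule borel_imp_lebesgue) measurable
    show "AE x in lebesgue. norm (F x * div2 \<epsilon> x) \<le> norm (2 * F x)"
      using div2_bounds[OF that] F_nonneg by (intro AE_I2) (auto simp: abs_mult mult.commute intro!: mult_left_mono)
  qed
  \<comment> \<open>At fixed \<epsilon> the two estimates are combined and divided by s, and s -> 0.
    On the right remain \<mu> from the kernel and lam kappa \<beta> from the logarithmic
    interaction, each times \<beta>.\<close>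
  have eps: "2 * (LINT x|lebesgue. F x * div2 \<epsilon> x) \<le> \<mu> * \<beta> + lam * kappa * \<beta>\<^sup>2" if \<epsilon>: "\<epsilon> > 0" for \<epsilon>
  proof -
    let ?P = "LINT x|lebesgue. F x * div2 \<epsilon> x"
    define c where "c = 4/3 * (1 / (4 * \<epsilon>)) powr (3/4) * Ks (3/2)"
    have *: "2 * ?P \<le> \<mu> * \<beta> + lam * kappa * \<beta>\<^sup>2 + (lam * kappa * \<beta> * c * s powr (1/2) + 8 * s * \<beta>)" if s: "0 < s" "s \<le> 1/2" for s
    proof -
      note lb = log_interaction_bound[OF \<epsilon> s]
      define J where "J = (LINT x|lebesgue. F x * (v (Tf s \<epsilon> x) - v x))"
      have "(LINT x|lebesgue. F x * ax s \<epsilon> x) = (LINT x|lebesgue. lam * (F x * (v (Tf s \<epsilon> x) - v x)) + s * (F x * div2 \<epsilon> x) - 4 * s\<^sup>2 * F x)"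
        unfolding ax_def by (intro Bochner_Integration.integral_cong refl) (simp add: algebra_simps)
      also have "\<dots> = lam * J + s * ?P - 4 * s\<^sup>2 * \<beta>"
        using lb(1) Fd[of \<epsilon>] \<epsilon> F_int by (simp add: \<beta>_def J_def)
      finally have e: "(LINT x|lebesgue. F x * ax s \<epsilon> x) = lam * J + s * ?P - 4 * s\<^sup>2 * \<beta>" .
      have J1: "2 * (lam * J + s * ?P - 4 * s\<^sup>2 * \<beta>) \<le> \<mu> * s * \<beta>"
        using Jensen_inequality(2)[OF \<epsilon>, of s] s unfolding e by simp
      have J2: "lam * (- J) \<le> lam * (kappa / 2 * \<beta> * (s * \<beta> + 4/3 * (s\<^sup>2 / (4 * \<epsilon>)) powr (3/4) * Ks (3/2)))"
        using lb(2) lam_pos unfolding J_def by (intro mult_left_mono) auto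
      have J3: "4/3 * (s\<^sup>2 / (4 * \<epsilon>)) powr (3/4) * Ks (3/2) = c * (s * s powr (1/2))"
      proof -
        have "(s\<^sup>2 / (4 * \<epsilon>)) powr (3/4) = (s\<^sup>2 * (1 / (4 * \<epsilon>))) powr (3/4)" by simp
        also have "\<dots> = (s\<^sup>2) powr (3/4) * (1 / (4 * \<epsilon>)) powr (3/4)" using s \<epsilon> by (subst powr_mult) auto
        also have "(s\<^sup>2) powr (3/4) = s powr (1 + 1/2)" using s by (simp add: powr_powr flip: powr_numeral)
        also have "\<dots> = s * s powr (1/2)" using s by (subst powr_add) simp
        finally show ?thesis by (simp add: c_def)
      qed
      have "2 * s * ?P \<le> \<mu> * s * \<beta> + lam * kappa * \<beta> * (s * \<beta> + c * (s * s powr (1/2))) + 8 * s\<^sup>2 * \<beta>"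
        using J1 J2 unfolding J3 by (simp add: algebra_simps)
      also have "\<dots> = s * (\<mu> * \<beta> + lam * kappa * \<beta>\<^sup>2 + (lam * kappa * \<beta> * c * s powr (1/2) + 8 * s * \<beta>))"
        by (simp add: algebra_simps power2_eq_square)
      finally have "s * (2 * ?P) \<le> s * (\<mu> * \<beta> + lam * kappa * \<beta>\<^sup>2 + (lam * kappa * \<beta> * c * s powr (1/2) + 8 * s * \<beta>))"
        by simp
      then show ?thesis using s by (simp only: mult_le_cancel_left_pos)
    qed
    have lim: "((\<lambda>s. \<mu> * \<beta> + lam * kappa * \<beta>\<^sup>2 + (lam * kappa * \<beta> * c * s powr (1/2) + 8 * s * \<beta>)) \<longlongrightarrow> \<mu> * \<beta> + lam * kappa * \<beta>\<^sup>2 + (lam * kappa * \<beta> * c * 0 + 8 * 0 * \<beta>)) (at_right 0)"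
    proof -
      have "((\<lambda>s::real. s powr (1/2)) \<longlongrightarrow> 0) (at_right 0)" by real_asymp
      then show ?thesis by (intro tendsto_intros)
    qed
    have "\<forall>\<^sub>F s in at_right 0. s \<in> {0<..<1/2::real}" by (rule eventually_at_right_real) simp
    then have "\<forall>\<^sub>F s in at_right 0. 2 * ?P \<le> \<mu> * \<beta> + lam * kappa * \<beta>\<^sup>2 + (lam * kappa * \<beta> * c * s powr (1/2) + 8 * s * \<beta>)"
      by eventually_elim (use * in auto)
    from tendsto_lowerbound[OF lim this] show ?thesis by simp
  qed
  have "(\<lambda>n. LINT x|lebesgue. F x * div2 (1 / (real n + 1)) x) \<longlonglongrightarrow> (LINT x|lebesgue. F x * 2)"
  proof (rule integral_dominated_convergence[where w="\<lambda>x. 2 * F x"])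
    show "(\<lambda>x. F x * 2) \<in> borel_measurable lebesgue" by (rule borel_imp_lebesgue) measurable
    show "(\<lambda>x. F x * div2 (1 / (real n + 1)) x) \<in> borel_measurable lebesgue" for n by (rule borel_imp_lebesgue) measurable
    show "integrable lebesgue (\<lambda>x. 2 * F x)" using F_int by simp
    show "AE x in lebesgue. norm (F x * div2 (1 / (real n + 1)) x) \<le> 2 * F x" for n
      using div2_bounds[of "1 / (real n + 1)"] F_nonneg by (intro AE_I2) (auto simp: abs_mult mult.commute intro!: mult_left_mono)
    show "AE x in lebesgue. (\<lambda>n. F x * div2 (1 / (real n + 1)) x) \<longlonglongrightarrow> F x * 2"
    proof (rule AE_I2)
      fix x :: "real^2"
      have "(\<lambda>n. 1 / (real n + 1)) \<longlonglongrightarrow> 0" by real_asymp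
      then have "(\<lambda>n. div2 (1 / (real n + 1)) x) \<longlonglongrightarrow> 2 / (1 + 0 * (norm x)\<^sup>2)\<^sup>2"
        unfolding div2_def by (intro tendsto_intros) auto
      then show "(\<lambda>n. F x * div2 (1 / (real n + 1)) x) \<longlonglongrightarrow> F x * 2" by (intro tendsto_intros) simp
    qed
  qed
  then have "(\<lambda>n. 2 * (LINT x|lebesgue. F x * div2 (1 / (real n + 1)) x)) \<longlonglongrightarrow> 2 * (LINT x|lebesgue. F x * 2)"
    by (intro tendsto_intros)
  then have "2 * (LINT x|lebesgue. F x * 2) \<le> \<mu> * \<beta> + lam * kappa * \<beta>\<^sup>2"
    by (rule LIMSEQ_le_const2) (use eps in auto)
  then have "4 * \<beta> \<le> \<mu> * \<beta> + lam * kappa * \<beta>\<^sup>2" by (simp add: \<beta>_def)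
  \<comment> \<open>The choice of lam enters here: 4 - \<mu> = 4 lam, so lam cancels and the bound
    is the same for every \<mu>.\<close>
  then have "(4 - \<mu>) * \<beta> \<le> lam * kappa * \<beta>\<^sup>2" by (simp add: algebra_simps)
  moreover have "4 - \<mu> = 4 * lam" using lam by simp
  ultimately have "\<beta> * (4 * lam) \<le> \<beta> * (lam * kappa * \<beta>)"
    by (simp add: ac_simps power2_eq_square)
  then have "4 * lam \<le> lam * kappa * \<beta>" using \<beta>_pos mult_le_cancel_left_pos by blast
  then have "lam * 4 \<le> lam * (kappa * \<beta>)" by (simp only: ac_simps)
  then have "4 \<le> kappa * \<beta>" using lam_pos by (simp only: mult_le_cancel_left_pos)
  then show ?thesis using kappa_pos by (simp add: divide_le_eq mult.commute)
qed

end

section \<open>Compactness of blow-up sequences\<close>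

definition Gam_mass :: real where
  "Gam_mass = (LINT y|lebesgue. Gam (norm (y :: real^2)))"

lemma integrable_Gam_norm: "integrable lebesgue (\<lambda>y. Gam (norm (y :: real^2)))"
proof -
  have w: "integrable lebesgue (\<lambda>y. 4 * theta * (indicator (cball 0 1) y * norm (y :: real^2) powr (-(1/2))))"
    using integrable_npow[of "1/2"] by (intro integrable_mult_right) auto
  show ?thesis
  proof (rule Bochner_Integration.integrable_bound[OF w])
    show "(\<lambda>y. Gam (norm (y :: real^2))) \<in> borel_measurable lebesgue" by (rule borel_imp_lebesgue) measurable
    show "AE y in lebesgue. norm (Gam (norm (y :: real^2))) \<le> norm (4 * theta * (indicator (cball 0 1) y * norm y powr (-(1/2))))"
    proof (rule AE_I2)
      fix y :: "real^2"
      show "norm (Gam (norm y)) \<le> norm (4 * theta * (indicator (cball 0 1) y * norm y powr (-(1/2))))"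
      proof (cases "norm y \<le> 1")
        case True
        then show ?thesis using Gam_le_powr[of "norm y"] Gam_nonneg[of "norm y"] theta_pos
          by (simp add: abs_mult)
      next
        case False
        then show ?thesis using Gam_eq_0[of "norm y"] by simp
      qed
    qed
  qed
qed

lemma Gam_mass_nonneg: "Gam_mass \<ge> 0"
  unfolding Gam_mass_def by (intro integral_nonneg_AE) (auto simp: Gam_nonneg)

lemma
  fixes x :: "real^2"
  assumes "\<rho> > 0"
  shows integrable_Gam: "integrable lebesgue (\<lambda>y. Green \<rho> x y)"
    and integral_Gam: "(LINT y|lebesgue. Green \<rho> x y) = \<rho>\<^sup>2 * Gam_mass"
proof -
  have e: "Gam (norm (x - (x + \<rho> *\<^sub>R y)) / \<rho>) = Gam (norm y)" for y using assms by simp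
  show "integrable lebesgue (\<lambda>y. Green \<rho> x y)"
    using integrable_lebesgue_scale[of \<rho> "\<lambda>y. Green \<rho> x y" x] assms integrable_Gam_norm
    unfolding e by simp
  show "(LINT y|lebesgue. Green \<rho> x y) = \<rho>\<^sup>2 * Gam_mass"
    using integral_lebesgue_scale[of \<rho> "\<lambda>y. Green \<rho> x y" x] assms
    unfolding e by (simp add: Gam_mass_def)
qed

text \<open>The functions \<open>v n\<close> solve the rescaled equation on the disc of radius \<open>R n\<close>, are normalised at the
  origin and bounded above by \<open>B\<close>; \<open>g n\<close> extends \<open>exp (lam * v n)\<close> to the plane and carries the
  nonlocal part, which is only controlled in \<open>L\<^sup>p\<close> with \<open>p = 1 / lam\<close>.\<close>

locale blow_up =
  fixes \<mu> lam b c0 B W0 :: real and v g Wt F :: "nat \<Rightarrow> real^2 \<Rightarrow> real"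
    and S :: "nat \<Rightarrow> (real^2) set" and R :: "nat \<Rightarrow> real"
  assumes \<mu>: "0 < \<mu>" "\<mu> < 2" and lam: "lam = (4 - \<mu>) / 4" and W0: "W0 > 0"
    and R_lim: "filterlim R at_top sequentially" and R_pos: "\<And>n. R n > 0"
    and v_cont: "\<And>n. continuous_on (cball 0 (R n)) (v n)" and v_0: "\<And>n. v n 0 = 0"
    and v_le: "\<And>n y. norm y \<le> R n \<Longrightarrow> v n y \<le> B"
    and g_meas: "\<And>n. g n \<in> borel_measurable lebesgue" and g_nonneg: "\<And>n y. g n y \<ge> 0"
    and g_int: "\<And>n. integrable lebesgue (\<lambda>y. g n y powr (1 / lam))"
    and g_le: "\<And>n. (LINT y|lebesgue. g n y powr (1 / lam)) \<le> c0"
    and g_eq: "\<And>n y. norm y \<le> R n \<Longrightarrow> g n y = exp (lam * v n y)"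
    and F_eq: "\<And>n y. norm y \<le> R n \<Longrightarrow> F n y = Wt n y * riesz_potential \<mu> (g n) y * g n y"
    and F_meas: "\<And>n. (\<lambda>y. indicator (cball 0 (R n)) y * F n y) \<in> borel_measurable lebesgue"
    and rep_v: "\<And>n. rep (S n) (v n) (F n)" and S_sub: "\<And>n. cball 0 (R n) \<subseteq> S n"
    and W_bd: "\<And>n y. norm y \<le> R n \<Longrightarrow> 0 \<le> Wt n y \<and> Wt n y \<le> b"
    and W_lim: "\<And>y. (\<lambda>n. Wt n y) \<longlonglongrightarrow> W0"
begin

lemma lam_pos: "lam > 0" using \<mu> lam by simp

lemma B_nonneg: "B \<ge> 0" using v_le[of 0 0] v_0[of 0] R_pos[of 0] by simp

lemma c0_nonneg: "c0 \<ge> 0"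
proof -
  have "0 \<le> (LINT y|lebesgue. g 0 y powr (1 / lam))" by (intro integral_nonneg_AE) auto
  then show ?thesis using g_le[of 0] by linarith
qed

lemma b_nonneg: "b \<ge> 0" using W_bd[of 0 0] R_pos[of 0] by simp

lemma g_le_B: "norm y \<le> R n \<Longrightarrow> g n y \<le> exp (lam * B)"
  using g_eq v_le lam_pos by simp

definition "CI = exp (lam * B) * npow \<mu> + c0 + ntail"

lemma CI_nonneg: "CI \<ge> 0"
  unfolding CI_def using npow_nonneg ntail_nonneg c0_nonneg by simp

text \<open>The margin 1 leaves room for the unit disc about y, on which \<open>riesz_bound\<close>
  requires the pointwise bound of g.\<close>

lemma
  assumes "norm y + 1 \<le> R n"
  shows riesz_int: "integrable lebesgue (\<lambda>z. g n z / norm (y - z) powr \<mu>)"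
    and riesz_le: "riesz_potential \<mu> (g n) y \<le> CI" and riesz_nonneg: "riesz_potential \<mu> (g n) y \<ge> 0"
proof -
  have "g n z \<le> exp (lam * B)" if "norm (y - z) \<le> 1" for z
  proof (rule g_le_B)
    show "norm z \<le> R n" using norm_triangle_ineq4[of y "y - z"] that assms by simp
  qed
  note * = riesz_bound[OF \<mu> lam g_meas g_nonneg g_int g_le this]
  show "integrable lebesgue (\<lambda>z. g n z / norm (y - z) powr \<mu>)"
    "riesz_potential \<mu> (g n) y \<le> CI" "riesz_potential \<mu> (g n) y \<ge> 0"
    using * by (auto simp: CI_def)
qed

definition "CF = b * CI * exp (lam * B)"

lemma CF_nonneg: "CF \<ge> 0" unfolding CF_def using b_nonneg CI_nonneg by simp

lemma F_bounds:
  assumes "norm y + 1 \<le> R n"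
  shows "0 \<le> F n y" "F n y \<le> CF"
proof -
  have y: "norm y \<le> R n" using assms by linarith
  show "0 \<le> F n y"
    unfolding F_eq[OF y] using W_bd[OF y] riesz_nonneg[OF assms] g_nonneg by simp
  show "F n y \<le> CF"
    unfolding F_eq[OF y] CF_def using W_bd[OF y] riesz_nonneg[OF assms] riesz_le[OF assms] g_nonneg g_le_B[OF y] b_nonneg CI_nonneg
    by (intro mult_mono) auto
qed

lemma F_meas_sub:
  assumes "\<rho> \<le> R n" "h \<in> borel_measurable borel" "\<And>y. norm y > \<rho> \<Longrightarrow> h y = 0"
  shows "(\<lambda>y. F n y * h y) \<in> borel_measurable lebesgue"
proof -
  have "(\<lambda>y. F n y * h y) = (\<lambda>y. (indicator (cball 0 (R n)) y * F n y) * h y)"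
    using assms by (auto simp: fun_eq_iff indicator_def)
  then show ?thesis using F_meas[of n] borel_imp_lebesgue[OF assms(2)] by simp
qed

lemma FGam_int:
  assumes "norm x + \<rho> + 1 \<le> R n" "\<rho> > 0"
  shows "integrable lebesgue (\<lambda>y. F n y * Green \<rho> x y)"
proof -
  have "cball x \<rho> \<subseteq> cball 0 (R n)" using assms by (auto simp: cball_subset_cball_iff)
  then show ?thesis using rep_v[of n] S_sub[of n] assms unfolding rep_def by blast
qed

lemma F_le_on_ball: "norm x + \<rho> + 1 \<le> R n \<Longrightarrow> norm (x - y) \<le> \<rho> \<Longrightarrow> 0 \<le> F n y \<and> F n y \<le> CF"
  using F_bounds[of y n] norm_triangle_ineq4[of x "x - y"] by simp

lemma FGam_le:
  assumes "4 * \<rho> + 1 \<le> R n" "\<rho> > 0"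
  shows "(LINT y|lebesgue. F n y * Gam (norm y / (4 * \<rho>))) \<le> CF * (16 * \<rho>\<^sup>2 * Gam_mass)"
proof -
  have "(LINT y|lebesgue. F n y * Green (4 * \<rho>) 0 y) \<le> (LINT y|lebesgue. CF * Gam (norm (0 - y :: real^2) / (4 * \<rho>)))"
  proof (rule integral_mono)
    show "integrable lebesgue (\<lambda>y. F n y * Green (4 * \<rho>) 0 y)"
      using assms by (intro FGam_int) auto
    show "integrable lebesgue (\<lambda>y. CF * Gam (norm (0 - y :: real^2) / (4 * \<rho>)))"
      using assms by (intro integrable_mult_right integrable_Gam) auto
    fix y
    show "F n y * Green (4 * \<rho>) 0 y \<le> CF * Green (4 * \<rho>) 0 y"
    proof (cases "norm y \<le> 4 * \<rho>")
      case True
      then show ?thesis using F_bounds[of y n] assms by (intro mult_right_mono Gam_nonneg) auto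
    next
      case False
      then have "Green (4 * \<rho>) 0 y = 0" using assms by (intro Gam_eq_0) auto
      then show ?thesis by simp
    qed
  qed
  also have "\<dots> = CF * ((4 * \<rho>)\<^sup>2 * Gam_mass)"
    using integral_Gam[of "4 * \<rho>" "0::real^2"] assms by simp
  finally show ?thesis by simp
qed

lemma FGam_diff_le:
  assumes "4 * \<rho> + 1 \<le> R n" "\<rho> > 0" "norm x \<le> \<rho>" "norm x' \<le> \<rho>"
  shows "\<bar>(LINT y|lebesgue. F n y * Green \<rho> x y) - (LINT y|lebesgue. F n y * Green \<rho> x' y)\<bar>
    \<le> CF * (2 * theta * norm (x - x') * (6 * \<rho> * npow 1))"
proof -
  have i: "integrable lebesgue (\<lambda>y. F n y * Green \<rho> x y)" "integrable lebesgue (\<lambda>y. F n y * Green \<rho> x' y)"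
    using assms by (auto intro!: FGam_int)
  \<comment> \<open>A point within \<rho> of one centre is within 3 \<rho> of the other, as the
    centres are at most 2 \<rho> apart. Where it is far from both, both kernels vanish.\<close>
  let ?D = "\<lambda>y. indicator (cball x (3 * \<rho>)) y * norm (x - y) powr (-1) + indicator (cball x' (3 * \<rho>)) y * norm (x' - y) powr (-1)"
  have Di: "integrable lebesgue ?D"
    using assms by (intro Bochner_Integration.integrable_add near_power) auto
  have "\<bar>(LINT y|lebesgue. F n y * Green \<rho> x y) - (LINT y|lebesgue. F n y * Green \<rho> x' y)\<bar>
      = \<bar>LINT y|lebesgue. F n y * Green \<rho> x y - F n y * Green \<rho> x' y\<bar>"
    using i by simp
  also have "\<dots> \<le> (LINT y|lebesgue. \<bar>F n y * Green \<rho> x y - F n y * Green \<rho> x' y\<bar>)"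
    by (rule integral_abs_bound)
  also have "\<dots> \<le> (LINT y|lebesgue. CF * (2 * theta * norm (x - x')) * ?D y)"
  proof (rule integral_mono_AE)
    show "integrable lebesgue (\<lambda>y. \<bar>F n y * Green \<rho> x y - F n y * Green \<rho> x' y\<bar>)"
      using i by (intro integrable_abs Bochner_Integration.integrable_diff)
    show "integrable lebesgue (\<lambda>y. CF * (2 * theta * norm (x - x')) * ?D y)"
      by (rule integrable_mult_right[OF Di])
    show "AE y in lebesgue. \<bar>F n y * Green \<rho> x y - F n y * Green \<rho> x' y\<bar> \<le> CF * (2 * theta * norm (x - x')) * ?D y"
      using AE_lebesgue_neq[of x] AE_lebesgue_neq[of x']
    proof eventually_elim
      case (elim y)
      show ?case
      proof (cases "norm (x - y) \<le> \<rho> \<or> norm (x' - y) \<le> \<rho>")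
        case True
        have xx: "norm (x - x') \<le> 2 * \<rho>" using norm_triangle_ineq4[of x x'] assms by simp
        have n3: "norm (x - y) \<le> 3 * \<rho>" "norm (x' - y) \<le> 3 * \<rho>"
          using True xx norm_triangle_ineq[of "x - x'" "x' - y"] norm_triangle_ineq[of "x' - x" "x - y"] assms
          by (auto simp: norm_minus_commute)
        have Fb: "0 \<le> F n y" "F n y \<le> CF"
          using True F_le_on_ball[of x \<rho> n y] F_le_on_ball[of x' \<rho> n y] assms by auto
        have "\<bar>F n y * Green \<rho> x y - F n y * Green \<rho> x' y\<bar> = F n y * \<bar>Green \<rho> x y - Green \<rho> x' y\<bar>"
          using Fb by (simp add: abs_mult flip: right_diff_distrib)
        also have "\<dots> \<le> CF * (2 * theta * norm (x - x') * (norm (x - y) powr (-1) + norm (x' - y) powr (-1)))"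
          using Fb elim assms by (intro mult_mono Gam_norm_diff_bound) auto
        also have "norm (x - y) powr (-1) + norm (x' - y) powr (-1) = ?D y"
          using n3 by (simp add: dist_norm)
        finally show ?thesis by (simp only: mult.assoc)
      next
        case False
        then have "Green \<rho> x y = 0" "Green \<rho> x' y = 0"
          using assms by (auto intro!: Gam_eq_0)
        moreover have "0 \<le> CF * (2 * theta * norm (x - x')) * ?D y"
          using CF_nonneg theta_pos by (intro mult_nonneg_nonneg add_nonneg_nonneg) auto
        ultimately show ?thesis by (simp only: mult_zero_right diff_self abs_zero)
      qed
    qed
  qed
  also have "\<dots> = CF * (2 * theta * norm (x - x')) * (LINT y|lebesgue. ?D y)" by (rule integral_mult_right_zero)
  also have "(LINT y|lebesgue. ?D y) = 3 * \<rho> * npow 1 + 3 * \<rho> * npow 1"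
    using near_power[of 1 "3 * \<rho>" x] near_power[of 1 "3 * \<rho>" x'] assms
    by (subst Bochner_Integration.integral_add) auto
  finally show ?thesis by (simp add: ac_simps)
qed

definition "Lip = (12 * CF * theta * npow 1 + 16 * osc * (4 * eta_mass * B + CF * (16 * Gam_mass))) / (4 * eta_mass)"

lemma Lip_nonneg: "Lip \<ge> 0"
  unfolding Lip_def using CF_nonneg theta_pos npow_nonneg osc_nonneg eta_mass_pos B_nonneg Gam_mass_nonneg
  by (intro divide_nonneg_pos add_nonneg_nonneg mult_nonneg_nonneg) auto

text \<open>\<open>rep_difference\<close> with v n 0 = 0 and the uniform bound \<open>CF\<close> of
  F. The constant is independent of n, which is the equicontinuity behind the compactness.\<close>

lemma v_Lipschitz:
  assumes r: "4 * \<rho> + 1 \<le> R n" "1 \<le> \<rho>" and x: "norm x \<le> \<rho>" "norm x' \<le> \<rho>"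
  shows "\<bar>v n x - v n x'\<bar> \<le> Lip * \<rho> * norm (x - x')"
proof -
  let ?G = "(LINT y|lebesgue. F n y * Green \<rho> x y) - (LINT y|lebesgue. F n y * Green \<rho> x' y)"
  have sub: "cball 0 (4 * \<rho>) \<subseteq> cball 0 (R n)" using r by (auto simp: cball_subset_cball_iff)
  have "\<bar>4 * eta_mass * (v n x - v n x') - ?G\<bar> \<le> 16 * osc * norm (x - x') / \<rho> * (4 * eta_mass * (B - v n 0) + (LINT y|lebesgue. F n y * Gam (norm y / (4 * \<rho>))))"
    using r x sub S_sub[of n] by (intro rep_difference[OF rep_v]) (auto intro: v_le continuous_on_subset[OF v_cont])
  also have "\<dots> \<le> 16 * osc * norm (x - x') / \<rho> * (4 * eta_mass * B + CF * (16 * \<rho>\<^sup>2 * Gam_mass))"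
    using r osc_nonneg FGam_le[of \<rho> n] v_0 eta_mass_pos by (intro mult_left_mono add_mono) auto
  also have "\<dots> \<le> 16 * osc * norm (x - x') / \<rho> * (\<rho>\<^sup>2 * (4 * eta_mass * B + CF * (16 * Gam_mass)))"
  proof (rule mult_left_mono)
    have "1 * (4 * eta_mass * B) \<le> \<rho>\<^sup>2 * (4 * eta_mass * B)"
      using r one_le_power[of \<rho> 2] B_nonneg eta_mass_pos by (intro mult_right_mono) auto
    then show "4 * eta_mass * B + CF * (16 * \<rho>\<^sup>2 * Gam_mass) \<le> \<rho>\<^sup>2 * (4 * eta_mass * B + CF * (16 * Gam_mass))"
      by (simp add: algebra_simps)
  qed (use r osc_nonneg in auto)
  also have "\<dots> = \<rho> * norm (x - x') * (16 * osc * (4 * eta_mass * B + CF * (16 * Gam_mass)))"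
    using r by (simp add: power2_eq_square)
  finally have 1: "\<bar>4 * eta_mass * (v n x - v n x') - ?G\<bar> \<le> \<rho> * norm (x - x') * (16 * osc * (4 * eta_mass * B + CF * (16 * Gam_mass)))" .
  have "\<bar>?G\<bar> \<le> CF * (2 * theta * norm (x - x') * (6 * \<rho> * npow 1))"
    using r x by (intro FGam_diff_le) auto
  then have "\<bar>?G\<bar> \<le> \<rho> * norm (x - x') * (12 * CF * theta * npow 1)" by (simp add: ac_simps)
  with 1 have "\<bar>4 * eta_mass * (v n x - v n x')\<bar> \<le> \<rho> * norm (x - x') * (16 * osc * (4 * eta_mass * B + CF * (16 * Gam_mass))) + \<rho> * norm (x - x') * (12 * CF * theta * npow 1)"
    by linarith
  also have "\<dots> = 4 * eta_mass * (Lip * \<rho> * norm (x - x'))"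
    unfolding Lip_def using eta_mass_pos by (simp add: field_simps)
  finally have "4 * eta_mass * \<bar>v n x - v n x'\<bar> \<le> 4 * eta_mass * (Lip * \<rho> * norm (x - x'))"
    using eta_mass_pos by (simp add: abs_mult)
  then show ?thesis using eta_mass_pos by simp
qed

end

text \<open>The bounds on the n-th function hold only once the disc of radius \<open>R n\<close> is
  large enough.\<close>

lemma integral_dominated_convergence_eventually:
  fixes f :: "nat \<Rightarrow> 'a \<Rightarrow> real"
  assumes w: "integrable M w" and fl: "fl \<in> borel_measurable M"
    and ev: "\<forall>\<^sub>F n in sequentially. f n \<in> borel_measurable M \<and> (\<forall>x. \<bar>f n x\<bar> \<le> w x)"
    and lim: "AE x in M. (\<lambda>n. f n x) \<longlonglongrightarrow> fl x"
  shows "integrable M fl" "(\<lambda>n. integral\<^sup>L M (f n)) \<longlonglongrightarrow> integral\<^sup>L M fl"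
proof -
  obtain N where N: "\<And>n. n \<ge> N \<Longrightarrow> f n \<in> borel_measurable M \<and> (\<forall>x. \<bar>f n x\<bar> \<le> w x)"
    using ev unfolding eventually_sequentially by blast
  have l: "AE x in M. (\<lambda>n. f (n + N) x) \<longlonglongrightarrow> fl x"
    using lim by eventually_elim (rule LIMSEQ_ignore_initial_segment)
  have m: "f (n + N) \<in> borel_measurable M" for n using N[of "n + N"] by simp
  have b: "AE x in M. norm (f (n + N) x) \<le> w x" for n using N[of "n + N"] by simp
  show "integrable M fl" by (rule integrable_dominated_convergence[OF fl m w l b])
  have "(\<lambda>n. integral\<^sup>L M (f (n + N))) \<longlonglongrightarrow> integral\<^sup>L M fl"
    by (rule integral_dominated_convergence[OF fl m w l b])
  then show "(\<lambda>n. integral\<^sup>L M (f n)) \<longlonglongrightarrow> integral\<^sup>L M fl" by (rule LIMSEQ_offset)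
qed

lemma integrable_if_cball_bounded:
  fixes h :: "real^2 \<Rightarrow> real"
  assumes h: "h \<in> borel_measurable lebesgue" "\<And>y. h y \<ge> 0"
    and i: "\<And>m::nat. integrable lebesgue (\<lambda>y. indicator (cball 0 (real m)) y * h y)"
    and le: "\<And>m::nat. (LINT y|lebesgue. indicator (cball 0 (real m)) y * h y) \<le> K"
  shows "integrable lebesgue h" "(LINT y|lebesgue. h y) \<le> K"
proof -
  define X where "X m = (LINT y|lebesgue. indicator (cball 0 (real m)) y * h y)" for m :: nat
  have mono: "incseq X"
    unfolding X_def incseq_def
    by (intro allI impI integral_mono[OF i i]) (use h(2) in \<open>auto simp: indicator_def\<close>)
  obtain L where L: "X \<longlonglongrightarrow> L" "\<And>m. X m \<le> L"
    using incseq_convergent[OF mono] le unfolding X_def by blast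
  have "L \<le> K" using L(1) by (rule LIMSEQ_le_const2) (use le in \<open>auto simp: X_def\<close>)
  have hb: "has_bochner_integral lebesgue h L"
  proof (rule has_bochner_integral_monotone_convergence[OF i])
    show "AE y in lebesgue. mono (\<lambda>m. indicator (cball 0 (real m)) y * h y)"
      using h(2) by (intro AE_I2) (auto simp: mono_def indicator_def)
    show "AE y in lebesgue. (\<lambda>m. indicator (cball 0 (real m)) y * h y) \<longlonglongrightarrow> h y"
    proof (rule AE_I2)
      fix y :: "real^2"
      obtain N :: nat where N: "norm y \<le> real N" using real_arch_simple by blast
      have "\<forall>\<^sub>F m in sequentially. h y = indicator (cball 0 (real m)) y * h y"
        using eventually_ge_at_top[of N] by eventually_elim (use N in \<open>auto simp: indicator_def\<close>)
      then show "(\<lambda>m. indicator (cball 0 (real m)) y * h y) \<longlonglongrightarrow> h y"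
        by (rule Lim_transform_eventually[OF tendsto_const])
    qed
    show "(\<lambda>m. LINT y|lebesgue. indicator (cball 0 (real m)) y * h y) \<longlonglongrightarrow> L"
      using L(1) unfolding X_def .
  qed (rule h(1))
  then show "integrable lebesgue h" "(LINT y|lebesgue. h y) \<le> K"
    using \<open>L \<le> K\<close> by (auto simp: has_bochner_integral_iff)
qed

context blow_up
begin

lemma R_eventually: "\<forall>\<^sub>F n in sequentially. c \<le> R n"
  using R_lim unfolding filterlim_at_top by blast

lemma subsequence:
  assumes k: "strict_mono k"
  shows "blow_up \<mu> lam b c0 B W0 (\<lambda>n. v (k n)) (\<lambda>n. g (k n)) (\<lambda>n. Wt (k n)) (\<lambda>n. F (k n)) (\<lambda>n. S (k n)) (\<lambda>n. R (k n))"
proof (unfold_locales)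
  show "filterlim (\<lambda>n. R (k n)) at_top sequentially"
    by (rule filterlim_compose[OF R_lim filterlim_subseq[OF k]])
  show "(\<lambda>n. Wt (k n) y) \<longlonglongrightarrow> W0" for y
    using LIMSEQ_subseq_LIMSEQ[OF W_lim k] by (simp add: o_def)
qed (use \<mu> lam W0 R_pos v_cont v_0 v_le g_meas g_nonneg g_int g_le g_eq F_eq F_meas rep_v S_sub W_bd in auto)

text \<open>A subsequence converges on a countable dense set, and the Lipschitz bound carries the
  Cauchy property over to every point.\<close>

lemma convergent_subsequence:
  obtains k where "strict_mono k" "\<And>x. convergent (\<lambda>n. v (k n) x)"
proof -
  define m :: "real^2 \<Rightarrow> real" where "m x = max 1 (norm x)" for x
  define M :: "real^2 \<Rightarrow> real" where "M x = Lip * m x * norm x + 1" for x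
  have m: "m x \<ge> 1" "norm x \<le> m x" for x by (auto simp: m_def)
  have M: "M x > 0" for x
    unfolding M_def using Lip_nonneg m(1)[of x] by (intro add_nonneg_pos mult_nonneg_nonneg) auto
  \<comment> \<open>Division by M x makes all values bounded by 1. The default 0 applies while the
    disc is too small for the Lipschitz bound at x, hence to finitely many n.\<close>
  define f where "f n x = (if 4 * m x + 1 \<le> R n then v n x / M x else 0)" for n x
  have fb: "norm (f n x) \<le> 1" for n x
  proof (cases "4 * m x + 1 \<le> R n")
    case True
    have "\<bar>v n x\<bar> \<le> Lip * m x * norm x"
      using v_Lipschitz[OF True m(1) m(2), of 0] m(1)[of x] v_0[of n] by simp
    then have "\<bar>v n x\<bar> \<le> M x" by (simp add: M_def)
    then show ?thesis using True M[of x] by (simp add: f_def)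
  qed (simp add: f_def)
  obtain D :: "(real^2) set" where D: "countable D" "\<And>X. open X \<Longrightarrow> X \<noteq> {} \<Longrightarrow> \<exists>d\<in>D. d \<in> X"
    using countable_dense_setE by blast
  obtain k :: "nat \<Rightarrow> nat" where k: "strict_mono k" "\<And>x. x \<in> D \<Longrightarrow> \<exists>l. (\<lambda>n. f (k n) x) \<longlonglongrightarrow> l"
    using function_convergent_subsequence[OF D(1), of f 1] fb by metis
  have Rk: "\<forall>\<^sub>F n in sequentially. c \<le> R (k n)" for c
    using filterlim_compose[OF R_lim filterlim_subseq[OF k(1)]] unfolding filterlim_at_top by blast
  have cD: "Cauchy (\<lambda>n. v (k n) x)" if x: "x \<in> D" for x
  proof -
    obtain l where l: "(\<lambda>n. f (k n) x) \<longlonglongrightarrow> l" using k(2)[OF x] by blast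
    have "(\<lambda>n. M x * f (k n) x) \<longlonglongrightarrow> M x * l" by (intro tendsto_intros l)
    moreover have "\<forall>\<^sub>F n in sequentially. M x * f (k n) x = v (k n) x"
      using Rk[of "4 * m x + 1"] by eventually_elim (use M[of x] in \<open>simp add: f_def\<close>)
    ultimately have "(\<lambda>n. v (k n) x) \<longlonglongrightarrow> M x * l" by (rule Lim_transform_eventually)
    then show ?thesis by (rule LIMSEQ_imp_Cauchy)
  qed
  have "Cauchy (\<lambda>n. v (k n) x)" for x
  proof (rule metric_CauchyI)
    fix e :: real assume e: "e > 0"
    define \<rho> where "\<rho> = m x + 1"
    have \<rho>: "\<rho> \<ge> 1" "norm x \<le> \<rho>" using m[of x] by (auto simp: \<rho>_def)
    define d where "d = min 1 (e / (3 * (Lip * \<rho> + 1)))"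
    have L\<rho>: "0 \<le> Lip * \<rho>" using Lip_nonneg \<rho> by simp
    have d: "d > 0" using e L\<rho> by (simp add: d_def)
    obtain q where q: "q \<in> D" "q \<in> ball x d" using D(2)[of "ball x d"] d by auto
    have nq: "norm (x - q) < d" using q(2) by (simp add: dist_norm)
    have "norm q \<le> \<rho>" using norm_triangle_ineq4[of x "x - q"] nq m[of x] by (simp add: \<rho>_def d_def)
    have s: "Lip * \<rho> * norm (x - q) < e / 3"
    proof -
      have "norm (x - q) < e / (3 * (Lip * \<rho> + 1))" using nq by (simp add: d_def)
      then have "(Lip * \<rho> + 1) * norm (x - q) < e / 3" using L\<rho> by (simp add: field_simps)
      then show ?thesis by (smt (verit) norm_ge_zero mult_right_mono)
    qed
    obtain N1 where N1: "\<And>n. n \<ge> N1 \<Longrightarrow> 4 * \<rho> + 1 \<le> R (k n)"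
      using Rk[of "4 * \<rho> + 1"] unfolding eventually_sequentially by blast
    obtain N2 where N2: "\<And>i j. i \<ge> N2 \<Longrightarrow> j \<ge> N2 \<Longrightarrow> dist (v (k i) q) (v (k j) q) < e / 3"
      using metric_CauchyD[OF cD[OF q(1)], of "e / 3"] e by auto
    show "\<exists>N. \<forall>i\<ge>N. \<forall>j\<ge>N. dist (v (k i) x) (v (k j) x) < e"
    proof (intro exI allI impI)
      fix i j assume ij: "max N1 N2 \<le> i" "max N1 N2 \<le> j"
      have "\<bar>v (k i) x - v (k i) q\<bar> < e / 3" "\<bar>v (k j) x - v (k j) q\<bar> < e / 3"
        using v_Lipschitz[OF N1 \<rho>(1) \<rho>(2) \<open>norm q \<le> \<rho>\<close>, of i] v_Lipschitz[OF N1 \<rho>(1) \<rho>(2) \<open>norm q \<le> \<rho>\<close>, of j] s ij by auto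
      moreover have "\<bar>v (k i) q - v (k j) q\<bar> < e / 3" using N2[of i j] ij by (simp add: dist_norm)
      ultimately show "dist (v (k i) x) (v (k j) x) < e" unfolding dist_norm real_norm_def by linarith
    qed
  qed
  then have "convergent (\<lambda>n. v (k n) x)" for x by (simp add: Cauchy_convergent_iff)
  then show ?thesis using that k(1) by blast
qed

text \<open>\<delta> is fixed by \<epsilon> and c0, then T by \<delta>. As T depends neither on the
  function nor on the centre, it serves the whole sequence and its limit.\<close>

lemma riesz_tail_small:
  assumes "\<epsilon> > 0"
  obtains T where "T > 0" "\<And>(h :: real^2 \<Rightarrow> real) y. h \<in> borel_measurable lebesgue \<Longrightarrow> (\<And>z. h z \<ge> 0) \<Longrightarrow>
    integrable lebesgue (\<lambda>z. h z powr (1 / lam)) \<Longrightarrow> (LINT z|lebesgue. h z powr (1 / lam)) \<le> c0 \<Longrightarrow>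
    integrable lebesgue (\<lambda>z. indicator (- cball y T) z * (h z / norm (y - z) powr \<mu>)) \<and>
    0 \<le> (LINT z|lebesgue. indicator (- cball y T) z * (h z / norm (y - z) powr \<mu>)) \<and>
    (LINT z|lebesgue. indicator (- cball y T) z * (h z / norm (y - z) powr \<mu>)) \<le> \<epsilon>"
proof -
  \<comment> \<open>Makes \<delta>^(1 / lam) c0 at most \<epsilon> / 2; the summand 1 keeps the
    denominator positive when c0 = 0.\<close>
  define \<delta> where "\<delta> = (\<epsilon> / (2 * (c0 + 1))) powr lam"
  have \<delta>: "\<delta> > 0" using assms c0_nonneg by (simp add: \<delta>_def)
  have \<delta>p: "\<delta> powr (1 / lam) = \<epsilon> / (2 * (c0 + 1))"
    using assms c0_nonneg lam_pos by (simp add: \<delta>_def powr_powr)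
  have 1: "\<delta> powr (1 / lam) * c0 \<le> \<epsilon> / 2"
    unfolding \<delta>p using assms c0_nonneg by (simp add: field_simps)
  define T where "T = sqrt (2 * \<delta> powr (- 4 / \<mu>) * (ntail + 1) / \<epsilon>)"
  have T2: "T\<^sup>2 = 2 * \<delta> powr (- 4 / \<mu>) * (ntail + 1) / \<epsilon>"
    unfolding T_def using \<delta> assms ntail_nonneg by simp
  have T: "T > 0" unfolding T_def using \<delta> assms ntail_nonneg by (intro real_sqrt_gt_zero) auto
  have p: "\<delta> powr (- 4 / \<mu>) > 0" using \<delta> by simp
  have 2: "\<delta> powr (- 4 / \<mu>) * ntail / T\<^sup>2 \<le> \<epsilon> / 2"
  proof -
    have "\<delta> powr (- 4 / \<mu>) * ntail \<le> \<delta> powr (- 4 / \<mu>) * (ntail + 1)" using p by simp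
    also have "\<dots> = \<epsilon> / 2 * T\<^sup>2" unfolding T2 using assms by simp
    finally show ?thesis using T by (simp add: divide_le_eq)
  qed
  have main: "integrable lebesgue (\<lambda>z. indicator (- cball y T) z * (h z / norm (y - z) powr \<mu>)) \<and>
    0 \<le> (LINT z|lebesgue. indicator (- cball y T) z * (h z / norm (y - z) powr \<mu>)) \<and>
    (LINT z|lebesgue. indicator (- cball y T) z * (h z / norm (y - z) powr \<mu>)) \<le> \<epsilon>"
    if h: "h \<in> borel_measurable lebesgue" "\<And>z. h z \<ge> 0" "integrable lebesgue (\<lambda>z. h z powr (1 / lam))"
      "(LINT z|lebesgue. h z powr (1 / lam)) \<le> c0" for h :: "real^2 \<Rightarrow> real" and y
  proof (intro conjI)
    note * = riesz_tail[OF \<mu> lam h T \<delta>, of y]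
    show "integrable lebesgue (\<lambda>z. indicator (- cball y T) z * (h z / norm (y - z) powr \<mu>))" by (rule *(1))
    show "0 \<le> (LINT z|lebesgue. indicator (- cball y T) z * (h z / norm (y - z) powr \<mu>))"
      using h(2) by (intro integral_nonneg_AE) auto
    show "(LINT z|lebesgue. indicator (- cball y T) z * (h z / norm (y - z) powr \<mu>)) \<le> \<epsilon>"
      using *(2) 1 2 by linarith
  qed
  show ?thesis by (rule that[OF T main])
qed

end

locale blow_up_limit = blow_up +
  fixes vl :: "real^2 \<Rightarrow> real"
  assumes v_lim: "\<And>x. (\<lambda>n. v n x) \<longlonglongrightarrow> vl x"
begin

definition "gl x = exp (lam * vl x)"
definition "Fl x = W0 * riesz_potential \<mu> gl x * gl x"

lemma vl_Lipschitz:
  assumes "1 \<le> \<rho>" "norm x \<le> \<rho>" "norm x' \<le> \<rho>"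
  shows "\<bar>vl x - vl x'\<bar> \<le> Lip * \<rho> * norm (x - x')"
proof (rule tendsto_upperbound)
  show "(\<lambda>n. \<bar>v n x - v n x'\<bar>) \<longlonglongrightarrow> \<bar>vl x - vl x'\<bar>" by (intro tendsto_intros v_lim)
  show "\<forall>\<^sub>F n in sequentially. \<bar>v n x - v n x'\<bar> \<le> Lip * \<rho> * norm (x - x')"
    using R_eventually[of "4 * \<rho> + 1"] by eventually_elim (rule v_Lipschitz[OF _ assms])
qed simp

lemma vl_cont: "continuous_on UNIV vl"
proof -
  have "isCont vl x" for x
  proof -
    have "(Lip * (norm x + 1))-lipschitz_on (ball 0 (norm x + 1)) vl"
      by (rule lipschitz_onI) (use vl_Lipschitz Lip_nonneg in \<open>auto simp: dist_norm intro!: mult_nonneg_nonneg\<close>)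
    then have "continuous_on (ball 0 (norm x + 1)) vl" by (rule lipschitz_on_continuous_on)
    then show ?thesis by (auto simp: continuous_on_eq_continuous_at)
  qed
  then show ?thesis by (auto intro: continuous_at_imp_continuous_on)
qed

lemma vl_le: "vl y \<le> B"
proof (rule tendsto_upperbound[OF v_lim])
  show "\<forall>\<^sub>F n in sequentially. v n y \<le> B"
    using R_eventually[of "norm y"] by eventually_elim (rule v_le)
qed simp

lemma vl_meas[measurable]: "vl \<in> borel_measurable borel"
  by (rule borel_measurable_continuous_onI[OF vl_cont])

lemma gl_meas[measurable]: "gl \<in> borel_measurable borel"
  unfolding gl_def[abs_def] by measurable

lemma gl_nonneg: "gl y \<ge> 0" by (simp add: gl_def)

lemma gl_le: "gl y \<le> exp (lam * B)" using vl_le lam_pos by (simp add: gl_def)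

lemma gl_powr: "gl y powr (1 / lam) = exp (vl y)"
  using lam_pos by (simp add: gl_def powr_def)

lemma g_lim: "(\<lambda>n. g n y) \<longlonglongrightarrow> gl y"
proof -
  have "(\<lambda>n. exp (lam * v n y)) \<longlonglongrightarrow> gl y" unfolding gl_def by (intro tendsto_intros v_lim)
  moreover have "\<forall>\<^sub>F n in sequentially. exp (lam * v n y) = g n y"
    using R_eventually[of "norm y"] by eventually_elim (simp add: g_eq)
  ultimately show ?thesis by (rule Lim_transform_eventually)
qed

lemma cball_indicator_int: "integrable lebesgue (\<lambda>y. indicator (cball x \<rho>) y * (c :: real))" for x :: "real^2"
  by (rule integrable_lebesgue_compact) auto

text \<open>Dominated convergence applies on each disc and the bound c0 passes to the limit there;
  exhausting the plane preserves it, although mass may escape to infinity.\<close>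

lemma exp_vl_int: "integrable lebesgue (\<lambda>y. exp (vl y))"
  and exp_vl_le: "(LINT y|lebesgue. exp (vl y)) \<le> c0"
proof -
  have m: "(\<lambda>y. exp (vl y)) \<in> borel_measurable lebesgue" by (rule borel_imp_lebesgue) measurable
  have *: "integrable lebesgue (\<lambda>y. indicator (cball 0 (real m)) y * exp (vl y)) \<and>
      (LINT y|lebesgue. indicator (cball 0 (real m)) y * exp (vl y)) \<le> c0" for m :: nat
  proof -
    have gm: "(\<lambda>y. indicator (cball 0 (real m)) y * g n y powr (1 / lam)) \<in> borel_measurable lebesgue" for n
      by (intro borel_measurable_times borel_measurable_integrable[OF g_int] borel_imp_lebesgue) measurable
    have ev: "\<forall>\<^sub>F n in sequentially. (\<lambda>y. indicator (cball 0 (real m)) y * g n y powr (1 / lam)) \<in> borel_measurable lebesgue \<and>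
        (\<forall>y. \<bar>indicator (cball 0 (real m)) y * g n y powr (1 / lam)\<bar> \<le> indicator (cball 0 (real m)) y * exp B)"
      using R_eventually[of "real m"]
    proof eventually_elim
      case (elim n)
      have "g n y powr (1 / lam) \<le> exp B" if "norm y \<le> real m" for y
        using g_eq[of y n] v_le[of y n] that elim lam_pos by (simp add: powr_def)
      then show ?case using gm by (auto simp: indicator_def)
    qed
    have lim: "AE y in lebesgue. (\<lambda>n. indicator (cball 0 (real m)) y * g n y powr (1 / lam)) \<longlonglongrightarrow> indicator (cball 0 (real m)) y * exp (vl y)"
      unfolding gl_powr[symmetric]
      by (intro AE_I2 tendsto_intros g_lim) (simp add: gl_def)
    have m': "(\<lambda>y. indicator (cball 0 (real m)) y * exp (vl y)) \<in> borel_measurable lebesgue"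
      by (rule borel_imp_lebesgue) measurable
    note D = integral_dominated_convergence_eventually[OF cball_indicator_int m' ev lim]
    have "(LINT y|lebesgue. indicator (cball 0 (real m)) y * exp (vl y)) \<le> c0"
    proof (rule LIMSEQ_le_const2[OF D(2)], intro exI allI impI)
      fix n
      have "(LINT y|lebesgue. indicator (cball 0 (real m)) y * g n y powr (1 / lam)) \<le> (LINT y|lebesgue. g n y powr (1 / lam))"
      proof (rule integral_mono[OF _ g_int])
        show "integrable lebesgue (\<lambda>y. indicator (cball 0 (real m)) y * g n y powr (1 / lam))"
          by (rule Bochner_Integration.integrable_bound[OF g_int[of n] gm]) (auto simp: indicator_def)
      qed (auto simp: indicator_def)
      then show "(LINT y|lebesgue. indicator (cball 0 (real m)) y * g n y powr (1 / lam)) \<le> c0" using g_le[of n] by linarith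
    qed
    with D(1) show ?thesis by blast
  qed
  show "integrable lebesgue (\<lambda>y. exp (vl y))" "(LINT y|lebesgue. exp (vl y)) \<le> c0"
    using integrable_if_cball_bounded[OF m _ _ , of c0] * by auto
qed

lemma riesz_gl_int: "integrable lebesgue (\<lambda>z. gl z / norm (y - z) powr \<mu>)"
proof (rule riesz_bound(1)[OF \<mu> lam _ gl_nonneg])
  show "gl \<in> borel_measurable lebesgue" by (rule borel_imp_lebesgue) measurable
  show "integrable lebesgue (\<lambda>y. gl y powr (1 / lam))" unfolding gl_powr by (rule exp_vl_int)
  show "(LINT y|lebesgue. gl y powr (1 / lam)) \<le> c0" unfolding gl_powr by (rule exp_vl_le)
  show "gl z \<le> exp (lam * B)" for z by (rule gl_le)
qed

text \<open>The near part converges by dominated convergence. The far parts are nonnegative and at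
  most e / 3, for every n and for the limit, so their convergence need not be examined.\<close>

lemma riesz_lim: "(\<lambda>n. riesz_potential \<mu> (g n) y) \<longlonglongrightarrow> riesz_potential \<mu> gl y"
proof (rule LIMSEQ_I)
  fix e :: real assume e: "e > 0"
  obtain T where T: "T > 0" "\<And>(h :: real^2 \<Rightarrow> real) y. h \<in> borel_measurable lebesgue \<Longrightarrow> (\<And>z. h z \<ge> 0) \<Longrightarrow>
    integrable lebesgue (\<lambda>z. h z powr (1 / lam)) \<Longrightarrow> (LINT z|lebesgue. h z powr (1 / lam)) \<le> c0 \<Longrightarrow>
    integrable lebesgue (\<lambda>z. indicator (- cball y T) z * (h z / norm (y - z) powr \<mu>)) \<and>
    0 \<le> (LINT z|lebesgue. indicator (- cball y T) z * (h z / norm (y - z) powr \<mu>)) \<and>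
    (LINT z|lebesgue. indicator (- cball y T) z * (h z / norm (y - z) powr \<mu>)) \<le> e / 3"
    using riesz_tail_small[of "e / 3"] e by auto
  define near where "near h = (LINT z|lebesgue. indicator (cball y T) z * (h z / norm (y - z) powr \<mu>))" for h
  define far where "far h = (LINT z|lebesgue. indicator (- cball y T) z * (h z / norm (y - z) powr \<mu>))" for h
  have glm: "gl \<in> borel_measurable lebesgue" by (rule borel_imp_lebesgue) measurable
  have split: "riesz_potential \<mu> h y = near h + far h"
    if h: "h \<in> borel_measurable lebesgue" "integrable lebesgue (\<lambda>z. h z / norm (y - z) powr \<mu>)" for h
  proof -
    have i: "integrable lebesgue (\<lambda>z. indicator A z * (h z / norm (y - z) powr \<mu>))" if "A \<in> sets borel" for A
    proof (rule Bochner_Integration.integrable_bound[OF h(2)])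
      show "(\<lambda>z. indicator A z * (h z / norm (y - z) powr \<mu>)) \<in> borel_measurable lebesgue"
        using that by (intro borel_measurable_times borel_measurable_integrable[OF h(2)] borel_imp_lebesgue borel_measurable_indicator) auto
    qed (auto simp: indicator_def)
    have "riesz_potential \<mu> h y = (LINT z|lebesgue. indicator (cball y T) z * (h z / norm (y - z) powr \<mu>) + indicator (- cball y T) z * (h z / norm (y - z) powr \<mu>))"
      unfolding riesz_potential_def by (intro Bochner_Integration.integral_cong refl) (auto simp: indicator_def)
    also have "\<dots> = near h + far h" unfolding near_def far_def by (intro Bochner_Integration.integral_add i) auto
    finally show ?thesis .
  qed
  have far_n: "0 \<le> far (g n)" "far (g n) \<le> e / 3" for n
    using T(2)[OF g_meas g_nonneg g_int g_le] unfolding far_def by auto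
  have far_l: "0 \<le> far gl" "far gl \<le> e / 3"
    using T(2)[OF glm gl_nonneg] exp_vl_int exp_vl_le unfolding far_def gl_powr by auto
  have "(\<lambda>n. near (g n)) \<longlonglongrightarrow> near gl"
    unfolding near_def
  proof (rule integral_dominated_convergence_eventually(2)[where w="\<lambda>z. exp (lam * B) * (indicator (cball y T) z * norm (y - z) powr (-\<mu>))"])
    show "integrable lebesgue (\<lambda>z. exp (lam * B) * (indicator (cball y T) z * norm (y - z) powr (-\<mu>)))"
      using \<mu> T(1) by (intro integrable_mult_right near_power) auto
    show "(\<lambda>z. indicator (cball y T) z * (gl z / norm (y - z) powr \<mu>)) \<in> borel_measurable lebesgue"
      by (rule borel_imp_lebesgue) measurable
    show "AE z in lebesgue. (\<lambda>n. indicator (cball y T) z * (g n z / norm (y - z) powr \<mu>)) \<longlonglongrightarrow> indicator (cball y T) z * (gl z / norm (y - z) powr \<mu>)"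
      using AE_lebesgue_neq[of y] by eventually_elim (intro tendsto_intros g_lim, simp)
    show "\<forall>\<^sub>F n in sequentially. (\<lambda>z. indicator (cball y T) z * (g n z / norm (y - z) powr \<mu>)) \<in> borel_measurable lebesgue \<and>
        (\<forall>z. \<bar>indicator (cball y T) z * (g n z / norm (y - z) powr \<mu>)\<bar> \<le> exp (lam * B) * (indicator (cball y T) z * norm (y - z) powr (-\<mu>)))"
      using R_eventually[of "norm y + T"]
    proof eventually_elim
      case (elim n)
      have "(\<lambda>z. indicator (cball y T) z * (g n z / norm (y - z) powr \<mu>)) \<in> borel_measurable lebesgue"
        by (intro borel_measurable_times borel_measurable_divide g_meas; rule borel_imp_lebesgue, measurable)
      moreover have "\<bar>indicator (cball y T) z * (g n z / norm (y - z) powr \<mu>)\<bar> \<le> exp (lam * B) * (indicator (cball y T) z * norm (y - z) powr (-\<mu>))" for z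
      proof (cases "norm (y - z) \<le> T")
        case True
        then have "norm z \<le> R n" using norm_triangle_ineq4[of y "y - z"] elim by simp
        then have "g n z \<le> exp (lam * B)" by (rule g_le_B)
        then show ?thesis using True g_nonneg[of n z] by (simp add: dist_norm powr_minus divide_inverse mult_right_mono)
      qed (simp add: dist_norm)
      ultimately show ?case by blast
    qed
  qed
  then have "\<forall>\<^sub>F n in sequentially. dist (near (g n)) (near gl) < e / 3"
    using e by (intro tendstoD) auto
  then have "\<forall>\<^sub>F n in sequentially. norm (riesz_potential \<mu> (g n) y - riesz_potential \<mu> gl y) < e"
    using R_eventually[of "norm y + 1"]
  proof eventually_elim
    case (elim n)
    have "riesz_potential \<mu> (g n) y = near (g n) + far (g n)" by (rule split[OF g_meas riesz_int[OF elim(2)]])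
    moreover have "riesz_potential \<mu> gl y = near gl + far gl" by (rule split[OF glm riesz_gl_int])
    ultimately show ?case using elim(1) far_n[of n] far_l unfolding dist_norm real_norm_def by linarith
  qed
  then show "\<exists>no. \<forall>n\<ge>no. norm (riesz_potential \<mu> (g n) y - riesz_potential \<mu> gl y) < e"
    unfolding eventually_sequentially .
qed

lemma F_lim: "(\<lambda>n. F n y) \<longlonglongrightarrow> Fl y"
proof -
  have "(\<lambda>n. Wt n y * riesz_potential \<mu> (g n) y * g n y) \<longlonglongrightarrow> Fl y"
    unfolding Fl_def by (intro tendsto_intros W_lim riesz_lim g_lim)
  moreover have "\<forall>\<^sub>F n in sequentially. Wt n y * riesz_potential \<mu> (g n) y * g n y = F n y"
    using R_eventually[of "norm y"] by eventually_elim (simp add: F_eq)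
  ultimately show ?thesis by (rule Lim_transform_eventually)
qed

lemma riesz_gl_meas[measurable]: "riesz_potential \<mu> gl \<in> borel_measurable borel"
proof -
  have "riesz_potential \<mu> gl x = (LINT y|lborel. gl y / norm (x - y) powr \<mu>)" for x
    unfolding riesz_potential_def by (rule integral_completion) measurable
  then have "riesz_potential \<mu> gl = (\<lambda>x. LINT y|lborel. gl y / norm (x - y) powr \<mu>)" by auto
  then show ?thesis by simp
qed

lemma Fl_meas[measurable]: "Fl \<in> borel_measurable borel"
  unfolding Fl_def[abs_def] by measurable

lemma Fl_nonneg: "Fl y \<ge> 0"
proof (rule tendsto_lowerbound[OF F_lim])
  show "\<forall>\<^sub>F n in sequentially. 0 \<le> F n y"
    using R_eventually[of "norm y + 1"] by eventually_elim (rule F_bounds)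
qed simp

lemma F_cball_lim:
  shows "integrable lebesgue (\<lambda>y. indicator (cball 0 \<rho>) y * Fl y)"
    "(\<lambda>n. LINT y|lebesgue. indicator (cball 0 \<rho>) y * F n y) \<longlonglongrightarrow> (LINT y|lebesgue. indicator (cball 0 \<rho>) y * Fl y)"
proof -
  have m: "(\<lambda>y. indicator (cball 0 \<rho>) y * Fl y) \<in> borel_measurable lebesgue" by (rule borel_imp_lebesgue) measurable
  have l: "AE y in lebesgue. (\<lambda>n. indicator (cball 0 \<rho>) y * F n y) \<longlonglongrightarrow> indicator (cball 0 \<rho>) y * Fl y"
    by (intro AE_I2 tendsto_intros F_lim)
  have ev: "\<forall>\<^sub>F n in sequentially. (\<lambda>y. indicator (cball 0 \<rho>) y * F n y) \<in> borel_measurable lebesgue \<and>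
      (\<forall>y. \<bar>indicator (cball 0 \<rho>) y * F n y\<bar> \<le> indicator (cball 0 \<rho>) y * CF)"
    using R_eventually[of "\<rho> + 1"]
  proof eventually_elim
    case (elim n)
    have "(\<lambda>y. F n y * indicator (cball 0 \<rho>) y) \<in> borel_measurable lebesgue"
      using elim by (intro F_meas_sub[of \<rho>]) auto
    moreover have "\<bar>indicator (cball 0 \<rho>) y * F n y\<bar> \<le> indicator (cball 0 \<rho>) y * CF" for y
      using F_bounds[of y n] elim by (auto simp: indicator_def)
    ultimately show ?case by (simp add: mult.commute)
  qed
  show "integrable lebesgue (\<lambda>y. indicator (cball 0 \<rho>) y * Fl y)"
    "(\<lambda>n. LINT y|lebesgue. indicator (cball 0 \<rho>) y * F n y) \<longlonglongrightarrow> (LINT y|lebesgue. indicator (cball 0 \<rho>) y * Fl y)"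
    using integral_dominated_convergence_eventually[OF cball_indicator_int m ev l] by auto
qed

text \<open>Both integrals live on a fixed disc, where v n is bounded by the Lipschitz estimate and
  F n by \<open>CF\<close>; dominated convergence applies to each.\<close>

lemma rep_vl: "rep UNIV vl Fl"
  unfolding rep_def
proof (intro allI impI, elim conjE)
  fix x :: "real^2" and \<rho> :: real assume \<rho>: "0 < \<rho>"
  define r where "r = max 1 (norm x + \<rho>)"
  have r: "r \<ge> 1" "norm x + \<rho> \<le> r" by (auto simp: r_def)
  have nz: "norm z \<le> r" if "norm (x - z) \<le> \<rho>" for z
    using norm_triangle_ineq4[of x "x - z"] that r by simp
  have ev: "\<forall>\<^sub>F n in sequentially. (\<lambda>y. v n y * bump \<rho> x y) \<in> borel_measurable lebesgue \<and>
      (\<forall>y. \<bar>v n y * bump \<rho> x y\<bar> \<le> Lip * r * r * bump \<rho> x y)"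
    using R_eventually[of "4 * r + 1"]
  proof eventually_elim
    case (elim n)
    have "cball x \<rho> \<subseteq> cball 0 (R n)" using r elim by (auto simp: cball_subset_cball_iff)
    then have "integrable lebesgue (\<lambda>y. v n y * bump \<rho> x y)"
      by (intro integrable_eta_kernel[OF \<rho>] continuous_on_subset[OF v_cont])
    moreover have "\<bar>v n y * bump \<rho> x y\<bar> \<le> Lip * r * r * bump \<rho> x y" for y
    proof (cases "norm (x - y) \<le> \<rho>")
      case True
      have "\<bar>v n y\<bar> \<le> Lip * r * norm y"
        using v_Lipschitz[OF elim r(1) nz[OF True], of 0] v_0 r by simp
      also have "\<dots> \<le> Lip * r * r" using Lip_nonneg r nz[OF True] by (intro mult_left_mono) auto
      finally show ?thesis using eta_nonneg by (simp add: abs_mult mult_right_mono)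
    next
      case False
      then show ?thesis using eta_kernel_eq_0[OF \<rho>, of x y] by simp
    qed
    ultimately show ?case by auto
  qed
  have iw: "integrable lebesgue (\<lambda>y. Lip * r * r * bump \<rho> x y)"
    by (rule integrable_eta_kernel[OF \<rho>]) auto
  have m: "(\<lambda>y. vl y * bump \<rho> x y) \<in> borel_measurable lebesgue" by (rule borel_imp_lebesgue) measurable
  have l: "AE y in lebesgue. (\<lambda>n. v n y * bump \<rho> x y) \<longlonglongrightarrow> vl y * bump \<rho> x y"
    by (intro AE_I2 tendsto_intros v_lim)
  note D1 = integral_dominated_convergence_eventually[OF iw m ev l]
  have ev2: "\<forall>\<^sub>F n in sequentially. (\<lambda>y. F n y * Green \<rho> x y) \<in> borel_measurable lebesgue \<and>
      (\<forall>y. \<bar>F n y * Green \<rho> x y\<bar> \<le> CF * Green \<rho> x y)"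
    using R_eventually[of "norm x + \<rho> + 1"]
  proof eventually_elim
    case (elim n)
    have "\<bar>F n y * Green \<rho> x y\<bar> \<le> CF * Green \<rho> x y" for y
    proof (cases "norm (x - y) \<le> \<rho>")
      case True
      then show ?thesis using F_le_on_ball[OF elim True] Gam_nonneg[of "norm (x - y) / \<rho>"] \<rho>
        by (simp add: abs_mult mult_right_mono)
    next
      case False
      then have "Green \<rho> x y = 0" using \<rho> by (intro Gam_eq_0) auto
      then show ?thesis by simp
    qed
    then show ?case using FGam_int[OF elim \<rho>] by auto
  qed
  have iw2: "integrable lebesgue (\<lambda>y. CF * Green \<rho> x y)"
    by (intro integrable_mult_right integrable_Gam \<rho>)
  have m2: "(\<lambda>y. Fl y * Green \<rho> x y) \<in> borel_measurable lebesgue" by (rule borel_imp_lebesgue) measurable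
  have l2: "AE y in lebesgue. (\<lambda>n. F n y * Green \<rho> x y) \<longlonglongrightarrow> Fl y * Green \<rho> x y"
    by (intro AE_I2 tendsto_intros F_lim)
  note D2 = integral_dominated_convergence_eventually[OF iw2 m2 ev2 l2]
  have "(\<lambda>n. 4 / \<rho>\<^sup>2 * (LINT y|lebesgue. v n y * bump \<rho> x y) + (LINT y|lebesgue. F n y * Green \<rho> x y))
      \<longlonglongrightarrow> 4 / \<rho>\<^sup>2 * (LINT y|lebesgue. vl y * bump \<rho> x y) + (LINT y|lebesgue. Fl y * Green \<rho> x y)"
    by (intro tendsto_intros D1(2) D2(2))
  moreover have "\<forall>\<^sub>F n in sequentially. 4 / \<rho>\<^sup>2 * (LINT y|lebesgue. v n y * bump \<rho> x y) + (LINT y|lebesgue. F n y * Green \<rho> x y) = 4 * eta_mass * v n x"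
    using R_eventually[of "norm x + \<rho>"]
  proof eventually_elim
    case (elim n)
    then have "cball x \<rho> \<subseteq> cball 0 (R n)" using \<rho> by (auto simp: cball_subset_cball_iff)
    then have "cball x \<rho> \<subseteq> S n" using S_sub by blast
    then show ?case using rep_v[of n] \<rho> unfolding rep_def by simp
  qed
  ultimately have "(\<lambda>n. 4 * eta_mass * v n x) \<longlonglongrightarrow> 4 / \<rho>\<^sup>2 * (LINT y|lebesgue. vl y * bump \<rho> x y) + (LINT y|lebesgue. Fl y * Green \<rho> x y)"
    by (rule Lim_transform_eventually)
  moreover have "(\<lambda>n. 4 * eta_mass * v n x) \<longlonglongrightarrow> 4 * eta_mass * vl x" by (intro tendsto_intros v_lim)
  ultimately show "integrable lebesgue (\<lambda>y. Fl y * Green \<rho> x y) \<and>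
     4 * eta_mass * vl x = 4 / \<rho>\<^sup>2 * (LINT y|lebesgue. vl y * bump \<rho> x y) + (LINT y|lebesgue. Fl y * Green \<rho> x y)"
    using D2(1) LIMSEQ_unique by blast
qed

text \<open>If every disc carried at most 4 / kappa - \<epsilon>, then Fl would be integrable with
  at most this mass, against \<open>mass_lower_bound\<close>. The contradiction hypothesis thus
  supplies the integrability that an entire solution requires.\<close>

lemma limit_mass:
  assumes "\<epsilon> > 0"
  obtains m :: nat where "(LINT y|lebesgue. indicator (cball 0 (real m)) y * Fl y) > 4 / kappa - \<epsilon>"
proof -
  have "\<exists>m::nat. (LINT y|lebesgue. indicator (cball 0 (real m)) y * Fl y) > 4 / kappa - \<epsilon>"
  proof (rule ccontr)
    assume "\<not> ?thesis"
    then have le: "(LINT y|lebesgue. indicator (cball 0 (real m)) y * Fl y) \<le> 4 / kappa - \<epsilon>" for m :: nat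
      by (simp add: not_less)
    have m: "Fl \<in> borel_measurable lebesgue" by (rule borel_imp_lebesgue) measurable
    note I = integrable_if_cball_bounded[OF m Fl_nonneg F_cball_lim(1) le]
    interpret E: entire_solution \<mu> lam W0 B vl Fl
    proof (unfold_locales; (fact \<mu> lam W0 vl_cont vl_le exp_vl_int rep_vl I(1))?)
      show "Fl x = W0 * riesz_potential \<mu> (\<lambda>y. exp (lam * vl y)) x * exp (lam * vl x)" for x
        by (simp add: Fl_def gl_def[abs_def])
    qed
    show False using E.mass_lower_bound I(2) assms unfolding E.\<beta>_def by linarith
  qed
  then show ?thesis using that by blast
qed

end

lemma (in blow_up) bubble_mass:
  assumes "\<epsilon> > 0"
  obtains k :: "nat \<Rightarrow> nat" and m :: nat where "strict_mono k"
    "\<forall>\<^sub>F n in sequentially. (LINT y|lebesgue. indicator (cball 0 (real m)) y * F (k n) y) > 4 / kappa - \<epsilon>"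
proof -
  obtain k where k: "strict_mono k" "\<And>x. convergent (\<lambda>n. v (k n) x)" using convergent_subsequence by blast
  interpret K: blow_up \<mu> lam b c0 B W0 "\<lambda>n. v (k n)" "\<lambda>n. g (k n)" "\<lambda>n. Wt (k n)" "\<lambda>n. F (k n)" "\<lambda>n. S (k n)" "\<lambda>n. R (k n)"
    by (rule subsequence[OF k(1)])
  interpret L: blow_up_limit \<mu> lam b c0 B W0 "\<lambda>n. v (k n)" "\<lambda>n. g (k n)" "\<lambda>n. Wt (k n)" "\<lambda>n. F (k n)" "\<lambda>n. S (k n)" "\<lambda>n. R (k n)" "\<lambda>x. lim (\<lambda>n. v (k n) x)"
    by unfold_locales (use k(2) in \<open>simp add: convergent_LIMSEQ_iff\<close>)
  obtain m :: nat where "(LINT y|lebesgue. indicator (cball 0 (real m)) y * L.Fl y) > 4 / kappa - \<epsilon>"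
    using L.limit_mass[OF assms] by blast
  from that[OF k(1) order_tendstoD(1)[OF L.F_cball_lim(2) this]] show ?thesis .
qed

section \<open>Rescaling around a blow-up point\<close>

text \<open>The dilation of the integrals contributes the factor r^2. Subtracting c is consistent
  because 4 / P^2 times the integral of the bump is 4 eta_mass.\<close>

lemma rep_rescale:
  assumes rep: "rep S u f" and r: "r > 0" and u: "continuous_on S u"
  shows "rep {y. x0 + r *\<^sub>R y \<in> S} (\<lambda>y. u (x0 + r *\<^sub>R y) - c) (\<lambda>y. r\<^sup>2 * f (x0 + r *\<^sub>R y))"
  unfolding rep_def
proof (intro allI impI, elim conjE)
  fix X :: "real^2" and P :: real
  assume P: "0 < P" and sub: "cball X P \<subseteq> {y. x0 + r *\<^sub>R y \<in> S}"
  let ?x = "x0 + r *\<^sub>R X" and ?T = "\<lambda>y. x0 + r *\<^sub>R y"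
  have rP: "r * P > 0" using r P by simp
  have T: "norm (?x - ?T y) / (r * P) = norm (X - y) / P" for y
  proof -
    have "?x - ?T y = r *\<^sub>R (X - y)" by (simp add: algebra_simps)
    then show ?thesis using r by simp
  qed
  have sub': "cball ?x (r * P) \<subseteq> S"
  proof
    fix p assume p: "p \<in> cball ?x (r * P)"
    define y where "y = (1 / r) *\<^sub>R (p - x0)"
    have py: "p = ?T y" using r by (simp add: y_def)
    have "norm (X - y) \<le> P" using p T[of y] r P unfolding py by (simp add: dist_norm field_simps)
    then show "p \<in> S" using sub py by (auto simp: dist_norm)
  qed
  have R: "integrable lebesgue (\<lambda>y. f y * Green (r * P) ?x y)"
    "4 * eta_mass * u ?x = 4 / (r * P)\<^sup>2 * (LINT y|lebesgue. u y * bump (r * P) ?x y)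
       + (LINT y|lebesgue. f y * Green (r * P) ?x y)"
    using rep rP sub' unfolding rep_def by blast+
  have i1: "integrable lebesgue (\<lambda>y. f (?T y) * Green P X y)"
    using R(1) integrable_lebesgue_scale[of r "\<lambda>y. f y * Green (r * P) ?x y" x0] r unfolding T by simp
  have e1: "(LINT y|lebesgue. f y * Green (r * P) ?x y) = r\<^sup>2 * (LINT y|lebesgue. f (?T y) * Green P X y)"
    using integral_lebesgue_scale[of r "\<lambda>y. f y * Green (r * P) ?x y" x0] r unfolding T by simp
  have e2: "(LINT y|lebesgue. u y * bump (r * P) ?x y) = r\<^sup>2 * (LINT y|lebesgue. u (?T y) * bump P X y)"
    using integral_lebesgue_scale[of r "\<lambda>y. u y * bump (r * P) ?x y" x0] r unfolding T by simp
  have "continuous_on (cball X P) (\<lambda>y. u (?T y))"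
    by (rule continuous_on_compose2[OF u]) (use sub in \<open>auto intro!: continuous_intros\<close>)
  then have iu: "integrable lebesgue (\<lambda>y. u (?T y) * bump P X y)"
    by (rule integrable_eta_kernel[OF P])
  have ic: "integrable lebesgue (\<lambda>y. c * bump P X y)"
    by (rule integrable_eta_kernel[OF P]) auto
  have e3: "(LINT y|lebesgue. (u (?T y) - c) * bump P X y) =
      (LINT y|lebesgue. u (?T y) * bump P X y) - c * (P\<^sup>2 * eta_mass)"
    unfolding left_diff_distrib using Bochner_Integration.integral_diff[OF iu ic] integral_eta_kernel[OF P, of X] by simp
  have i2: "integrable lebesgue (\<lambda>y. r\<^sup>2 * f (?T y) * Green P X y)"
    using integrable_mult_right[OF i1, of "r\<^sup>2"] by (simp only: mult.assoc)
  have e4: "(LINT y|lebesgue. r\<^sup>2 * f (?T y) * Green P X y) = r\<^sup>2 * (LINT y|lebesgue. f (?T y) * Green P X y)"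
    by (simp only: mult.assoc integral_mult_right_zero)
  have "4 * eta_mass * (u ?x - c) = 4 / P\<^sup>2 * (LINT y|lebesgue. (u (?T y) - c) * bump P X y)
       + (LINT y|lebesgue. r\<^sup>2 * f (?T y) * Green P X y)"
    using R(2) r P unfolding e1 e2 e3 e4 by (simp add: field_simps)
  with i2 show "integrable lebesgue (\<lambda>y. r\<^sup>2 * f (?T y) * Green P X y) \<and>
     4 * eta_mass * (u ?x - c) = 4 / P\<^sup>2 * (LINT y|lebesgue. (u (?T y) - c) * bump P X y)
       + (LINT y|lebesgue. r\<^sup>2 * f (?T y) * Green P X y)" by blast
qed

text \<open>x maximises (d - |x - z|) exp(u(x) / 2) over the disc, and \<sigma> is half of its
  distance to the boundary. Within \<sigma> of x the weight is still at least half of its value at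
  x, so exp(u / 2) at most doubles and u rises by at most 2 ln 2 = ln 4. Comparison with the centre
  z gives the remaining estimates.\<close>

lemma blow_up_point:
  fixes u :: "'a::euclidean_space \<Rightarrow> real"
  assumes u: "continuous_on (cball z d) u" and d: "d > 0"
  obtains x \<sigma> where "x \<in> cball z d" "0 < \<sigma>" "\<sigma> \<le> d" "u z \<le> u x" "\<sigma> * exp (u x / 2) \<ge> d / 2 * exp (u z / 2)"
    "\<And>y. norm (y - x) \<le> \<sigma> \<Longrightarrow> u y \<le> u x + ln 4"
proof -
  define h where "h x = (d - dist z x) * exp (u x / 2)" for x
  have hc: "continuous_on (cball z d) h" unfolding h_def by (auto intro!: continuous_intros u)
  obtain x where x: "x \<in> cball z d" "\<And>y. y \<in> cball z d \<Longrightarrow> h y \<le> h x"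
    using continuous_attains_sup[OF compact_cball _ hc] d by auto
  have hz: "h x \<ge> d * exp (u z / 2)" using x(2)[of z] d by (simp add: h_def)
  have t: "d - dist z x > 0"
  proof -
    have "h x > 0" using hz d by (smt (verit) exp_gt_zero mult_pos_pos)
    then show ?thesis by (simp add: h_def zero_less_mult_iff)
  qed
  define \<sigma> :: real where "\<sigma> = (d - dist z x) / 2"
  have \<sigma>2: "2 * \<sigma> = d - dist z x" by (simp add: \<sigma>_def)
  have "\<sigma> * exp (u x / 2) \<ge> d / 2 * exp (u z / 2)" using hz by (simp add: \<sigma>_def h_def)
  moreover have "u z \<le> u x"
  proof -
    have "(d - dist z x) * exp (u x / 2) \<le> d * exp (u x / 2)" by (intro mult_right_mono) auto
    then have "d * exp (u z / 2) \<le> d * exp (u x / 2)" using hz unfolding h_def by linarith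
    then show ?thesis using d by simp
  qed
  moreover have "u y \<le> u x + ln 4" if y: "norm (y - x) \<le> \<sigma>" for y
  proof -
    have dy: "dist z y \<le> dist z x + \<sigma>" using dist_triangle[of z y x] y by (simp add: dist_norm norm_minus_commute)
    then have "dist z y \<le> d" using t \<sigma>2 by linarith
    then have "y \<in> cball z d" by simp
    then have "(d - dist z y) * exp (u y / 2) \<le> 2 * \<sigma> * exp (u x / 2)"
      using x(2)[of y] by (simp add: h_def \<sigma>2)
    moreover have "\<sigma> * exp (u y / 2) \<le> (d - dist z y) * exp (u y / 2)"
      using dy \<sigma>2 by (intro mult_right_mono) auto
    ultimately have "\<sigma> * exp (u y / 2) \<le> \<sigma> * (2 * exp (u x / 2))" by linarith
    moreover have "\<sigma> > 0" using t \<sigma>2 by linarith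
    ultimately have "exp (u y / 2) \<le> 2 * exp (u x / 2)" by simp
    also have "\<dots> = exp (ln 2 + u x / 2)" by (simp add: exp_add)
    finally have "u y \<le> u x + 2 * ln 2" by simp
    also have "2 * ln 2 = ln (4 :: real)" using ln_realpow[of 2 2] by simp
    finally show ?thesis .
  qed
  moreover have "0 < \<sigma>" "\<sigma> \<le> d" using t \<sigma>2 d zero_le_dist[of z x] by linarith+
  ultimately show ?thesis using that x(1) by blast
qed

section \<open>Solutions of the original equation and their rescalings\<close>

locale hartree_solution =
  fixes \<omega> \<Omega> :: "(real^2) set" and \<mu> lam a b c0 :: real and V u :: "real^2 \<Rightarrow> real"
  assumes \<omega>: "open \<omega>" "\<omega> \<subseteq> \<Omega>" and \<mu>: "0 < \<mu>" "\<mu> < 2" and lam: "lam = (4 - \<mu>) / 4" and a: "0 < a"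
    and V: "\<And>x. x \<in> \<omega> \<Longrightarrow> a \<le> V x \<and> V x \<le> b"
    and u_cont: "continuous_on \<omega> u"
    and sol: "distributional_solution \<omega> u
      (\<lambda>x. V x * riesz_potential \<mu> (\<lambda>y. exp (lam * u y) * indicator \<Omega> y) x * exp (lam * u x))"
    and exp_int: "set_integrable lebesgue \<Omega> (\<lambda>x. exp (u x))"
    and exp_le: "(LINT x:\<Omega>|lebesgue. exp (u x)) \<le> c0"
begin

definition "f x = V x * riesz_potential \<mu> (\<lambda>y. exp (lam * u y) * indicator \<Omega> y) x * exp (lam * u x)"

lemma f_nonneg: "x \<in> \<omega> \<Longrightarrow> f x \<ge> 0"
  unfolding f_def riesz_potential_def using V a
  by (intro mult_nonneg_nonneg integral_nonneg_AE) (auto intro: order_trans[of 0 a])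

lemma rep_u: "rep \<omega> u f"
  using rep_if_distributional_solution[OF \<omega>(1) u_cont f_nonneg] sol by (simp add: f_def[abs_def])

lemma f_int: "integrable lebesgue (\<lambda>x. indicator \<omega> x * f x)"
  using sol by (simp add: distributional_solution_def set_integrable_def f_def)

text \<open>The equation is invariant under \<open>u \<mapsto> u (x + r y) + 2 ln r\<close>; the choice \<open>r = rad x\<close> makes the
  rescaled solution vanish at the origin.\<close>

definition "rad x = exp (- u x / 2)"
definition "pt x y = x + rad x *\<^sub>R y"
definition "v x y = u (pt x y) - u x"
definition "g x y = indicator \<Omega> (pt x y) * exp (lam * v x y)"
definition "F x y = (rad x)\<^sup>2 * f (pt x y)"

lemma rad_pos: "rad x > 0" by (simp add: rad_def)

lemma lam_pos: "lam > 0" using \<mu> lam by simp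

lemma v_0: "v x 0 = 0" by (simp add: v_def pt_def)

lemma rep_v: "rep {y. pt x y \<in> \<omega>} (v x) (F x)"
  using rep_rescale[OF rep_u rad_pos u_cont] unfolding pt_def v_def[abs_def] F_def[abs_def] .

text \<open>The power 1 / lam undoes the factor lam, and r^2 = exp(-u(x)) is the area factor of the
  dilation; hence the integral of exp u is preserved.\<close>

lemma g_powr: "g x y powr (1 / lam) = (rad x)\<^sup>2 * (indicator \<Omega> (pt x y) * exp (u (pt x y)))"
proof (cases "pt x y \<in> \<Omega>")
  case True
  have "exp (lam * v x y) powr (1 / lam) = exp (v x y)" using lam_pos by (simp add: powr_def)
  then have "g x y powr (1 / lam) = exp (v x y)" using True by (simp add: g_def)
  also have "\<dots> = (rad x)\<^sup>2 * exp (u (pt x y))"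
    by (simp add: v_def rad_def power2_eq_square flip: exp_add)
  finally show ?thesis using True by simp
qed (simp add: g_def)

lemma exp_int': "integrable lebesgue (\<lambda>z. indicator \<Omega> z * exp (u z))"
  using exp_int by (simp add: set_integrable_def)

lemma g_int: "integrable lebesgue (\<lambda>y. g x y powr (1 / lam))"
  unfolding g_powr pt_def
  using integrable_lebesgue_scale[of "rad x" "\<lambda>z. indicator \<Omega> z * exp (u z)" x] rad_pos[of x] exp_int'
  by (intro integrable_mult_right) simp

lemma g_le: "(LINT y|lebesgue. g x y powr (1 / lam)) \<le> c0"
proof -
  have "(LINT y|lebesgue. g x y powr (1 / lam)) = (LINT z|lebesgue. indicator \<Omega> z * exp (u z))"
    unfolding g_powr pt_def
    using integral_lebesgue_scale[of "rad x" "\<lambda>z. indicator \<Omega> z * exp (u z)" x] rad_pos[of x] by simp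
  then show ?thesis using exp_le by (simp add: set_lebesgue_integral_def)
qed

lemma g_nonneg: "g x y \<ge> 0" by (simp add: g_def)

text \<open>Off \<open>\<omega>\<close> measurability of u is available only through that of exp u,
  so g is recovered as a power of an integrable function.\<close>

lemma g_meas: "g x \<in> borel_measurable lebesgue"
proof -
  have "(g x y powr (1 / lam)) powr lam = g x y" for y using lam_pos g_nonneg by (simp add: powr_powr)
  then have "g x = (\<lambda>y. (g x y powr (1 / lam)) powr lam)" by auto
  moreover have "(\<lambda>y. (g x y powr (1 / lam)) powr lam) \<in> borel_measurable lebesgue"
    using borel_measurable_integrable[OF g_int[of x]] by measurable
  ultimately show ?thesis by simp
qed

lemma g_eq: "pt x y \<in> \<omega> \<Longrightarrow> g x y = exp (lam * v x y)"
  using \<omega>(2) by (auto simp: g_def indicator_def)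

lemma F_eq: "pt x y \<in> \<omega> \<Longrightarrow> F x y = V (pt x y) * riesz_potential \<mu> (g x) y * g x y"
proof -
  assume y: "pt x y \<in> \<omega>"
  let ?r = "rad x" and ?E = "exp (lam * u x)"
  have h: "exp (lam * u (pt x z)) * indicator \<Omega> (pt x z) = ?E * g x z" for z
    by (simp add: g_def v_def right_diff_distrib exp_diff)
  have n: "norm (pt x y - pt x z) powr \<mu> = ?r powr \<mu> * norm (y - z) powr \<mu>" for z
  proof -
    have "pt x y - pt x z = ?r *\<^sub>R (y - z)" by (simp add: pt_def algebra_simps)
    then show ?thesis using rad_pos[of x] by (simp add: powr_mult)
  qed
  have "riesz_potential \<mu> (\<lambda>z. exp (lam * u z) * indicator \<Omega> z) (pt x y) =
      ?r\<^sup>2 * (LINT z|lebesgue. exp (lam * u (pt x z)) * indicator \<Omega> (pt x z) / norm (pt x y - pt x z) powr \<mu>)"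
    unfolding riesz_potential_def
    using integral_lebesgue_scale[of ?r "\<lambda>z. exp (lam * u z) * indicator \<Omega> z / norm (pt x y - z) powr \<mu>" x] rad_pos[of x]
    by (simp add: pt_def)
  also have "\<dots> = ?r\<^sup>2 * (LINT z|lebesgue. (?E / ?r powr \<mu>) * (g x z / norm (y - z) powr \<mu>))"
    unfolding h n by simp
  also have "\<dots> = ?r\<^sup>2 * (?E / ?r powr \<mu>) * riesz_potential \<mu> (g x) y"
    unfolding riesz_potential_def by (simp only: integral_mult_right_zero mult.assoc)
  finally have R: "riesz_potential \<mu> (\<lambda>z. exp (lam * u z) * indicator \<Omega> z) (pt x y) = ?r\<^sup>2 * (?E / ?r powr \<mu>) * riesz_potential \<mu> (g x) y" .
  have G: "exp (lam * u (pt x y)) = ?E * g x y"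
    using h[of y] y \<omega>(2) by (auto simp: indicator_def)
  \<comment> \<open>The powers of exp(u(x)) balance: -1 from the factor r^2 in F, -1 from the area
    in the potential, \<mu> / 2 from the kernel and 2 lam from the two exponentials add up to
    0.\<close>
  have one: "?r\<^sup>2 * (?r\<^sup>2 * (?E / ?r powr \<mu>) * ?E) = 1"
  proof -
    have "?r\<^sup>2 = exp (- u x)" by (simp add: rad_def power2_eq_square flip: exp_add)
    moreover have "?r powr \<mu> = exp (- \<mu> * u x / 2)" by (simp add: rad_def powr_def)
    ultimately have "?r\<^sup>2 * (?r\<^sup>2 * (?E / ?r powr \<mu>) * ?E) = exp (- u x + (- u x + (lam * u x - (- \<mu> * u x / 2)) + lam * u x))"
      by (simp only: exp_add exp_diff)
    also have "- u x + (- u x + (lam * u x - (- \<mu> * u x / 2)) + lam * u x) = 0"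
      unfolding lam by (simp add: field_simps)
    finally show ?thesis by simp
  qed
  have "F x y = ?r\<^sup>2 * (?r\<^sup>2 * (?E / ?r powr \<mu>) * ?E) * (V (pt x y) * riesz_potential \<mu> (g x) y * g x y)"
    unfolding F_def f_def R G by (simp only: ac_simps)
  then show ?thesis unfolding one by simp
qed

lemma F_nonneg: "pt x y \<in> \<omega> \<Longrightarrow> F x y \<ge> 0"
  unfolding F_def using f_nonneg by simp

lemma F_meas:
  assumes "\<And>y. norm y \<le> R \<Longrightarrow> pt x y \<in> \<omega>"
  shows "(\<lambda>y. indicator (cball 0 R) y * F x y) \<in> borel_measurable lebesgue"
proof -
  have "integrable lebesgue (\<lambda>y. indicator \<omega> (pt x y) * f (pt x y))"
    unfolding pt_def using integrable_lebesgue_scale[of "rad x" "\<lambda>z. indicator \<omega> z * f z" x] rad_pos[of x] f_int by simp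
  then have "(\<lambda>y. indicator (cball 0 R) y * ((rad x)\<^sup>2 * (indicator \<omega> (pt x y) * f (pt x y)))) \<in> borel_measurable lebesgue"
    by (intro borel_measurable_times borel_measurable_integrable borel_imp_lebesgue[OF borel_measurable_indicator]) auto
  moreover have "(\<lambda>y. indicator (cball 0 R) y * ((rad x)\<^sup>2 * (indicator \<omega> (pt x y) * f (pt x y)))) = (\<lambda>y. indicator (cball 0 R) y * F x y)"
    using assms by (auto simp: fun_eq_iff indicator_def F_def)
  ultimately show ?thesis by simp
qed

text \<open>exp(i) times the area of \<open>\<omega>\<close> is at most c0. Since the infimum cannot
  be large, a violation of the estimate forces large values of u on K.\<close>

lemma inf_le:
  assumes i: "\<And>x. x \<in> \<omega> \<Longrightarrow> i \<le> u x" and ne: "\<omega> \<noteq> {}" and bd: "bounded \<omega>"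
  shows "i \<le> ln (c0 / measure lebesgue \<omega>)"
proof -
  have lm: "\<omega> \<in> lmeasurable" using bd \<omega>(1) by (rule lmeasurable_open)
  obtain x e where xe: "e > 0" "ball x e \<subseteq> \<omega>" using ne \<omega>(1) by (meson all_not_in_conv open_contains_ball)
  have "0 < measure lebesgue (ball x e)" using xe(1) by (simp add: measure_completion)
  also have "\<dots> \<le> measure lebesgue \<omega>" using lm xe(2) by (intro measure_mono_fmeasurable) auto
  finally have pos: "measure lebesgue \<omega> > 0" .
  have io: "integrable lebesgue (indicator \<omega> :: real^2 \<Rightarrow> real)"
    using fmeasurableD[OF lm] fmeasurableD2[OF lm] by (intro integrable_real_indicator) (auto simp: top.not_eq_extremum)
  have "exp i * measure lebesgue \<omega> = (LINT x|lebesgue. exp i * indicator \<omega> x)"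
    by simp
  also have "\<dots> \<le> (LINT x|lebesgue. indicator \<Omega> x * exp (u x))"
    by (rule integral_mono[OF integrable_mult_right[OF io] exp_int']) (use i \<omega>(2) in \<open>auto simp: indicator_def\<close>)
  also have "\<dots> \<le> c0" using exp_le by (simp add: set_lebesgue_integral_def)
  finally have "exp i \<le> c0 / measure lebesgue \<omega>" using pos by (simp add: field_simps)
  then have "ln (exp i) \<le> ln (c0 / measure lebesgue \<omega>)"
    using less_le_trans[OF exp_gt_zero] by (subst ln_le_cancel_iff) auto
  then show ?thesis by simp
qed

text \<open>The representation at the origin on the disc of rescaled radius P = d / rad x, with left
  side 0 because v x 0 = 0. The average of v is at least i - u(x). On the disc of radius m, which
  carries mass \<beta>, the kernel is at least \<gamma>, since ln P = ln d + u(x) / 2; elsewhere the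
  integrand is nonnegative.\<close>

lemma inf_upper_bound:
  assumes i: "\<And>z. z \<in> \<omega> \<Longrightarrow> i \<le> u z" and d: "d > 0" "cball x d \<subseteq> \<omega>" and m: "0 < m" "m \<le> d / rad x"
    and mass: "(LINT y|lebesgue. indicator (cball 0 m) y * F x y) \<ge> \<beta>"
    and \<gamma>: "\<gamma> = Lg 0 + theta * u x + 2 * theta * (ln d - ln m)" "\<gamma> \<ge> 0"
  shows "4 * eta_mass * (i - u x) \<le> - \<gamma> * \<beta>"
proof -
  define P where "P = d / rad x"
  have P: "P > 0" using d rad_pos[of x] by (simp add: P_def)
  have inw: "pt x y \<in> \<omega>" if "norm y \<le> P" for y
  proof -
    have "norm (pt x y - x) \<le> d" using that rad_pos[of x] by (simp add: pt_def P_def field_simps)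
    then show ?thesis using d(2) by (auto simp: dist_norm norm_minus_commute)
  qed
  have sub: "cball 0 P \<subseteq> {y. pt x y \<in> \<omega>}" using inw by auto
  have R: "integrable lebesgue (\<lambda>y. F x y * Green P 0 y)"
    "4 * eta_mass * v x 0 = 4 / P\<^sup>2 * (LINT y|lebesgue. v x y * bump P 0 y)
       + (LINT y|lebesgue. F x y * Green P 0 y)"
    using rep_v[of x] sub P unfolding rep_def by blast+
  have "continuous_on (cball 0 P) (v x)"
    unfolding v_def[abs_def]
    by (intro continuous_intros continuous_on_compose2[OF u_cont]) (use sub in \<open>auto simp: pt_def intro!: continuous_intros\<close>)
  then have iv: "integrable lebesgue (\<lambda>y. v x y * bump P 0 y)" by (rule integrable_eta_kernel[OF P])
  have ic: "integrable lebesgue (\<lambda>y::real^2. (i - u x) * bump P 0 y)"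
    by (rule integrable_eta_kernel[OF P]) auto
  have "(i - u x) * (P\<^sup>2 * eta_mass) = (LINT y|lebesgue. (i - u x) * bump P 0 (y :: real^2))"
    using integral_eta_kernel[OF P, of 0] by simp
  also have "\<dots> \<le> (LINT y|lebesgue. v x y * bump P 0 y)"
  proof (rule integral_mono[OF ic iv])
    fix y :: "real^2"
    show "(i - u x) * bump P 0 y \<le> v x y * bump P 0 y"
    proof (cases "norm y \<le> P")
      case True
      then show ?thesis using i[OF inw[OF True]] eta_nonneg by (intro mult_right_mono) (auto simp: v_def)
    next
      case False
      then have "bump P 0 y = 0" using eta_kernel_eq_0[OF P, of 0 y] by simp
      then show ?thesis by simp
    qed
  qed
  finally have 1: "4 * eta_mass * (i - u x) \<le> 4 / P\<^sup>2 * (LINT y|lebesgue. v x y * bump P 0 y)"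
    using P by (simp add: field_simps)
  have mP: "m \<le> P" using m by (simp add: P_def)
  have lnP: "ln P = ln d + u x / 2" using d by (simp add: P_def rad_def ln_div)
  have Fm: "integrable lebesgue (\<lambda>y. indicator (cball 0 m) y * F x y)"
  proof (rule Bochner_Integration.integrable_bound)
    have "integrable lebesgue (\<lambda>y. indicator \<omega> (pt x y) * f (pt x y))"
      unfolding pt_def using integrable_lebesgue_scale[of "rad x" "\<lambda>z. indicator \<omega> z * f z" x] rad_pos[of x] f_int by simp
    then show "integrable lebesgue (\<lambda>y. (rad x)\<^sup>2 * (indicator \<omega> (pt x y) * f (pt x y)))" by simp
    show "(\<lambda>y. indicator (cball 0 m) y * F x y) \<in> borel_measurable lebesgue"
      using inw mP by (intro F_meas) auto
    show "AE y in lebesgue. norm (indicator (cball 0 m) y * F x y) \<le> norm ((rad x)\<^sup>2 * (indicator \<omega> (pt x y) * f (pt x y)))"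
      using inw mP by (intro AE_I2) (auto simp: indicator_def F_def)
  qed
  have "\<gamma> * \<beta> \<le> \<gamma> * (LINT y|lebesgue. indicator (cball 0 m) y * F x y)"
    using mass \<gamma>(2) by (rule mult_left_mono)
  also have "\<dots> = (LINT y|lebesgue. \<gamma> * (indicator (cball 0 m) y * F x y))" by simp
  also have "\<dots> \<le> (LINT y|lebesgue. F x y * Green P 0 y)"
  proof (rule integral_mono_AE[OF _ R(1)])
    show "integrable lebesgue (\<lambda>y. \<gamma> * (indicator (cball 0 m) y * F x y))" using Fm by simp
    show "AE y in lebesgue. \<gamma> * (indicator (cball 0 m) y * F x y) \<le> F x y * Green P 0 y"
      using AE_lebesgue_neq[of 0]
    proof eventually_elim
      case (elim y)
      consider "norm y \<le> m" | "m < norm y" "norm y \<le> P" | "norm y > P" by linarith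
      then show ?case
      proof cases
        case 1
        have "\<gamma> = Lg 0 - 2 * theta * (ln m - ln P)" unfolding \<gamma>(1) lnP by (simp add: algebra_simps)
        also have "\<dots> \<le> Lg 0 - 2 * theta * ln (norm y / P)"
          using 1 elim m P theta_pos by (simp add: ln_div)
        also have "\<dots> \<le> Gam (norm y / P)" using elim P by (intro Gam_lower) auto
        finally show ?thesis using F_nonneg[OF inw, of y] 1 mP by (simp add: mult.commute mult_right_mono)
      next
        case 2
        then show ?thesis using F_nonneg[OF inw, of y] Gam_nonneg[of "norm y / P"] P by (simp add: indicator_def)
      next
        case 3
        then have "Green P 0 y = 0" using P by (intro Gam_eq_0) auto
        then show ?thesis using 3 mP by (simp add: indicator_def)
      qed
    qed
  qed
  finally show ?thesis using 1 R(2) v_0 by simp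
qed

end

text \<open>If K is empty or the infimum is minus infinity, the sum is minus infinity and the bound
  holds. A violation therefore comes with a point where the maximum is attained and a real
  infimum.\<close>

lemma sup_inf_violation:
  fixes u :: "'a::topological_space \<Rightarrow> real"
  assumes K: "compact K" "K \<subseteq> \<omega>" and ne: "\<omega> \<noteq> {}" and u: "continuous_on \<omega> u" and C: "C > 0"
    and viol: "\<not> (SUP x\<in>K. ereal (u x)) + ereal C * (INF x\<in>\<omega>. ereal (u x)) \<le> ereal N"
  shows "\<exists>z\<in>K. \<exists>i. (\<forall>x\<in>\<omega>. i \<le> u x) \<and> N < u z + C * i"
proof -
  let ?I = "INF x\<in>\<omega>. ereal (u x)"
  obtain x0 where x0: "x0 \<in> \<omega>" using ne by blast
  have I_le: "?I \<le> ereal (u x)" if "x \<in> \<omega>" for x using that by (rule INF_lower)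
  have "K \<noteq> {}"
  proof
    assume "K = {}"
    then have S: "(SUP x\<in>K. ereal (u x)) = - \<infinity>" by (simp add: bot_ereal_def)
    have "ereal C * ?I \<noteq> \<infinity>"
      using I_le[OF x0] C by (cases ?I) auto
    moreover have "- \<infinity> + y = - \<infinity>" if "y \<noteq> \<infinity>" for y :: ereal
      using that by (cases y) auto
    ultimately have eq: "(SUP x\<in>K. ereal (u x)) + ereal C * ?I = - \<infinity>"
      unfolding S by blast
    show False using viol unfolding eq by simp
  qed
  then obtain z where z: "z \<in> K" "\<And>x. x \<in> K \<Longrightarrow> u x \<le> u z"
    using continuous_attains_sup[OF K(1) _ continuous_on_subset[OF u K(2)]] by blast
  have S: "(SUP x\<in>K. ereal (u x)) \<le> ereal (u z)" using z(2) by (intro SUP_least) auto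
  have le: "(SUP x\<in>K. ereal (u x)) + ereal C * ?I \<le> ereal (u z) + ereal C * ?I"
    using S by (rule add_right_mono)
  obtain i where i: "?I = ereal i"
  proof (cases ?I)
    case (real i)
    then show ?thesis using that by blast
  next
    case PInf
    then show ?thesis using I_le[OF x0] by simp
  next
    case MInf
    then have eq: "ereal (u z) + ereal C * ?I = - \<infinity>" using C by simp
    have "(SUP x\<in>K. ereal (u x)) + ereal C * ?I \<le> ereal N"
      using le unfolding eq by (rule order_trans) simp
    then show ?thesis using viol by blast
  qed
  have "\<not> ereal (u z) + ereal C * ?I \<le> ereal N" using viol le order_trans by blast
  then have "N < u z + C * i" unfolding i by simp
  moreover have "\<forall>x\<in>\<omega>. i \<le> u x" using I_le unfolding i by simp
  ultimately show ?thesis using z(1) by blast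
qed

(* On omega, u is its continuous representative, so the supremum over K is a maximum (minus
   infinity if K is empty). The infimum over omega may be minus infinity, hence ereal. *)
theorem theorem1p2:
  fixes \<omega> K :: "(real^2) set" and \<mu> lam a b c\<^sub>0 C\<^sub>1 :: real
    and \<Lambda> :: "(real^2 \<Rightarrow> real) set"
  assumes "bounded_domain \<omega>"
    and "0 < \<mu>" and "\<mu> < 2" and "lam = (4 - \<mu>) / 4"
    and "0 < a" and "a \<le> b"
    and "\<Lambda> \<subseteq> Lambda_class a b \<omega>" and "equicontinuous_at_points \<omega> \<Lambda>"
    and "compact K" and "K \<subseteq> \<omega>" and "0 < c\<^sub>0" and "1 < C\<^sub>1"
  shows "\<exists>C\<^sub>2>0. \<forall>V\<in>\<Lambda>. \<forall>\<Omega> (u :: real^2 \<Rightarrow> real).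
           bounded_domain \<Omega> \<and> \<omega> \<subseteq> \<Omega> \<and>
           continuous_on \<omega> u \<and>
           distributional_solution \<omega> u
             (\<lambda>x. V x * riesz_potential \<mu> (\<lambda>y. exp (lam * u y) * indicator \<Omega> y) x
                    * exp (lam * u x)) \<and>
           set_integrable lebesgue \<Omega> (\<lambda>x. exp (u x)) \<and>
           (LINT x:\<Omega>|lebesgue. exp (u x)) \<le> c\<^sub>0
           \<longrightarrow> (SUP x\<in>K. ereal (u x)) + ereal C\<^sub>1 * (INF x\<in>\<omega>. ereal (u x)) \<le> ereal C\<^sub>2"
proof (rule ccontr)
  assume neg: "\<not> ?thesis"
  have \<omega>: "open \<omega>" "\<omega> \<noteq> {}" "bounded \<omega>" using assms(1) by (auto simp: bounded_domain_def)
  have C1: "C\<^sub>1 > 0" using assms by simp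
  \<comment> \<open>The candidates n + 1 are positive, as \<open>C\<^sub>2\<close> has to be, and
    unbounded; each is violated by a solution with its own \<open>\<Omega>\<close>.\<close>
  have "\<exists>V \<Omega> u z i. V \<in> \<Lambda> \<and> hartree_solution \<omega> \<Omega> \<mu> lam a b c\<^sub>0 V u \<and>
      z \<in> K \<and> (\<forall>x\<in>\<omega>. i \<le> u x) \<and> real n + 1 < u z + C\<^sub>1 * i" for n :: nat
  proof -
    have "real n + 1 > 0" by simp
    with neg obtain V \<Omega> u where V: "V \<in> \<Lambda>" and sol: "\<omega> \<subseteq> \<Omega>" "continuous_on \<omega> u"
      "distributional_solution \<omega> u (\<lambda>x. V x * riesz_potential \<mu> (\<lambda>y. exp (lam * u y) * indicator \<Omega> y) x * exp (lam * u x))"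
      "set_integrable lebesgue \<Omega> (\<lambda>x. exp (u x))" "(LINT x:\<Omega>|lebesgue. exp (u x)) \<le> c\<^sub>0"
      and viol: "\<not> (SUP x\<in>K. ereal (u x)) + ereal C\<^sub>1 * (INF x\<in>\<omega>. ereal (u x)) \<le> ereal (real n + 1)"
      by blast
    have "hartree_solution \<omega> \<Omega> \<mu> lam a b c\<^sub>0 V u"
    proof (unfold_locales; (fact \<omega>(1) sol assms(2-5))?)
      show "a \<le> V x \<and> V x \<le> b" if "x \<in> \<omega>" for x
        using V assms(7) that by (auto simp: Lambda_class_def)
    qed
    with V sup_inf_violation[OF assms(9,10) \<omega>(2) sol(2) C1 viol] show ?thesis by blast
  qed
  then obtain V \<Omega> u z i where V: "\<And>n. V n \<in> \<Lambda>" and sol: "\<And>n. hartree_solution \<omega> (\<Omega> n) \<mu> lam a b c\<^sub>0 (V n) (u n)"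
    and z: "\<And>n. z n \<in> K" and i: "\<And>n x. x \<in> \<omega> \<Longrightarrow> i n \<le> u n x" and big: "\<And>n::nat. real n + 1 < u n (z n) + C\<^sub>1 * i n"
    by metis
  interpret H: hartree_solution \<omega> "\<Omega> n" \<mu> lam a b c\<^sub>0 "V n" "u n" for n by (rule sol)
  \<comment> \<open>The infima are bounded above in terms of \<open>\<omega>\<close> and
    \<open>c\<^sub>0\<close> alone, so the values of u at the points z n tend to infinity.\<close>
  define i0 where "i0 = ln (c\<^sub>0 / measure lebesgue \<omega>)"
  have i0: "i n \<le> i0" for n unfolding i0_def using H.inf_le[OF i \<omega>(2,3)] .
  have uz: "u n (z n) \<ge> real n - C\<^sub>1 * i0" for n
    using big[of n] mult_left_mono[OF i0[of n], of "C\<^sub>1"] C1 by linarith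
  obtain e where e: "e > 0" "(\<Union>x\<in>K. cball x e) \<subseteq> \<omega>"
    using compact_subset_open_imp_cball_epsilon_subset[OF assms(9) \<omega>(1) assms(10)] by blast
  \<comment> \<open>Half of e: the blow-up point lies within d of K, and the disc of radius d about
    it still lies in \<open>\<omega>\<close>.\<close>
  define d where "d = e / 2"
  have d: "d > 0" using e by (simp add: d_def)
  have Kd: "compact (\<Union>x\<in>K. cball x d)" "(\<Union>x\<in>K. cball x d) \<subseteq> \<omega>"
  proof -
    have "(\<Union>x\<in>K. cball x d) = {x + y |x y. x \<in> K \<and> y \<in> cball 0 d}"
    proof (intro set_eqI iffI)
      fix p assume "p \<in> (\<Union>x\<in>K. cball x d)"
      then obtain x where "x \<in> K" "norm (p - x) \<le> d" by (auto simp: dist_norm norm_minus_commute)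
      then have "p = x + (p - x) \<and> x \<in> K \<and> p - x \<in> cball 0 d" by simp
      then show "p \<in> {x + y |x y. x \<in> K \<and> y \<in> cball 0 d}" by blast
    next
      fix p assume "p \<in> {x + y |x y. x \<in> K \<and> y \<in> cball 0 d}"
      then obtain x y where "p = x + y" "x \<in> K" "norm y \<le> d" by auto
      then have "x \<in> K \<and> p \<in> cball x d" by (simp add: dist_norm)
      then show "p \<in> (\<Union>x\<in>K. cball x d)" by blast
    qed
    then show "compact (\<Union>x\<in>K. cball x d)" using compact_sums[OF assms(9) compact_cball[of 0 d]] by simp
    show "(\<Union>x\<in>K. cball x d) \<subseteq> \<omega>" using e by (force simp: d_def)
  qed
  have zc: "continuous_on (cball (z n) d) (u n)" for n
    using Kd(2) z by (intro continuous_on_subset[OF H.u_cont]) blast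
  have "\<exists>x \<sigma>. x \<in> cball (z n) d \<and> 0 < \<sigma> \<and> \<sigma> \<le> d \<and> u n (z n) \<le> u n x \<and> \<sigma> * exp (u n x / 2) \<ge> d / 2 * exp (u n (z n) / 2)
      \<and> (\<forall>y. norm (y - x) \<le> \<sigma> \<longrightarrow> u n y \<le> u n x + ln 4)" for n
    using blow_up_point[OF zc d] by metis
  then obtain x \<sigma> where x: "\<And>n. x n \<in> cball (z n) d" and \<sigma>: "\<And>n. 0 < \<sigma> n" "\<And>n. \<sigma> n \<le> d"
    and ux: "\<And>n. u n (z n) \<le> u n (x n)" and \<sigma>x: "\<And>n. \<sigma> n * exp (u n (x n) / 2) \<ge> d / 2 * exp (u n (z n) / 2)"
    and ub: "\<And>n y. norm (y - x n) \<le> \<sigma> n \<Longrightarrow> u n y \<le> u n (x n) + ln 4"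
    by metis
  have xd: "cball (x n) d \<subseteq> \<omega>" for n
  proof
    fix p assume "p \<in> cball (x n) d"
    then have "dist (z n) p \<le> e" using dist_triangle[of "z n" p "x n"] x[of n] by (simp add: d_def)
    then have "p \<in> cball (z n) e" by simp
    then show "p \<in> \<omega>" using e(2) z[of n] by blast
  qed
  have M_lim: "filterlim (\<lambda>n. u n (x n)) at_top sequentially"
  proof (rule filterlim_at_top_mono)
    show "filterlim (\<lambda>n. real n - C\<^sub>1 * i0) at_top sequentially" by real_asymp
    show "\<forall>\<^sub>F n in sequentially. real n - C\<^sub>1 * i0 \<le> u n (x n)"
      using uz ux order_trans by (intro always_eventually) blast
  qed
  \<comment> \<open>The rescaled radius of the disc on which u exceeds its value at x n by at most
    ln 4. It is bounded below through the value at z n and so tends to infinity.\<close>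
  define R where "R n = \<sigma> n * exp (u n (x n) / 2)" for n
  have R_eq: "R n * H.rad n (x n) = \<sigma> n" for n
    by (simp add: R_def H.rad_def flip: exp_add)
  have R_lim: "filterlim R at_top sequentially"
  proof (rule filterlim_at_top_mono)
    show "filterlim (\<lambda>n. d / 2 * exp ((real n - C\<^sub>1 * i0) / 2)) at_top sequentially" using d by real_asymp
    show "\<forall>\<^sub>F n in sequentially. d / 2 * exp ((real n - C\<^sub>1 * i0) / 2) \<le> R n"
    proof (intro always_eventually allI)
      fix n
      have "d / 2 * exp ((real n - C\<^sub>1 * i0) / 2) \<le> d / 2 * exp (u n (z n) / 2)"
        using uz[of n] d by (intro mult_left_mono) auto
      then show "d / 2 * exp ((real n - C\<^sub>1 * i0) / 2) \<le> R n" using \<sigma>x[of n] by (simp add: R_def)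
    qed
  qed
  have R_pos: "R n > 0" for n using \<sigma> by (simp add: R_def)
  have ptR: "norm (H.pt n (x n) y - x n) \<le> \<sigma> n" if "norm y \<le> R n" for n y
  proof -
    have "norm (H.pt n (x n) y - x n) = H.rad n (x n) * norm y" using H.rad_pos[of n "x n"] by (simp add: H.pt_def)
    also have "\<dots> \<le> H.rad n (x n) * R n" using that H.rad_pos[of n "x n"] by (intro mult_left_mono) auto
    finally show ?thesis using R_eq[of n] by (simp add: mult.commute)
  qed
  have pt\<omega>: "H.pt n (x n) y \<in> \<omega>" if "norm y \<le> R n" for n y
    using ptR[OF that] \<sigma>(2)[of n] xd[of n] by (auto simp: dist_norm norm_minus_commute)
  have xK: "x n \<in> (\<Union>x\<in>K. cball x d)" for n using x z by blast
  obtain x0 s1 where s1: "x0 \<in> (\<Union>x\<in>K. cball x d)" "strict_mono s1" "(\<lambda>n. x (s1 n)) \<longlonglongrightarrow> x0"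
    using Kd(1) xK unfolding compact_def o_def by meson
  have x0: "x0 \<in> \<omega>" using s1(1) Kd(2) by blast
  have V_bd: "a \<le> V n p \<and> V n p \<le> b" if "p \<in> \<omega>" for n p using H.V[OF that] .
  obtain W0 s2 where s2: "W0 \<in> {a..b}" "strict_mono s2" "(\<lambda>n. V (s1 (s2 n)) x0) \<longlonglongrightarrow> W0"
  proof -
    have "\<forall>n. V (s1 n) x0 \<in> {a..b}" using V_bd[OF x0] by auto
    then show ?thesis using that compact_Icc[of a b] unfolding compact_def o_def by meson
  qed
  define s where "s n = s1 (s2 n)" for n
  have s: "strict_mono s" unfolding s_def using strict_mono_o[OF s1(2) s2(2)] by (simp add: o_def)
  have xs: "(\<lambda>n. x (s n)) \<longlonglongrightarrow> x0" unfolding s_def using LIMSEQ_subseq_LIMSEQ[OF s1(3) s2(2)] by (simp add: o_def)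
  have rad_lim: "(\<lambda>n. H.rad n (x n)) \<longlonglongrightarrow> 0"
  proof -
    have "((\<lambda>t::real. exp (- t / 2)) \<longlongrightarrow> 0) at_top" by real_asymp
    then show ?thesis unfolding H.rad_def using M_lim by (rule filterlim_compose)
  qed
  \<comment> \<open>For every y the unscaled points converge to x0, and equicontinuity at this one
    point compares V there with V at x0, uniformly over the family. Hence the limit does not depend
    on y.\<close>
  have W_lim: "(\<lambda>n. V (s n) (H.pt (s n) (x (s n)) y)) \<longlonglongrightarrow> W0" for y
  proof -
    have "(\<lambda>n. x (s n) + H.rad (s n) (x (s n)) *\<^sub>R y) \<longlonglongrightarrow> x0 + 0 *\<^sub>R y"
      using LIMSEQ_subseq_LIMSEQ[OF rad_lim s] by (intro tendsto_intros xs) (simp add: o_def)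
    then have p: "(\<lambda>n. H.pt (s n) (x (s n)) y) \<longlonglongrightarrow> x0" by (simp add: H.pt_def)
    have "(\<lambda>n. V (s n) (H.pt (s n) (x (s n)) y) - V (s n) x0) \<longlonglongrightarrow> 0"
    proof (rule LIMSEQ_I)
      fix \<epsilon> :: real assume \<epsilon>: "\<epsilon> > 0"
      obtain \<delta> where \<delta>: "\<delta> > 0" "\<And>V y. V \<in> \<Lambda> \<Longrightarrow> y \<in> \<omega> \<Longrightarrow> dist y x0 < \<delta> \<Longrightarrow> dist (V y) (V x0) < \<epsilon>"
        using assms(8) x0 \<epsilon> unfolding equicontinuous_at_points_def by blast
      have "\<forall>\<^sub>F n in sequentially. dist (H.pt (s n) (x (s n)) y) x0 < \<delta>" using p \<delta>(1) by (rule tendstoD)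
      moreover have "\<forall>\<^sub>F n in sequentially. H.pt (s n) (x (s n)) y \<in> \<omega>" using p \<omega>(1) x0 by (rule topological_tendstoD)
      ultimately have "\<forall>\<^sub>F n in sequentially. norm (V (s n) (H.pt (s n) (x (s n)) y) - V (s n) x0 - 0) < \<epsilon>"
        by eventually_elim (use \<delta>(2) V in \<open>auto simp: dist_norm\<close>)
      then show "\<exists>no. \<forall>n\<ge>no. norm (V (s n) (H.pt (s n) (x (s n)) y) - V (s n) x0 - 0) < \<epsilon>"
        unfolding eventually_sequentially .
    qed
    from tendsto_add[OF this s2(3)[folded s_def]] show ?thesis by simp
  qed
  interpret B: blow_up \<mu> lam b c\<^sub>0 "ln 4" W0 "\<lambda>n. H.v (s n) (x (s n))" "\<lambda>n. H.g (s n) (x (s n))"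
    "\<lambda>n y. V (s n) (H.pt (s n) (x (s n)) y)" "\<lambda>n. H.F (s n) (x (s n))" "\<lambda>n. {y. H.pt (s n) (x (s n)) y \<in> \<omega>}" "\<lambda>n. R (s n)"
  proof unfold_locales
    show "0 < W0" using s2(1) assms(5) by simp
    show "filterlim (\<lambda>n. R (s n)) at_top sequentially" by (rule filterlim_compose[OF R_lim filterlim_subseq[OF s]])
    show "continuous_on (cball 0 (R (s n))) (H.v (s n) (x (s n)))" for n
      unfolding H.v_def[abs_def]
      by (intro continuous_intros continuous_on_compose2[OF H.u_cont])
         (use pt\<omega>[of _ "s n"] in \<open>auto simp: H.pt_def intro!: continuous_intros\<close>)
    show "H.v (s n) (x (s n)) y \<le> ln 4" if "norm y \<le> R (s n)" for n y
      using ub[OF ptR[OF that]] by (simp add: H.v_def)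
    show "(\<lambda>y. indicator (cball 0 (R (s n))) y * H.F (s n) (x (s n)) y) \<in> borel_measurable lebesgue" for n
      by (rule H.F_meas) (rule pt\<omega>)
    show "0 \<le> V (s n) (H.pt (s n) (x (s n)) y) \<and> V (s n) (H.pt (s n) (x (s n)) y) \<le> b" if "norm y \<le> R (s n)" for n y
      using V_bd[OF pt\<omega>[OF that], of "s n"] assms(5) by auto
  qed (use assms R_pos H.v_0 H.g_meas H.g_nonneg H.g_int H.g_le H.g_eq H.F_eq H.rep_v pt\<omega> W_lim in auto)
  \<comment> \<open>The mass with kappa \<beta> / 2 = 1 + 1 / \<open>C\<^sub>1\<close>, for which
    \<open>inf_upper_bound\<close> yields \<open>C\<^sub>1\<close> times the infimum at most -u(x n)
    plus a constant. It lies below 4 / kappa because \<open>C\<^sub>1\<close> > 1, and \<epsilon> is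
    the gap.\<close>
  define \<beta> where "\<beta> = (2 + 2 / C\<^sub>1) / kappa"
  define \<epsilon> where "\<epsilon> = (2 - 2 / C\<^sub>1) / kappa"
  have \<beta>: "\<beta> > 0" using C1 kappa_pos by (simp add: \<beta>_def add_pos_pos)
  have "2 / C\<^sub>1 < 2" using assms(12) by (simp add: divide_less_eq)
  then have \<epsilon>: "\<epsilon> > 0" unfolding \<epsilon>_def using kappa_pos by (intro divide_pos_pos) auto
  have \<beta>\<epsilon>: "4 / kappa - \<epsilon> = \<beta>" by (simp add: \<beta>_def \<epsilon>_def flip: diff_divide_distrib)
  obtain k m where k: "strict_mono (k :: nat \<Rightarrow> nat)"
    and mass: "\<forall>\<^sub>F n in sequentially. (LINT y|lebesgue. indicator (cball 0 (real m)) y * H.F (s (k n)) (x (s (k n))) y) > \<beta>"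
    using B.bubble_mass[OF \<epsilon>] unfolding \<beta>\<epsilon> by blast
  define j where "j n = s (k n)" for n
  have j: "strict_mono j" unfolding j_def using strict_mono_o[OF s k] by (simp add: o_def)
  \<comment> \<open>Required for ln m: a disc of radius 0 is a null set and carries no mass.\<close>
  have m: "real m > 0"
  proof (rule ccontr)
    assume "\<not> real m > 0"
    then have m0: "m = 0" by simp
    have "(LINT y|lebesgue. indicator (cball 0 (real m)) y * H.F n p y) = 0" for n p
      unfolding m0 by (rule integral_eq_zero_AE, rule eventually_mono[OF AE_lebesgue_neq[of 0]]) (simp add: indicator_def)
    then show False using mass \<beta> by simp
  qed
  have Mj: "filterlim (\<lambda>n. u (j n) (x (j n))) at_top sequentially"
    using filterlim_compose[OF M_lim filterlim_subseq[OF j]] .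
  \<comment> \<open>The part of \<gamma> in \<open>inf_upper_bound\<close> that does not depend on
    n.\<close>
  define c1 where "c1 = Lg 0 + 2 * theta * (ln d - ln (real m))"
  have e1: "\<forall>\<^sub>F n in sequentially. - c1 / theta \<le> u (j n) (x (j n))"
    and e2: "\<forall>\<^sub>F n in sequentially. 2 * (ln (real m) - ln d) \<le> u (j n) (x (j n))"
    using Mj unfolding filterlim_at_top by blast+
  have "\<forall>\<^sub>F n in sequentially. real n \<le> - (c1 / theta) * (C\<^sub>1 + 1)"
    using mass e1 e2
  proof eventually_elim
    case (elim n)
    let ?M = "u (j n) (x (j n))"
    have g0: "theta * ?M + c1 \<ge> 0" using elim(2) theta_pos by (simp add: field_simps)
    have md: "real m \<le> d / H.rad (j n) (x (j n))"
    proof -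
      have "ln (real m) \<le> ln d + ?M / 2" using elim(3) by simp
      then have "exp (ln (real m)) \<le> exp (ln d + ?M / 2)" by simp
      moreover have "exp (ln d + ?M / 2) = d / H.rad (j n) (x (j n))"
      proof -
        have "exp (ln d + ?M / 2) = exp (ln d) * exp (?M / 2)" by (rule exp_add)
        also have "\<dots> = d / inverse (exp (?M / 2))"
          by (simp only: exp_ln[OF d] divide_inverse[of d "inverse _"] inverse_inverse_eq)
        also have "inverse (exp (?M / 2)) = exp (- ?M / 2)" by (simp flip: exp_minus)
        finally show ?thesis unfolding H.rad_def .
      qed
      ultimately show ?thesis using m by simp
    qed
    have X: "4 * eta_mass * (i (j n) - ?M) \<le> - (theta * ?M + c1) * \<beta>"
    proof (rule H.inf_upper_bound[OF i d xd m md])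
      show "\<beta> \<le> (LINT y|lebesgue. indicator (cball 0 (real m)) y * H.F (j n) (x (j n)) y)"
        using elim(1) by (simp add: j_def)
      show "theta * ?M + c1 = Lg 0 + theta * ?M + 2 * theta * (ln d - ln (real m))" by (simp add: c1_def)
    qed (use g0 in auto)
    have E: "4 * eta_mass = 2 * theta / kappa" using theta_pos eta_mass_pos by (simp add: kappa_def)
    have "kappa * (2 * theta / kappa * (i (j n) - ?M)) \<le> kappa * (- (theta * ?M + c1) * \<beta>)"
      using X kappa_pos unfolding E by (intro mult_left_mono) auto
    moreover have "kappa * (2 * theta / kappa * (i (j n) - ?M)) = 2 * (theta * (i (j n) - ?M))"
      using kappa_pos by simp
    moreover have "kappa * (- (theta * ?M + c1) * \<beta>) = 2 * (- (theta * ?M + c1) * (1 + 1 / C\<^sub>1))"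
    proof -
      have "\<beta> = 2 * (1 + 1 / C\<^sub>1) / kappa" by (simp add: \<beta>_def)
      then show ?thesis using kappa_pos by simp
    qed
    \<comment> \<open>After multiplication by \<open>C\<^sub>1\<close> the terms in ?M combine to ?M
      + \<open>C\<^sub>1\<close> * i (j n), which is thus bounded by a constant, although by the
      choice of the sequence it exceeds j n + 1.\<close>
    ultimately have "theta * (i (j n) - ?M) \<le> - (theta * ?M + c1) * (1 + 1 / C\<^sub>1)"
      by linarith
    then have "C\<^sub>1 * (theta * (i (j n) - ?M)) \<le> C\<^sub>1 * (- (theta * ?M + c1) * (1 + 1 / C\<^sub>1))"
      using C1 by (intro mult_left_mono) auto
    also have "\<dots> = - (theta * ?M + c1) * (C\<^sub>1 + 1)" using C1 by (simp add: field_simps)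
    finally have "theta * (?M + C\<^sub>1 * i (j n)) \<le> - c1 * (C\<^sub>1 + 1)" by (simp add: algebra_simps)
    then have "?M + C\<^sub>1 * i (j n) \<le> - (c1 / theta) * (C\<^sub>1 + 1)" using theta_pos by (simp add: field_simps)
    moreover have "real (j n) + 1 < ?M + C\<^sub>1 * i (j n)" using big[of "j n"] ux[of "j n"] by linarith
    moreover have "real n \<le> real (j n)" using strict_mono_imp_increasing[OF j, of n] by simp
    ultimately show ?case by linarith
  qed
  moreover have "\<forall>\<^sub>F n in sequentially. - (c1 / theta) * (C\<^sub>1 + 1) < real n"
    by real_asymp
  ultimately have "\<forall>\<^sub>F n in sequentially. False" by eventually_elim linarith
  then show False by simp
qed

end
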